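(* Let $n\geq 1$, $0<\varepsilon\leq 1$, $0\leq \rho\leq 1$ and $1\leq p<\infty$. Let $\omega:[0,\infty)\rightarrow[0,\infty)$ be a non-decreasing and bounded function such that $\int_{0}^{1}\omega(t)t^{-1}\,dt<\infty$. Let $\sigma:\mathbb{T}^n\times\mathbb{Z}^n\rightarrow\mathbb{C}$ be a symbol for which there is a constant $C>0$ such that $$|\partial_{x}^{\beta}\Delta_{\xi}^{\alpha}\sigma(x,\xi)|\leq C\,\omega(\langle\xi\rangle^{-\varepsilon})\,\langle\xi\rangle^{-\frac{n}{2}(1-\rho)-\rho|\alpha|},\qquad (x,\xi)\in\mathbb{T}^n\times\mathbb{Z}^n,$$ for all $\alpha,\beta\in\mathbb{N}^n$ with $|\alpha|\leq[\frac{n}{2}]+1$ and $|\beta|\leq[\frac{n}{p}]+1$. Then the periodic operator $\sigma(x,D)$ extends to a bounded operator on $L^p(\mathbb{T}^n)$.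
   Context: $\mathbb{T}^n=\mathbb{R}^n/\mathbb{Z}^n$ with normalized Lebesgue measure; $\mathbb{N}=\{0,1,2,\dots\}$; $[\cdot]$ denotes the integer part; $\langle\xi\rangle=(1+|\xi|^2)^{1/2}$. The toroidal Fourier transform is $\widehat{f}(\xi)=\int_{\mathbb{T}^n}e^{-i2\pi\langle x,\xi\rangle}f(x)\,dx$, $\xi\in\mathbb{Z}^n$. For $f:\mathbb{Z}^n\to\mathbb{C}$ and the canonical basis $(e_j)$, $(\Delta_{\xi_j}f)(\xi)=f(\xi+e_j)-f(\xi)$, and $\Delta_\xi^\alpha=\Delta_{\xi_1}^{\alpha_1}\cdots\Delta_{\xi_n}^{\alpha_n}$ for $\alpha\in\mathbb{N}^n$. The symbol is understood to have the $x$-derivatives appearing in the hypothesis (continuous in $x$). The periodic operator with symbol $\sigma$ is $\sigma(x,D)f(x)=\sum_{\xi\in\mathbb{Z}^n}e^{i2\pi\langle x,\xi\rangle}\sigma(x,\xi)\widehat{f}(\xi)$ for $f\in C^\infty(\mathbb{T}^n)$. *)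

theory Defs
  imports "HOL-Analysis.Analysis"
begin

text \<open>
  Functions on the torus are \<open>\<int>^n\<close>-periodic functions on \<open>real ^ 'n\<close>, with \<open>n = CARD('n)\<close>;
  integration over the torus is integration over the unit cube, which has Lebesgue measure 1.
\<close>

definition int_vec :: "int ^ 'n \<Rightarrow> real ^ 'n" where
  "int_vec k = (\<chi> i. of_int (k $ i))"

definition periodic :: "(real ^ 'n \<Rightarrow> complex) \<Rightarrow> bool" where
  "periodic f \<longleftrightarrow> (\<forall>x k. f (x + int_vec k) = f x)"

definition torus :: "(real ^ 'n) measure" where
  "torus = lebesgue_on (cbox 0 1)"

definition japanese :: "int ^ 'n \<Rightarrow> real" where
  "japanese \<xi> = sqrt (1 + (norm (int_vec \<xi>))\<^sup>2)"


subsection \<open>Multi-indices, partial derivatives, differences\<close>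

text \<open>
  The index type carries no order, so the factors of \<open>D\<^sub>1^\<alpha>\<^sub>1 \<cdots> D\<^sub>n^\<alpha>\<^sub>n\<close> are composed along an arbitrary
  enumeration of the coordinates. The choice is irrelevant for difference operators and, on
  \<open>C^k\<close> functions, for partial derivatives of order at most \<open>k\<close>.
\<close>

definition coords :: "'n::finite list" where
  "coords = (SOME js. distinct js \<and> set js = UNIV)"

definition multi_op :: "('n \<Rightarrow> 'a \<Rightarrow> 'a) \<Rightarrow> nat ^ 'n \<Rightarrow> 'a \<Rightarrow> 'a" where
  "multi_op D \<alpha> = foldr (\<lambda>j. D j ^^ (\<alpha> $ j)) coords"

definition msize :: "nat ^ 'n \<Rightarrow> nat" where
  "msize \<alpha> = (\<Sum>i\<in>UNIV. \<alpha> $ i)"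

definition partial :: "'n \<Rightarrow> (real ^ 'n \<Rightarrow> complex) \<Rightarrow> real ^ 'n \<Rightarrow> complex" where
  "partial j f x = vector_derivative (\<lambda>t. f (x + t *\<^sub>R axis j 1)) (at 0)"

definition has_partial :: "'n \<Rightarrow> (real ^ 'n \<Rightarrow> complex) \<Rightarrow> bool" where
  "has_partial j f \<longleftrightarrow> (\<forall>x. (\<lambda>t. f (x + t *\<^sub>R axis j 1)) differentiable (at 0))"

definition diff_op :: "'n \<Rightarrow> (int ^ 'n \<Rightarrow> complex) \<Rightarrow> int ^ 'n \<Rightarrow> complex" where
  "diff_op j f \<xi> = f (\<xi> + axis j 1) - f \<xi>"

primrec C_k :: "nat \<Rightarrow> (real ^ 'n \<Rightarrow> complex) \<Rightarrow> bool" where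
  "C_k 0 f \<longleftrightarrow> continuous_on UNIV f"
| "C_k (Suc k) f \<longleftrightarrow> continuous_on UNIV f \<and> (\<forall>j. has_partial j f \<and> C_k k (partial j f))"

definition smooth_torus :: "(real ^ 'n \<Rightarrow> complex) set" where
  "smooth_torus = {f. periodic f \<and> (\<forall>k. C_k k f)}"


subsection \<open>Toroidal Fourier transform and periodic operators\<close>

definition fourier :: "(real ^ 'n \<Rightarrow> complex) \<Rightarrow> int ^ 'n \<Rightarrow> complex" where
  "fourier f \<xi> = (LINT x|torus. exp (- \<i> * 2 * pi * (x \<bullet> int_vec \<xi>)) * f x)"

definition periodic_op ::
    "(real ^ 'n \<Rightarrow> int ^ 'n \<Rightarrow> complex) \<Rightarrow> (real ^ 'n \<Rightarrow> complex) \<Rightarrow> real ^ 'n \<Rightarrow> complex" where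
  "periodic_op \<sigma> f x = (\<Sum>\<^sub>\<infinity>\<xi>\<in>UNIV. exp (\<i> * 2 * pi * (x \<bullet> int_vec \<xi>)) * \<sigma> x \<xi> * fourier f \<xi>)"


subsection \<open>Lebesgue spaces on the torus\<close>

text \<open>
  Elements of \<open>L^p\<close> are handled through representatives: equalities between them are
  required almost everywhere only.
\<close>

definition Lp :: "real \<Rightarrow> (real ^ 'n \<Rightarrow> complex) set" where
  "Lp p = {f. periodic f \<and> f \<in> borel_measurable torus \<and>
              integrable torus (\<lambda>x. norm (f x) powr p)}"

definition Lp_norm :: "real \<Rightarrow> (real ^ 'n \<Rightarrow> complex) \<Rightarrow> real" where
  "Lp_norm p f = (LINT x|torus. norm (f x) powr p) powr (1 / p)"

definition bounded_op_Lp ::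
    "real \<Rightarrow> ((real ^ 'n \<Rightarrow> complex) \<Rightarrow> real ^ 'n \<Rightarrow> complex) \<Rightarrow> bool" where
  "bounded_op_Lp p T \<longleftrightarrow>
     (\<forall>f\<in>Lp p. T f \<in> Lp p) \<and>
     (\<forall>f\<in>Lp p. \<forall>g\<in>Lp p. (AE x in torus. f x = g x) \<longrightarrow> (AE x in torus. T f x = T g x)) \<and>
     (\<forall>f\<in>Lp p. \<forall>g\<in>Lp p. AE x in torus. T (\<lambda>y. f y + g y) x = T f x + T g x) \<and>
     (\<forall>c. \<forall>f\<in>Lp p. AE x in torus. T (\<lambda>y. c * f y) x = c * T f x) \<and>
     (\<exists>B. \<forall>f\<in>Lp p. Lp_norm p (T f) \<le> B * Lp_norm p f)"

definition extends_to_bounded_op_Lp ::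
    "real \<Rightarrow> ((real ^ 'n \<Rightarrow> complex) \<Rightarrow> real ^ 'n \<Rightarrow> complex) \<Rightarrow> bool" where
  "extends_to_bounded_op_Lp p A \<longleftrightarrow>
     (\<exists>T. bounded_op_Lp p T \<and> (\<forall>f\<in>smooth_torus. AE x in torus. T f x = A f x))"

end

theory Submission
  imports Defs
begin

text \<open>
  Split the symbol dyadically, \<open>\<sigma> = \<Sum>\<^sub>j \<psi>\<^sub>j \<sigma>\<close> with \<open>\<psi>\<^sub>j\<close> supported where \<open>|\<xi>|\<close> is comparable to \<open>2^j\<close>. With the
  symbol frozen at \<open>z\<close>, each piece is convolution with a trigonometric polynomial, whose \<open>L^1\<close> norm is
  bounded by Cauchy-Schwarz against a weight at the scale \<open>R = 2^(- j \<rho>)\<close>: Parseval turns the weighted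
  \<open>L^2\<close> norm into differences of the symbol of order \<open>[n/2] + 1 > n/2\<close>, the powers of \<open>2^j\<close> cancel, and
  only \<open>\<omega>(c 2^(- j \<epsilon>))\<close> remains. The dependence of the symbol on \<open>x\<close> costs a supremum over \<open>z\<close>, which the
  Sobolev inequality replaces by \<open>L^p\<close> norms in \<open>z\<close> of at most \<open>[n/p] + 1 > n/p\<close> derivatives; then
  Young's inequality applies for each \<open>z\<close>. The Dini condition sums the pieces, and the sum is the
  bounded extension.
\<close>

section \<open>Integration over the torus\<close>

text \<open>It comes from averaging Taylor's formula over a unit cube: the remainder at dilation t
  carries t^(k-1), averaging over a cube of side t costs t^(-n/p), and the product is integrable at
  0 exactly when k > n/p. The scale R = 2^(-j \<rho>) is the one at which N differences of a piece
  gain the factor R^N that the weight divides out. Then R^n from the weight, about 2^(jn) lattice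
  points and about 2^(-jn(1-\<rho>)) from the squared symbol multiply to a constant. The bound on
  the symbol at \<xi> depends on the size of \<xi>, so an N-th difference is estimated on the N + 1
  points that it reads. If these meet the support of a piece, their brackets are at least \<Lambda>
  = 2^j / (2 (1 + N)), the scale behind all constants. The values \<Lambda>^(-\<epsilon>) form a
  geometric progression of ratio 2^(-\<epsilon>), and sampling \<omega> along it is what the Dini
  integral controls.\<close>

lemma space_torus [simp]: "space torus = cbox 0 1"
  by (simp add: torus_def)

lemma finite_measure_torus: "finite_measure (torus :: (real ^ 'n) measure)"
  unfolding torus_def by (intro finite_measure_lebesgue_on) simp

lemma emeasure_torus: "emeasure (torus :: (real ^ 'n) measure) (cbox 0 1) = 1"
proof -
  have "emeasure lborel (cbox 0 (1::real ^ 'n)) = (\<Prod>b\<in>Basis. (1 - 0 :: real ^ 'n) \<bullet> b)"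
    by (rule emeasure_lborel_cbox) (auto simp: Basis_vec_def inner_axis)
  also have "\<dots> = 1"
    by (intro arg_cong[where f = ennreal] prod.neutral ballI trans[OF _ ennreal_1])
       (auto simp: Basis_vec_def inner_axis)
  finally show ?thesis
    unfolding torus_def by (simp add: emeasure_restrict_space)
qed

lemma measure_torus [simp]: "measure (torus :: (real ^ 'n) measure) (cbox 0 1) = 1"
  by (simp add: measure_def emeasure_torus)

lemma borel_measurable_torus:
  "f \<in> borel_measurable borel \<Longrightarrow> f \<in> borel_measurable (torus :: (real ^ 'n) measure)"
  unfolding torus_def
  by (intro measurable_restrict_space1 measurable_completion) simp

lemma borel_measurable_torus_continuous:
  fixes f :: "real ^ 'n \<Rightarrow> 'b::topological_space"
  assumes "continuous_on UNIV f"
  shows "f \<in> borel_measurable torus"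
  using assms borel_measurable_continuous_onI borel_measurable_torus by blast

lemma nn_integral_torus:
  fixes f :: "real ^ 'n \<Rightarrow> ennreal"
  shows "(\<integral>\<^sup>+x. f x \<partial>torus) = (\<integral>\<^sup>+x. f x * indicator (cbox 0 1) x \<partial>lborel)"
  unfolding torus_def
  by (subst nn_integral_restrict_space) (auto simp: nn_integral_completion)

lemma integrable_torus_continuous:
  fixes f :: "real ^ 'n \<Rightarrow> 'b::{banach, second_countable_topology}"
  assumes "continuous_on UNIV f"
  shows "integrable torus f"
proof -
  have "compact (f ` cbox 0 1)"
    using assms by (intro compact_continuous_image) (auto intro: continuous_on_subset)
  then obtain B where B: "\<And>x. x \<in> cbox 0 1 \<Longrightarrow> norm (f x) \<le> B"
    by (meson bounded_iff compact_imp_bounded imageI)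
  show ?thesis
    by (rule finite_measure.integrable_const_bound[OF finite_measure_torus, where B = B])
       (use B in \<open>auto intro!: borel_measurable_torus_continuous assms AE_I2\<close>)
qed

text \<open>Half-open, because integer translates of the closed cube overlap in their faces. This
  cell meets each orbit exactly once and differs from the cube by a null set.\<close>

definition unit_cell :: "(real ^ 'n) set" where
  "unit_cell = {x. \<forall>i. 0 \<le> x $ i \<and> x $ i < 1}"

lemma unit_cell_borel [measurable]: "unit_cell \<in> sets borel"
proof -
  have "unit_cell = (\<Inter>i. {x :: real ^ 'n. 0 \<le> x $ i} \<inter> {x. x $ i < 1})"
    by (auto simp: unit_cell_def)
  also have "\<dots> \<in> sets borel"
    by (intro sets.finite_INT sets.Int borel_closed borel_open closed_Collect_le open_Collect_less)
       (auto intro!: continuous_intros)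
  finally show ?thesis .
qed

lemma AE_cbox_unit_cell:
  "AE x in lborel. x \<in> cbox 0 (1 :: real ^ 'n) \<longleftrightarrow> x \<in> unit_cell"
proof -
  have "AE x in lebesgue. \<not> x \<in> cbox 0 (1 :: real ^ 'n) - box 0 1"
    using negligible_frontier_interval[of 0 "1 :: real ^ 'n"]
    by (intro AE_not_in) (simp add: negligible_iff_null_sets)
  then have "AE x in lborel. \<not> x \<in> cbox 0 (1 :: real ^ 'n) - box 0 1"
    by (simp add: AE_completion_iff)
  then show ?thesis
  proof eventually_elim
    case (elim x)
    then show ?case
      by (auto simp: unit_cell_def mem_box_cart less_imp_le)
  qed
qed

lemma nn_integral_torus_unit_cell:
  fixes f :: "real ^ 'n \<Rightarrow> ennreal"
  shows "(\<integral>\<^sup>+x. f x \<partial>torus) = (\<integral>\<^sup>+x. f x * indicator unit_cell x \<partial>lborel)"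
  unfolding nn_integral_torus
  by (intro nn_integral_cong_AE, use AE_cbox_unit_cell in eventually_elim) (auto split: split_indicator)

lemma int_vec_nth [simp]: "int_vec k $ i = of_int (k $ i)"
  by (simp add: int_vec_def)

lemma int_vec_0 [simp]: "int_vec 0 = 0"
  by (simp add: vec_eq_iff)

lemma int_vec_add: "int_vec (k + l) = int_vec k + int_vec l"
  by (simp add: vec_eq_iff)

lemma int_vec_uminus: "int_vec (- k) = - int_vec k"
  by (simp add: vec_eq_iff)

lemma unit_cell_tiling: "\<exists>!k. x + int_vec k \<in> unit_cell"
proof (rule ex1I[of _ "\<chi> i. - \<lfloor>x $ i\<rfloor>"])
  show "x + int_vec (\<chi> i. - \<lfloor>x $ i\<rfloor>) \<in> unit_cell"
    by (auto simp: unit_cell_def) (linarith+)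
next
  fix k assume "x + int_vec k \<in> unit_cell"
  then have "k $ i = - \<lfloor>x $ i\<rfloor>" for i
    unfolding unit_cell_def by (simp, elim allE[of _ i], linarith)
  then show "k = (\<chi> i. - \<lfloor>x $ i\<rfloor>)"
    by (simp add: vec_eq_iff)
qed

lemma nn_integral_lborel_shift:
  fixes f :: "real ^ 'n \<Rightarrow> ennreal"
  assumes [measurable]: "f \<in> borel_measurable borel"
  shows "(\<integral>\<^sup>+x. f (x + a) \<partial>lborel) = (\<integral>\<^sup>+x. f x \<partial>lborel)"
proof -
  have "(\<integral>\<^sup>+x. f x \<partial>lborel) = (\<integral>\<^sup>+x. f x \<partial>distr lborel borel ((+) a))"
    by (simp add: lborel_distr_plus)
  also have "\<dots> = (\<integral>\<^sup>+x. f (x + a) \<partial>lborel)"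
    by (subst nn_integral_distr) (auto simp: add.commute)
  finally show ?thesis ..
qed


text \<open>The indicators of the translated cells sum to 1 at every point; Tonelli and a
  translation of each summand bring every cell back to the origin.\<close>

lemma nn_integral_lborel_tiling:
  fixes f :: "real ^ 'n \<Rightarrow> ennreal"
  assumes [measurable]: "f \<in> borel_measurable borel"
  shows "(\<integral>\<^sup>+x. f x \<partial>lborel) = 
    (\<integral>\<^sup>+k. (\<integral>\<^sup>+x. f (x - int_vec k) * indicator unit_cell x \<partial>lborel) \<partial>count_space UNIV)"
proof -
  have one: "(\<integral>\<^sup>+k. indicator unit_cell (x + int_vec k) \<partial>count_space UNIV) = (1::ennreal)" for x :: "real ^ 'n"
  proof -
    obtain k where k: "\<And>l. x + int_vec l \<in> unit_cell \<longleftrightarrow> l = k"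
      using unit_cell_tiling[of x] by metis
    have "(\<integral>\<^sup>+l. indicator unit_cell (x + int_vec l) \<partial>count_space UNIV)
       = (\<integral>\<^sup>+l. indicator {k} l \<partial>count_space (UNIV :: (int^'n) set))"
      by (intro nn_integral_cong) (auto simp: k split: split_indicator)
    then show ?thesis by simp
  qed
  have "(\<integral>\<^sup>+x. f x \<partial>lborel) = 
      (\<integral>\<^sup>+x. (\<integral>\<^sup>+k. f x * indicator unit_cell (x + int_vec k) \<partial>count_space UNIV) \<partial>lborel)"
    by (simp add: nn_integral_cmult one)
  also have "\<dots> = (\<integral>\<^sup>+k. (\<integral>\<^sup>+x. f x * indicator unit_cell (x + int_vec k) \<partial>lborel) \<partial>count_space UNIV)"
    by (subst nn_integral_count_space_nn_integral) auto
  also have "\<dots> = (\<integral>\<^sup>+k. (\<integral>\<^sup>+x. f (x - int_vec k) * indicator unit_cell x \<partial>lborel) \<partial>count_space UNIV)"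
    using nn_integral_lborel_shift[of "\<lambda>x. f (x - int_vec k) * indicator unit_cell x" "int_vec k" for k]
    by simp
  finally show ?thesis .
qed

text \<open>Moving the shift onto the cell replaces it by another fundamental domain. Tiling
  reassembles that domain inside \<open>unit_cell\<close>; by periodicity of \<open>f\<close> only
  the number of translates covering a point matters, and that is 1.\<close>

proposition nn_integral_torus_shift:
  fixes f :: "real ^ 'n \<Rightarrow> ennreal"
  assumes [measurable]: "f \<in> borel_measurable borel" and per: "\<And>x k. f (x + int_vec k) = f x"
  shows "(\<integral>\<^sup>+x. f (x + a) \<partial>torus) = (\<integral>\<^sup>+x. f x \<partial>torus)"
proof -
  have tile: "(\<integral>\<^sup>+k. indicator unit_cell (x - int_vec k) \<partial>count_space UNIV) = (1::ennreal)" for x :: "real ^ 'n"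
  proof -
    obtain k where k: "\<And>l. x + int_vec l \<in> unit_cell \<longleftrightarrow> l = k"
      using unit_cell_tiling[of x] by metis
    have "x - int_vec l \<in> unit_cell \<longleftrightarrow> l = - k" for l
      using k[of "- l"] by (auto simp: int_vec_uminus)
    then have "(\<integral>\<^sup>+l. indicator unit_cell (x - int_vec l) \<partial>count_space UNIV)
       = (\<integral>\<^sup>+l. indicator {- k} l \<partial>count_space (UNIV :: (int^'n) set))"
      by (intro nn_integral_cong) (auto split: split_indicator)
    then show ?thesis by simp
  qed
  have per': "f (x - int_vec k) = f x" for x k
    using per[of "x - int_vec k" k] by simp
  have "(\<integral>\<^sup>+x. f (x + a) \<partial>torus) = (\<integral>\<^sup>+x. f (x + a) * indicator unit_cell (x + a - a) \<partial>lborel)"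
    by (simp add: nn_integral_torus_unit_cell)
  also have "\<dots> = (\<integral>\<^sup>+x. f x * indicator unit_cell (x - a) \<partial>lborel)"
    by (rule nn_integral_lborel_shift) auto
  also have "\<dots> = (\<integral>\<^sup>+k. (\<integral>\<^sup>+x. f (x - int_vec k) * indicator unit_cell (x - int_vec k - a) * indicator unit_cell x \<partial>lborel) \<partial>count_space UNIV)"
    by (rule nn_integral_lborel_tiling) auto
  also have "\<dots> = (\<integral>\<^sup>+x. (\<integral>\<^sup>+k. f x * indicator unit_cell x * indicator unit_cell (x - a - int_vec k) \<partial>count_space UNIV) \<partial>lborel)"
    by (subst nn_integral_count_space_nn_integral) (auto simp: per' algebra_simps)
  also have "\<dots> = (\<integral>\<^sup>+x. f x * indicator unit_cell x \<partial>lborel)"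
    by (simp add: nn_integral_cmult tile)
  finally show ?thesis by (simp add: nn_integral_torus_unit_cell)
qed

text \<open>Positive and negative parts are again continuous and periodic, so the invariance of
  nonnegative integrals carries over.\<close>

lemma integral_torus_shift_real:
  fixes f :: "real ^ 'n \<Rightarrow> real"
  assumes cont: "continuous_on UNIV f" and per: "\<And>x k. f (x + int_vec k) = f x"
  shows "(LINT x|torus. f (x + a)) = (LINT x|torus. f x)"
proof -
  have pos: "(LINT x|torus. g (x + a)) = (LINT x|torus. g x)"
    if g: "continuous_on UNIV g" "\<And>x k. g (x + int_vec k) = g x" "\<And>x. 0 \<le> g x" for g :: "real ^ 'n \<Rightarrow> real"
  proof -
    have "continuous_on UNIV (\<lambda>x. g (x + a))"
      by (rule continuous_on_compose2[OF g(1)]) (auto intro!: continuous_intros)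
    then show ?thesis
      using g nn_integral_torus_shift[of "\<lambda>x. ennreal (g x)" a]
      by (simp add: integral_eq_nn_integral borel_measurable_torus_continuous borel_measurable_continuous_onI)
  qed
  have intg: "integrable torus (\<lambda>x. g (x + b))" if "continuous_on UNIV g" for g :: "real ^ 'n \<Rightarrow> real" and b
    by (intro integrable_torus_continuous continuous_on_compose2[OF that]) (auto intro!: continuous_intros)
  note intg0 = intg[where b = 0, simplified]
  have c: "continuous_on UNIV (\<lambda>x. max (f x) 0)" "continuous_on UNIV (\<lambda>x. max (- f x) 0)"
    using cont by (auto intro!: continuous_intros)
  have split: "f x = max (f x) 0 - max (- f x) 0" for x by auto
  have "(LINT x|torus. f (x + a)) = (LINT x|torus. max (f (x + a)) 0) - (LINT x|torus. max (- f (x + a)) 0)"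
    by (subst split, subst Bochner_Integration.integral_diff) (use intg[OF c(1)] intg[OF c(2)] in auto)
  also have "\<dots> = (LINT x|torus. max (f x) 0) - (LINT x|torus. max (- f x) 0)"
    using pos[OF c(1)] pos[OF c(2)] per by simp
  also have "\<dots> = (LINT x|torus. f x)"
    by (subst (3) split, subst Bochner_Integration.integral_diff) (use intg0[OF c(1)] intg0[OF c(2)] in auto)
  finally show ?thesis .
qed

lemma integral_torus_shift:
  fixes f :: "real ^ 'n \<Rightarrow> complex"
  assumes cont: "continuous_on UNIV f" and per: "periodic f"
  shows "(LINT x|torus. f (x + a)) = (LINT x|torus. f x)"
proof -
  have cont': "continuous_on UNIV (\<lambda>x. f (x + a))"
    by (rule continuous_on_compose2[OF cont]) (auto intro!: continuous_intros)
  have "(LINT x|torus. Re (f (x + a))) = (LINT x|torus. Re (f x))" "(LINT x|torus. Im (f (x + a))) = (LINT x|torus. Im (f x))"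
    using cont per by (auto intro!: integral_torus_shift_real[of "\<lambda>x. Re (f x)"] 
        integral_torus_shift_real[of "\<lambda>x. Im (f x)"] continuous_intros simp: periodic_def)
  then show ?thesis
    using integrable_torus_continuous[OF cont] integrable_torus_continuous[OF cont']
    by (auto intro!: complex_eqI)
qed

section \<open>Jensen's inequality\<close>

text \<open>The convex function s^p lies above its tangent at \<open>m\<close>; for p > 1 this is
  Young's inequality with exponents p and p / (p - 1).\<close>

lemma powr_tangent:
  fixes s m p :: real
  assumes p: "1 \<le> p" and s: "0 \<le> s" and m: "0 < m"
  shows "p * m powr (p - 1) * s \<le> s powr p + (p - 1) * m powr p"
proof (cases "p = 1")
  case False
  with p have "p > 1" by simp
  then have "s * m powr (p - 1) \<le> s powr p / p + (m powr (p - 1)) powr (p / (p - 1)) / (p / (p - 1))"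
    using s by (intro Youngs_inequality) (auto simp: field_simps)
  also have "(m powr (p - 1)) powr (p / (p - 1)) = m powr p"
    using \<open>p > 1\<close> by (simp add: powr_powr)
  finally show ?thesis
    using \<open>p > 1\<close> by (simp add: field_simps)
qed (use s m in simp)

text \<open>Jensen's inequality for a weight that is not normalized: the tangent of s^p at the
  weighted mean is integrated against \<open>w\<close>. With the total mass kept explicit,
  \<open>w\<close> can later be a convolution kernel, a counting weight or a sequence of norm
  bounds.\<close>

lemma powr_integral_le:
  fixes w s :: "'a \<Rightarrow> real"
  assumes p: "1 \<le> p"
    and w: "\<And>x. x \<in> space M \<Longrightarrow> 0 \<le> w x" and s: "\<And>x. x \<in> space M \<Longrightarrow> 0 \<le> s x"
    and int: "integrable M w" "integrable M (\<lambda>x. w x * s x)" "integrable M (\<lambda>x. w x * s x powr p)"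
  shows "(LINT x|M. w x * s x) powr p \<le> (LINT x|M. w x) powr (p - 1) * (LINT x|M. w x * s x powr p)"
proof -
  define W where "W = (LINT x|M. w x)"
  define I where "I = (LINT x|M. w x * s x)"
  have W: "W \<ge> 0" and I: "I \<ge> 0"
    unfolding W_def I_def using w s by (auto intro!: integral_nonneg_AE)
  have J: "(LINT x|M. w x * s x powr p) \<ge> 0"
    using w s by (auto intro!: integral_nonneg_AE)
  show ?thesis
  \<comment> \<open>No positive mean is available here. Zero mass forces \<open>w\<close> to vanish
    almost everywhere, so the left side is 0 in either case.\<close>
  proof (cases "W = 0 \<or> I = 0")
    case True
    have "I = 0"
    proof (cases "W = 0")
      case True
      then have "AE x in M. w x = 0"
        unfolding W_def using w int by (subst (asm) integral_nonneg_eq_0_iff_AE) auto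
      then have "I = (LINT x|M. 0)"
        unfolding I_def using int by (intro integral_cong_AE) auto
      then show ?thesis by simp
    qed (use True in auto)
    then show ?thesis using J by (simp add: I_def)
  next
    case False
    define m where "m = I / W"
    have m: "m > 0" using False W I by (simp add: m_def)
    have "p * m powr (p - 1) * (w x * s x) \<le> w x * s x powr p + (p - 1) * m powr p * w x" if "x \<in> space M" for x
      using mult_left_mono[OF powr_tangent[OF p s[OF that] m] w[OF that]] by (simp add: algebra_simps)
    then have "(LINT x|M. p * m powr (p - 1) * (w x * s x)) \<le> (LINT x|M. w x * s x powr p + (p - 1) * m powr p * w x)"
      using int by (intro integral_mono) auto
    then have "p * m powr (p - 1) * I \<le> (LINT x|M. w x * s x powr p) + (p - 1) * m powr p * W"
      using int by (simp add: I_def W_def)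
    moreover have "I = m * W" "m powr p = m * m powr (p - 1)"
      using False W m powr_mult_base[of m "p - 1"] by (auto simp: m_def)
    ultimately have "m powr p * W \<le> (LINT x|M. w x * s x powr p)"
      by (simp add: algebra_simps)
    then have "W powr (p - 1) * (m powr p * W) \<le> W powr (p - 1) * (LINT x|M. w x * s x powr p)"
      by (intro mult_left_mono) auto
    moreover have "W powr (p - 1) * (m powr p * W) = I powr p"
      using False W m by (simp add: \<open>I = m * W\<close> powr_mult powr_mult_base[of W "p - 1"] mult_ac)
    ultimately show ?thesis
      by (simp add: I_def W_def)
  qed
qed

lemma powr_sum_le:
  fixes w s :: "'a \<Rightarrow> real"
  assumes "1 \<le> p" "finite A" "\<And>x. x \<in> A \<Longrightarrow> 0 \<le> w x" "\<And>x. x \<in> A \<Longrightarrow> 0 \<le> s x"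
  shows "(\<Sum>x\<in>A. w x * s x) powr p \<le> (\<Sum>x\<in>A. w x) powr (p - 1) * (\<Sum>x\<in>A. w x * s x powr p)"
  using powr_integral_le[of p "count_space A" w s] assms
  by (simp add: lebesgue_integral_count_space_finite integrable_count_space)

lemma continuous_on_powr_const:
  fixes f :: "'a::topological_space \<Rightarrow> real"
  assumes "continuous_on S f" "\<And>x. x \<in> S \<Longrightarrow> 0 \<le> f x" "0 < p"
  shows "continuous_on S (\<lambda>x. f x powr p)"
  using assms by (intro continuous_on_powr' continuous_intros) auto

lemma integral_torus_le_powr:
  fixes g :: "real ^ 'n \<Rightarrow> real"
  assumes "1 \<le> p" "continuous_on UNIV g" "\<And>x. 0 \<le> g x"
  shows "(LINT x|torus. g x) \<le> (LINT x|torus. g x powr p) powr (1 / p)"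
proof -
  have "(LINT x|torus. 1 * g x) powr p \<le> (LINT x|(torus :: (real ^ 'n) measure). 1) powr (p - 1) * (LINT x|torus. 1 * g x powr p)"
    using assms by (intro powr_integral_le integrable_torus_continuous continuous_intros continuous_on_powr_const) auto
  then have "((LINT x|torus. g x) powr p) powr (1 / p) \<le> (LINT x|torus. g x powr p) powr (1 / p)"
    using assms by (intro powr_mono2) auto
  then show ?thesis
    using assms by (simp add: powr_powr)
qed

section \<open>Partial derivatives\<close>

lemma partial_has_vector_derivative:
  assumes "has_partial j f"
  shows "((\<lambda>t. f (x + t *\<^sub>R axis j 1)) has_vector_derivative partial j f (x + s *\<^sub>R axis j 1)) (at s within S)"
proof -
  have "((\<lambda>t. f ((x + s *\<^sub>R axis j 1) + t *\<^sub>R axis j 1)) has_vector_derivative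
      partial j f (x + s *\<^sub>R axis j 1)) (at 0)"
    using assms unfolding has_partial_def partial_def vector_derivative_works[symmetric] by blast
  then have "((\<lambda>t. f ((x + s *\<^sub>R axis j 1) + t *\<^sub>R axis j 1)) \<circ> (\<lambda>t. t - s) has_vector_derivative
      1 *\<^sub>R partial j f (x + s *\<^sub>R axis j 1)) (at s)"
    by (intro vector_diff_chain_at) (auto intro!: derivative_eq_intros)
  then show ?thesis
    by (auto simp: o_def algebra_simps intro: has_vector_derivative_at_within)
qed

lemma has_partialI:
  assumes "\<And>x. ((\<lambda>t. f (x + t *\<^sub>R axis j 1)) has_vector_derivative g x) (at 0)"
  shows "has_partial j f" "partial j f = g"
  using assms by (auto simp: has_partial_def partial_def fun_eq_iff vector_derivative_at
      intro: differentiableI_vector)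

lemma partial_has_vector_derivative_0:
  assumes "has_partial j f"
  shows "((\<lambda>t. f (x + t *\<^sub>R axis j 1)) has_vector_derivative partial j f x) (at 0)"
  using partial_has_vector_derivative[OF assms, of x 0] by simp

lemma partial_diff:
  assumes "has_partial j f" "has_partial j g"
  shows "has_partial j (\<lambda>x. f x - g x)" "partial j (\<lambda>x. f x - g x) = (\<lambda>x. partial j f x - partial j g x)"
  using assms by (auto intro!: has_partialI derivative_intros partial_has_vector_derivative_0)

lemma partial_mult_left:
  assumes "has_partial j f"
  shows "has_partial j (\<lambda>x. c * f x)" "partial j (\<lambda>x. c * f x) = (\<lambda>x. c * partial j f x)"
  using assms by (auto intro!: has_partialI has_vector_derivative_mult_right partial_has_vector_derivative_0)

lemma partial_sum:
  assumes "\<And>i. i \<in> I \<Longrightarrow> has_partial j (f i)"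
  shows "has_partial j (\<lambda>x. \<Sum>i\<in>I. f i x)" "partial j (\<lambda>x. \<Sum>i\<in>I. f i x) = (\<lambda>x. \<Sum>i\<in>I. partial j (f i) x)"
proof -
  have "((\<lambda>t. \<Sum>i\<in>I. f i (x + t *\<^sub>R axis j 1)) has_vector_derivative (\<Sum>i\<in>I. partial j (f i) x)) (at 0)" for x
    using assms by (intro has_vector_derivative_sum partial_has_vector_derivative_0)
  then show "has_partial j (\<lambda>x. \<Sum>i\<in>I. f i x)" "partial j (\<lambda>x. \<Sum>i\<in>I. f i x) = (\<lambda>x. \<Sum>i\<in>I. partial j (f i) x)"
    by (auto intro!: has_partialI)
qed

lemma partial_mult:
  assumes "has_partial j f" "has_partial j g"
  shows "has_partial j (\<lambda>x. f x * g x)" "partial j (\<lambda>x. f x * g x) = (\<lambda>x. f x * partial j g x + partial j f x * g x)"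
proof -
  have "((\<lambda>t. f (x + t *\<^sub>R axis j 1) * g (x + t *\<^sub>R axis j 1)) has_vector_derivative
     (f x * partial j g x + partial j f x * g x)) (at 0)" for x
    using has_vector_derivative_mult[OF partial_has_vector_derivative_0[OF assms(1), of x] partial_has_vector_derivative_0[OF assms(2), of x]]
    by simp
  then show "has_partial j (\<lambda>x. f x * g x)" "partial j (\<lambda>x. f x * g x) = (\<lambda>x. f x * partial j g x + partial j f x * g x)"
    by (auto intro!: has_partialI)
qed

lemma partial_periodic:
  assumes "periodic f"
  shows "periodic (partial j f)"
proof -
  have "f (x + int_vec k + t *\<^sub>R axis j 1) = f (x + t *\<^sub>R axis j 1)" for x k t
    using assms[unfolded periodic_def, rule_format, of "x + t *\<^sub>R axis j 1" k] by (simp add: algebra_simps)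
  then show ?thesis
    by (simp add: periodic_def partial_def)
qed

lemma foldr_partial_periodic: "periodic f \<Longrightarrow> periodic (foldr partial js f)"
  by (induction js) (auto intro: partial_periodic)

lemma C_k_continuous: "C_k k f \<Longrightarrow> continuous_on UNIV f"
  by (cases k) auto

lemma C_k_mono: "C_k k f \<Longrightarrow> l \<le> k \<Longrightarrow> C_k l f"
proof (induction k arbitrary: l f)
  case (Suc k)
  then show ?case by (cases l) auto
qed simp

lemma C_k_diff: "C_k k f \<Longrightarrow> C_k k g \<Longrightarrow> C_k k (\<lambda>x. f x - g x)"
  by (induction k arbitrary: f g) (auto intro!: continuous_intros simp: partial_diff)

lemma C_k_mult_left: "C_k k f \<Longrightarrow> C_k k (\<lambda>x. c * f x)"
  by (induction k arbitrary: f) (auto intro!: continuous_intros simp: partial_mult_left)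

lemma C_k_sum: "(\<And>i. i \<in> I \<Longrightarrow> C_k k (f i)) \<Longrightarrow> C_k k (\<lambda>x. \<Sum>i\<in>I. f i x)"
proof (induction k arbitrary: f)
  case (Suc k)
  then show ?case by (auto intro!: continuous_intros simp: partial_sum)
qed (auto intro!: continuous_intros)

text \<open>Higher derivatives are kept as folds over lists of directions, which suit induction on
  the order; multi-indices return only when the hypothesis on the symbol is invoked.\<close>

lemma C_k_foldr_partial: "C_k (length js + k) f \<Longrightarrow> C_k k (foldr partial js f)"
proof (induction js arbitrary: k)
  case (Cons j js)
  then have "C_k (Suc k) (foldr partial js f)"
    by (intro Cons.IH) (simp del: C_k.simps)
  then show ?case by simp
qed simp

lemma C_k_foldr_has_partial: "C_k (Suc (length js)) f \<Longrightarrow> has_partial j (foldr partial js f)"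
  using C_k_foldr_partial[of js 1 f] by simp

lemma foldr_partial_diff:
  "C_k (length js) f \<Longrightarrow> C_k (length js) g \<Longrightarrow>
    foldr partial js (\<lambda>x. f x - g x) = (\<lambda>x. foldr partial js f x - foldr partial js g x)"
proof (induction js)
  case (Cons j js)
  then have "C_k (length js) f" "C_k (length js) g"
    using C_k_mono[of "Suc (length js)" _ "length js"] by (auto simp del: C_k.simps)
  with Cons show ?case by (simp add: partial_diff C_k_foldr_has_partial del: C_k.simps)
qed simp

lemma foldr_partial_mult_left:
  "C_k (length js) f \<Longrightarrow> foldr partial js (\<lambda>x. c * f x) = (\<lambda>x. c * foldr partial js f x)"
proof (induction js)
  case (Cons j js)
  then have "C_k (length js) f"
    using C_k_mono[of "Suc (length js)" _ "length js"] by (auto simp del: C_k.simps)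
  with Cons show ?case by (simp add: partial_mult_left C_k_foldr_has_partial del: C_k.simps)
qed simp

lemma foldr_partial_sum:
  "(\<And>i. i \<in> I \<Longrightarrow> C_k (length js) (f i)) \<Longrightarrow>
    foldr partial js (\<lambda>x. \<Sum>i\<in>I. f i x) = (\<lambda>x. \<Sum>i\<in>I. foldr partial js (f i) x)"
proof (induction js)
  case (Cons j js)
  then have "C_k (length js) (f i)" if "i \<in> I" for i
    using that C_k_mono[of "Suc (length js)" "f i" "length js"] by auto
  with Cons show ?case by (simp add: partial_sum C_k_foldr_has_partial del: C_k.simps)
qed simp

lemma continuous_on_line:
  fixes f :: "real ^ 'n \<Rightarrow> complex"
  assumes "continuous_on UNIV f" "continuous_on S g"
  shows "continuous_on S (\<lambda>s. f (g s))"
  using continuous_on_compose2[OF assms] by simp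

text \<open>Symmetry of mixed derivatives by integration: the increment of \<open>f\<close> in
  direction i is the integral of \<open>partial i f\<close>; differentiating under the integral in
  direction j gives the increment of \<open>partial j f\<close>, whose derivative in the length of
  the segment is the claim.\<close>

lemma partial_commute:
  assumes "C_k 2 f"
  shows "partial i (partial j f) = partial j (partial i f)"
proof
  fix x
  have f: "C_k (Suc (Suc 0)) f"
    using assms by (simp add: numeral_2_eq_2)
  then have hp: "has_partial l f" "has_partial m (partial l f)" 
    and ct: "continuous_on UNIV (partial l f)" "continuous_on UNIV (partial m (partial l f))" for l m
    by auto
  define I where "I s = integral {0..s} (\<lambda>r. partial j (partial i f) (x + r *\<^sub>R axis i 1))" for s
  have I: "partial j f (x + s *\<^sub>R axis i 1) = partial j f x + I s" if "s \<ge> 0" for s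
  proof -
    \<comment> \<open>\<open>G\<close> is the increment of \<open>f\<close> over length
      \<open>s\<close> in direction i, as a function of a displacement in direction j; its
      derivative at 0 is computed in two ways.\<close>
    define G where "G t = integral (cbox 0 s) (\<lambda>r. partial i f (x + t *\<^sub>R axis j 1 + r *\<^sub>R axis i 1))" for t
    have "((\<lambda>r. partial i f (x + t *\<^sub>R axis j 1 + r *\<^sub>R axis i 1)) has_integral
        f (x + t *\<^sub>R axis j 1 + s *\<^sub>R axis i 1) - f (x + t *\<^sub>R axis j 1 + 0 *\<^sub>R axis i 1)) {0..s}" for t
      by (rule fundamental_theorem_of_calculus[OF that]) (rule partial_has_vector_derivative[OF hp(1)])
    then have Gt: "G t = f (x + t *\<^sub>R axis j 1 + s *\<^sub>R axis i 1) - f (x + t *\<^sub>R axis j 1 + 0 *\<^sub>R axis i 1)" for t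
      unfolding G_def cbox_interval by (intro integral_unique)
    have eq: "x + t *\<^sub>R axis j 1 + s *\<^sub>R axis i 1 = x + s *\<^sub>R axis i 1 + t *\<^sub>R axis j 1" for t
      by simp
    have G: "G = (\<lambda>t. f (x + s *\<^sub>R axis i 1 + t *\<^sub>R axis j 1) - f (x + t *\<^sub>R axis j 1))"
      by (intro ext) (simp only: Gt eq scale_zero_left add_0_right)
    have "(G has_vector_derivative integral (cbox 0 s) (\<lambda>r. partial j (partial i f) (x + 0 *\<^sub>R axis j 1 + r *\<^sub>R axis i 1))) (at 0 within UNIV)"
      unfolding G_def
    proof (rule leibniz_rule_vector_derivative)
      fix t r :: real
      show "((\<lambda>t. partial i f (x + t *\<^sub>R axis j 1 + r *\<^sub>R axis i 1)) has_vector_derivative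
          partial j (partial i f) (x + t *\<^sub>R axis j 1 + r *\<^sub>R axis i 1)) (at t within UNIV)"
        using partial_has_vector_derivative[OF hp(2)[of j i], of "x + r *\<^sub>R axis i 1" t]
        by (simp add: algebra_simps)
      show "(\<lambda>r. partial i f (x + t *\<^sub>R axis j 1 + r *\<^sub>R axis i 1)) integrable_on cbox 0 s"
        by (intro integrable_continuous continuous_on_line[OF ct(1)] continuous_intros)
      show "continuous_on (UNIV \<times> cbox 0 s) (\<lambda>(t, r). partial j (partial i f) (x + t *\<^sub>R axis j 1 + r *\<^sub>R axis i 1))"
        unfolding split_beta by (intro continuous_on_line[OF ct(2)] continuous_intros)
    qed auto
    then have "(G has_vector_derivative I s) (at 0)"
      by (simp add: I_def)
    moreover have "(G has_vector_derivative partial j f (x + s *\<^sub>R axis i 1) - partial j f x) (at 0)"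
      unfolding G by (intro derivative_intros partial_has_vector_derivative_0 hp)
    ultimately have "I s = partial j f (x + s *\<^sub>R axis i 1) - partial j f x"
      by (rule vector_derivative_unique_at)
    then show ?thesis by simp
  qed
  \<comment> \<open>The formula with \<open>I\<close> is available for s \<ge> 0 only, so the
    remaining derivatives are one-sided and uniqueness is applied within {0..1}.\<close>
  have "(I has_vector_derivative partial j (partial i f) (x + 0 *\<^sub>R axis i 1)) (at 0 within {0..1})"
    unfolding I_def 
    by (rule integral_has_vector_derivative) (auto intro!: continuous_on_line[OF ct(2)] continuous_intros)
  then have "((\<lambda>s. partial j f x + I s) has_vector_derivative 0 + partial j (partial i f) x) (at 0 within {0..1})"
    by (intro derivative_intros) simp
  then have "((\<lambda>s. partial j f (x + s *\<^sub>R axis i 1)) has_vector_derivative 0 + partial j (partial i f) x) (at 0 within {0..1})"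
    by (rule has_vector_derivative_transform[rotated 2]) (auto simp: I)
  moreover have "((\<lambda>s. partial j f (x + s *\<^sub>R axis i 1)) has_vector_derivative partial i (partial j f) x) (at 0 within {0..1})"
    by (rule has_vector_derivative_at_within, rule partial_has_vector_derivative_0, rule hp)
  ultimately show "partial i (partial j f) x = partial j (partial i f) x"
    using vector_derivative_unique_within_closed_interval[of 0 1 0 "\<lambda>s. partial j f (x + s *\<^sub>R axis i 1)"]
    by (simp add: cbox_interval)
qed

lemma foldr_partial_commute:
  "C_k (Suc (length js)) f \<Longrightarrow> foldr partial js (partial a f) = partial a (foldr partial js f)"
proof (induction js)
  case (Cons j js)
  have "C_k (Suc (length js)) f"
    using Cons.prems by (rule C_k_mono) simp
  moreover have "C_k 2 (foldr partial js f)"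
    using Cons.prems by (intro C_k_foldr_partial) (simp add: numeral_2_eq_2 del: C_k.simps)
  ultimately show ?case
    using Cons.IH partial_commute by (simp del: C_k.simps)
qed simp

text \<open>The head of \<open>js\<close> occurs somewhere in \<open>ks\<close>; symmetry of mixed
  derivatives moves it to the front there, and induction treats the rest.\<close>

lemma foldr_partial_mset_cong:
  "C_k (length js) f \<Longrightarrow> mset js = mset ks \<Longrightarrow> foldr partial js f = foldr partial ks f"
proof (induction js arbitrary: ks)
  case (Cons a js)
  then have "a \<in> set ks"
    by (metis list.set_intros(1) set_mset_mset)
  then obtain us vs where ks: "ks = us @ a # vs"
    by (meson split_list)
  have len: "length ks = Suc (length js)"
    using Cons.prems(2) by (metis length_Cons size_mset)
  have "C_k (length js) f"
    using Cons.prems C_k_mono[of "Suc (length js)" _ "length js"] by (auto simp del: C_k.simps)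
  then have "foldr partial js f = foldr partial (us @ vs) f"
    using Cons.prems(2) by (intro Cons.IH) (auto simp: ks)
  moreover have "C_k (Suc (length us)) (foldr partial vs f)"
    using Cons.prems(1) len by (intro C_k_foldr_partial) (simp add: ks add.commute del: C_k.simps)
  then have "foldr partial us (partial a (foldr partial vs f)) = partial a (foldr partial us (foldr partial vs f))"
    by (rule foldr_partial_commute)
  ultimately show ?case by (simp add: ks)
qed simp

section \<open>Multi-indices as lists of directions\<close>

definition multi_index_list :: "nat ^ 'n \<Rightarrow> 'n::finite list" where
  "multi_index_list \<alpha> = concat (map (\<lambda>j. replicate (\<alpha> $ j) j) coords)"

lemma coords: "distinct (coords :: 'n::finite list)" "set (coords :: 'n list) = UNIV"
  unfolding coords_def
  by (rule someI2_ex, use finite_distinct_list[of "UNIV :: 'n set"] in auto)+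

lemma foldr_funpow_replicate:
  "foldr (\<lambda>j. D j ^^ a j) js f = foldr D (concat (map (\<lambda>j. replicate (a j) j) js)) f"
proof (induction js)
  case (Cons j js)
  have "foldr D (replicate m j) g = (D j ^^ m) g" for m g
    by (induction m) auto
  with Cons show ?case by simp
qed simp

lemma multi_op_eq_foldr: "multi_op D \<alpha> f = foldr D (multi_index_list \<alpha>) f"
  by (simp add: multi_op_def multi_index_list_def foldr_funpow_replicate)

lemma length_multi_index_list: "length (multi_index_list \<alpha>) = msize \<alpha>"
  unfolding multi_index_list_def msize_def length_concat map_map o_def length_replicate
  by (subst sum_list_distinct_conv_sum_set) (auto simp: coords)

lemma count_concat_replicate:
  "distinct js \<Longrightarrow> count (mset (concat (map (\<lambda>j. replicate (a j) j) js))) i = (if i \<in> set js then a i else 0)"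
  by (induction js) auto

lemma count_multi_index_list: "count (mset (multi_index_list \<alpha>)) i = \<alpha> $ i"
  unfolding multi_index_list_def by (subst count_concat_replicate) (auto simp: coords)

text \<open>The bridge from the lists in the Sobolev inequality to the multi-indices of the symbol
  hypothesis; the arbitrary enumeration \<open>coords\<close> is absorbed by permutation
  invariance.\<close>

lemma foldr_partial_eq_multi_op:
  assumes "C_k (length js) f"
  shows "foldr partial js f = multi_op partial (\<chi> i. count (mset js) i) f"
  unfolding multi_op_eq_foldr using assms
  by (rule foldr_partial_mset_cong) (auto intro: multiset_eqI simp: count_multi_index_list)

lemma msize_count: "msize (\<chi> i. count (mset js) i) = length js"
  unfolding length_multi_index_list[symmetric]
  by (intro mset_eq_length multiset_eqI) (simp add: count_multi_index_list)

text \<open>Parseval produces repeated differences in a single direction; these belong to the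
  multi-indices concentrated at \<open>j\<close>.\<close>

lemma multi_op_axis: "multi_op D (\<chi> i. if i = j then m else 0) = D j ^^ m"
proof
  fix f
  have "foldr D (replicate m j) f = (D j ^^ m) f" for f
    by (induction m) auto
  moreover have "multi_index_list (\<chi> i. if i = j then m else 0) = replicate m j"
  proof -
    have "set (multi_index_list (\<chi> i. if i = j then m else 0)) \<subseteq> {j}"
      by (auto simp: multi_index_list_def split: if_splits)
    moreover have "length (multi_index_list (\<chi> i. if i = j then m else 0)) = m"
      by (simp add: length_multi_index_list msize_def)
    ultimately show ?thesis
      by (intro replicate_eqI) auto
  qed
  ultimately show "multi_op D (\<chi> i. if i = j then m else 0) f = (D j ^^ m) f"
    by (simp add: multi_op_eq_foldr)
qed

lemma msize_axis: "msize (\<chi> i. if i = j then m else 0) = m"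
  by (simp add: msize_def)

text \<open>Differentiability along \<open>u\<close> has to be built from continuous partial
  derivatives. The coordinates of \<open>u\<close> are released one at a time, by induction on a set
  outside which they vanish.\<close>

lemma chain_rule_supported:
  assumes f: "C_k (Suc 0) f" and "finite A" "\<And>i. i \<notin> A \<Longrightarrow> u $ i = 0"
  shows "((\<lambda>t. f (x + t *\<^sub>R u)) has_vector_derivative (\<Sum>j\<in>A. u $ j *\<^sub>R partial j f (x + t *\<^sub>R u))) (at t)"
  using assms(2,3)
proof (induction A arbitrary: x u t)
  case empty
  then have "u = 0" by (simp add: vec_eq_iff)
  then show ?case by simp
next
  case (insert a A)
  have hp: "has_partial a f" and ct: "continuous_on UNIV (partial a f)"
    using f by auto
  define u' where "u' = (\<chi> i. if i = a then 0 else u $ i)"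
  define c where "c = u $ a"
  have u: "u = u' + c *\<^sub>R axis a 1"
    by (auto simp: u'_def c_def vec_eq_iff axis_def)
  \<comment> \<open>Separate times for the old coordinates and the new one. The s-derivative is
    needed at one point only and is the induction hypothesis; the r-derivative exists everywhere and
    is continuous. The diagonal s = r recovers the line.\<close>
  define F where "F s r = f (x + s *\<^sub>R u' + (r * c) *\<^sub>R axis a 1)" for s r
  define D1 where "D1 = (\<Sum>j\<in>A. u' $ j *\<^sub>R partial j f (x + (t * c) *\<^sub>R axis a 1 + t *\<^sub>R u'))"
  define D2 where "D2 s r = c *\<^sub>R partial a f (x + s *\<^sub>R u' + (r * c) *\<^sub>R axis a 1)" for s r
  have 1: "((\<lambda>s. F s t) has_derivative (\<lambda>h. h *\<^sub>R D1)) (at t within UNIV)"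
    using insert.IH[of u' "x + (t * c) *\<^sub>R axis a 1" t] insert.prems
    by (auto simp: F_def D1_def u'_def has_vector_derivative_def algebra_simps)
  have 2: "((\<lambda>r. F s r) has_derivative blinfun_apply (blinfun_scaleR_left (D2 s r))) (at r within UNIV)" for s r
  proof -
    have "((\<lambda>t. f (x + s *\<^sub>R u' + t *\<^sub>R axis a 1)) \<circ> (\<lambda>r. r * c) has_vector_derivative c *\<^sub>R partial a f (x + s *\<^sub>R u' + (r * c) *\<^sub>R axis a 1)) (at r)"
      by (intro vector_diff_chain_at partial_has_vector_derivative[OF hp]) (auto intro!: derivative_eq_intros)
    then show ?thesis
      by (simp add: F_def D2_def o_def has_vector_derivative_def)
  qed
  have 3: "continuous (at (t, t) within UNIV \<times> UNIV) (\<lambda>(s, r). blinfun_scaleR_left (D2 s r))"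
  proof -
    have "continuous_on UNIV (\<lambda>(s, r). blinfun_scaleR_left (D2 s r))"
      unfolding D2_def split_beta
      by (intro bounded_linear.continuous_on[OF bounded_linear_blinfun_scaleR_left] continuous_on_scaleR
          continuous_on_const continuous_on_line[OF ct] continuous_intros)
    then show ?thesis
      by (simp add: continuous_on_eq_continuous_within)
  qed
  have "((\<lambda>(s, r). F s r) has_derivative (\<lambda>(h, k). h *\<^sub>R D1 + blinfun_apply (blinfun_scaleR_left (D2 t t)) k)) (at (t, t) within UNIV \<times> UNIV)"
    by (rule has_derivative_partialsI[OF 1 2 3]) auto
  then have "((\<lambda>(s, r). F s r) has_derivative (\<lambda>(h, k). h *\<^sub>R D1 + k *\<^sub>R D2 t t)) (at ((\<lambda>t. (t, t)) t))"
    by simp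
  then have "((\<lambda>(s, r). F s r) \<circ> (\<lambda>t. (t, t)) has_derivative (\<lambda>(h, k). h *\<^sub>R D1 + k *\<^sub>R D2 t t) \<circ> (\<lambda>h. (h, h))) (at t)"
    by (intro diff_chain_at) (auto intro!: derivative_eq_intros)
  then have "((\<lambda>t. F t t) has_vector_derivative D1 + D2 t t) (at t)"
    by (simp add: has_vector_derivative_def o_def scaleR_add_right)
  moreover have "F t t = f (x + t *\<^sub>R u)" for t
    by (simp add: F_def u algebra_simps)
  moreover have "D1 + D2 t t = (\<Sum>j\<in>insert a A. u $ j *\<^sub>R partial j f (x + t *\<^sub>R u))"
  proof -
    have eqs: "x + (t * c) *\<^sub>R axis a 1 + t *\<^sub>R u' = x + t *\<^sub>R u" "x + t *\<^sub>R u' + (t * c) *\<^sub>R axis a 1 = x + t *\<^sub>R u"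
      by (simp_all add: u algebra_simps)
    have "D1 = (\<Sum>j\<in>A. u $ j *\<^sub>R partial j f (x + t *\<^sub>R u))" "D2 t t = u $ a *\<^sub>R partial a f (x + t *\<^sub>R u)"
      unfolding D1_def D2_def eqs using insert.hyps by (auto simp: c_def u'_def intro!: sum.cong)
    then show ?thesis using insert.hyps by simp
  qed
  ultimately show ?case by simp
qed

lemma chain_rule_line:
  assumes "C_k (Suc 0) f"
  shows "((\<lambda>t. f (x + t *\<^sub>R u)) has_vector_derivative (\<Sum>j\<in>UNIV. u $ j *\<^sub>R partial j f (x + t *\<^sub>R u))) (at t)"
  using chain_rule_supported[OF assms, of UNIV u] by simp

section \<open>A Sobolev inequality on the torus\<close>

text \<open>Ordered lists rather than multi-indices: iterating the chain rule produces each list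
  once, so no multinomial coefficients appear.\<close>

definition index_lists :: "nat \<Rightarrow> 'n list set" where
  "index_lists i = {js. length js = i}"

lemma finite_index_lists [simp]: "finite (index_lists i :: 'n::finite list set)"
  using finite_lists_length_eq[of "UNIV :: 'n set" i] by (simp add: index_lists_def)

lemma index_lists_Suc: "index_lists (Suc i) = (\<lambda>(j, js). j # js) ` (UNIV \<times> index_lists i)"
  by (auto simp: index_lists_def length_Suc_conv image_iff)

lemma sum_index_lists_Suc:
  "(\<Sum>js\<in>index_lists (Suc i). g js) = (\<Sum>j\<in>UNIV. \<Sum>js\<in>index_lists i. g (j # js :: 'n::finite list))"
  unfolding index_lists_Suc by (subst sum.reindex) (auto simp: inj_on_def sum.cartesian_product split_beta)

lemma continuous_on_foldr_partial:
  "C_k k f \<Longrightarrow> length js \<le> k \<Longrightarrow> continuous_on UNIV (foldr partial js f)"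
  using C_k_foldr_partial[of js 0 f] C_k_mono by auto

lemma taylor_bound:
  fixes f :: "real ^ 'n \<Rightarrow> complex"
  assumes f: "C_k k f" and k: "k > 0" and u: "u \<in> cbox 0 1"
  shows "ennreal (norm (f x)) \<le> (\<Sum>i<k. \<Sum>js\<in>index_lists i. ennreal (norm (foldr partial js f (x + u)))) +
    (\<integral>\<^sup>+t. ennreal (t ^ (k - 1)) * (\<Sum>js\<in>index_lists k. ennreal (norm (foldr partial js f (x + t *\<^sub>R u)))) * indicator {0..1} t \<partial>lborel)"
proof -
  \<comment> \<open>\<open>c js\<close> is the monomial in - u belonging to \<open>js\<close>, so
    that \<open>H i\<close> is the i-th derivative of s \<mapsto> f (x + u - s u).\<close>
  define c where "c js = prod_list (map (\<lambda>j. (- u) $ j) js)" for js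
  define H where "H i s = (\<Sum>js\<in>index_lists i. c js *\<^sub>R foldr partial js f (x + u + s *\<^sub>R (- u)))" for i s
  have ui: "\<bar>u $ j\<bar> \<le> 1" for j
    using u by (auto simp: mem_box_cart)
  have c: "\<bar>c js\<bar> \<le> 1" for js
    using mult_le_one[OF ui] unfolding c_def by (induction js) (auto simp: abs_mult)
  have H_bound: "norm (H i s) \<le> (\<Sum>js\<in>index_lists i. norm (foldr partial js f (x + (1 - s) *\<^sub>R u)))" for i s
  proof -
    have "norm (H i s) \<le> (\<Sum>js\<in>index_lists i. norm (c js *\<^sub>R foldr partial js f (x + u + s *\<^sub>R (- u))))"
      unfolding H_def by (rule norm_sum)
    also have "\<dots> \<le> (\<Sum>js\<in>index_lists i. norm (foldr partial js f (x + u + s *\<^sub>R (- u))))"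
      using c by (intro sum_mono) (simp add: mult_left_le_one_le)
    also have "x + u + s *\<^sub>R (- u) = x + (1 - s) *\<^sub>R u"
      by (simp add: algebra_simps)
    finally show ?thesis .
  qed
  have deriv: "(H i has_vector_derivative H (Suc i) s) (at s within {0..1})" if "i < k" for i s
  proof -
    have "C_k (Suc 0) (foldr partial js f)" if "js \<in> index_lists i" for js
      using that \<open>i < k\<close> C_k_mono[OF f, of "length js + Suc 0"]
      by (intro C_k_foldr_partial) (auto simp: index_lists_def simp del: C_k.simps)
    then have "(H i has_vector_derivative (\<Sum>js\<in>index_lists i. c js *\<^sub>R 
        (\<Sum>j\<in>UNIV. (- u) $ j *\<^sub>R partial j (foldr partial js f) (x + u + s *\<^sub>R (- u))))) (at s within {0..1})"
      unfolding H_def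
      by (intro has_vector_derivative_sum has_vector_derivative_at_within[OF bounded_linear.has_vector_derivative[OF bounded_linear_scaleR_right chain_rule_line]])
    also have "(\<Sum>js\<in>index_lists i. c js *\<^sub>R 
        (\<Sum>j\<in>UNIV. (- u) $ j *\<^sub>R partial j (foldr partial js f) (x + u + s *\<^sub>R (- u)))) = H (Suc i) s"
      unfolding H_def sum_index_lists_Suc scaleR_sum_right
      by (subst sum.swap) (simp add: c_def mult.commute)
    finally show ?thesis .
  qed
  have "f x = H 0 1"
    by (simp add: H_def index_lists_def c_def)
  also have "\<dots> = (\<Sum>i<k. ((1 - 0) ^ i / fact i) *\<^sub>R H i 0) + integral {0..1} (\<lambda>s. ((1 - s) ^ (k - 1) / fact (k - 1)) *\<^sub>R H k s)"
    using k deriv by (intro Taylor_integral) auto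
  finally have taylor: "f x = (\<Sum>i<k. (1 / fact i) *\<^sub>R H i 0) + integral {0..1} (\<lambda>s. ((1 - s) ^ (k - 1) / fact (k - 1)) *\<^sub>R H k s)"
    by simp
  define G where "G s = (1 - s) ^ (k - 1) * (\<Sum>js\<in>index_lists k. norm (foldr partial js f (x + (1 - s) *\<^sub>R u)))" for s :: real
  have cont: "continuous_on UNIV (foldr partial js f)" if "js \<in> index_lists k" for js
    using that by (intro continuous_on_foldr_partial[OF f]) (auto simp: index_lists_def)
  have G: "continuous_on S G" for S
    unfolding G_def by (intro continuous_intros continuous_on_line[OF cont]) auto
  have H: "continuous_on S (H k)" for S
    unfolding H_def by (intro continuous_intros continuous_on_line[OF cont]) auto
  have "norm (integral {0..1} (\<lambda>s. ((1 - s) ^ (k - 1) / fact (k - 1)) *\<^sub>R H k s)) \<le> integral {0..1} G"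
  proof (rule integral_norm_bound_integral)
    fix s :: real assume s: "s \<in> {0..1}"
    have "norm (((1 - s) ^ (k - 1) / fact (k - 1)) *\<^sub>R H k s) \<le> (1 - s) ^ (k - 1) * norm (H k s)"
      using s fact_ge_1[of "k - 1", where 'a = real] mult_right_mono[of 1 "fact (k - 1)" "(1 - s) ^ (k - 1) * norm (H k s)"]
      by (simp add: divide_simps mult.commute)
    also have "\<dots> \<le> G s"
      unfolding G_def using s by (intro mult_left_mono H_bound) auto
    finally show "norm (((1 - s) ^ (k - 1) / fact (k - 1)) *\<^sub>R H k s) \<le> G s" .
  qed (auto intro!: integrable_continuous_interval continuous_intros G H)
  moreover have "norm (\<Sum>i<k. (1 / fact i) *\<^sub>R H i 0) \<le> (\<Sum>i<k. \<Sum>js\<in>index_lists i. norm (foldr partial js f (x + u)))"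
  proof (rule order_trans[OF norm_sum], rule sum_mono)
    fix i
    have "norm ((1 / fact i) *\<^sub>R H i 0) \<le> norm (H i 0)"
      using fact_ge_1[of i, where 'a = real] by (simp add: divide_simps mult_le_cancel_left1)
    also have "\<dots> \<le> (\<Sum>js\<in>index_lists i. norm (foldr partial js f (x + u)))"
      using H_bound[of i 0] by simp
    finally show "norm ((1 / fact i) *\<^sub>R H i 0) \<le> (\<Sum>js\<in>index_lists i. norm (foldr partial js f (x + u)))" .
  qed
  ultimately have "norm (f x) \<le> (\<Sum>i<k. \<Sum>js\<in>index_lists i. norm (foldr partial js f (x + u))) + integral {0..1} G"
    unfolding taylor by (intro order_trans[OF norm_triangle_ineq] add_mono)
  moreover have "0 \<le> integral {0..1} G"
    by (intro integral_nonneg integrable_continuous_interval G) (auto simp: G_def intro!: mult_nonneg_nonneg sum_nonneg)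
  ultimately have "ennreal (norm (f x)) \<le> ennreal (\<Sum>i<k. \<Sum>js\<in>index_lists i. norm (foldr partial js f (x + u))) + ennreal (integral {0..1} G)"
    by (subst ennreal_plus[symmetric]) (auto intro!: sum_nonneg ennreal_leI)
  also have "ennreal (integral {0..1} G) = (\<integral>\<^sup>+s. ennreal (G s) * indicator {0..1} s \<partial>lborel)"
  proof (rule nn_integral_has_integral_lebesgue'[symmetric])
    show "(G has_integral integral {0..1} G) {0..1}"
      by (intro integrable_integral integrable_continuous_interval G)
  qed (auto simp: G_def intro!: mult_nonneg_nonneg sum_nonneg)
  also have "\<dots> = (\<integral>\<^sup>+t. ennreal (G (1 - t)) * indicator {0..1} (1 - t) \<partial>lborel)"
  proof -
    have [measurable]: "G \<in> borel_measurable borel"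
      using G[of UNIV] by (rule borel_measurable_continuous_onI)
    show ?thesis
      by (subst nn_integral_real_affine[where t = 1 and c = "-1"]) auto
  qed
  also have "\<dots> = (\<integral>\<^sup>+t. ennreal (t ^ (k - 1)) * (\<Sum>js\<in>index_lists k. ennreal (norm (foldr partial js f (x + t *\<^sub>R u)))) * indicator {0..1} t \<partial>lborel)"
    by (intro nn_integral_cong) (auto simp: G_def ennreal_mult sum_nonneg split: split_indicator)
  finally show ?thesis
    by (simp add: sum_nonneg)
qed

text \<open>The substitution v = x + t u carries the unit cube onto a cube of side t inside x +
  [0,1]^n, which is a full period.\<close>

lemma nn_integral_torus_dilation:
  fixes g :: "real ^ 'n \<Rightarrow> ennreal"
  assumes [measurable]: "g \<in> borel_measurable borel" and per: "\<And>x k. g (x + int_vec k) = g x"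
    and t: "0 < t" "t \<le> 1"
  shows "ennreal (t ^ CARD('n)) * (\<integral>\<^sup>+u. g (x + t *\<^sub>R u) \<partial>torus) \<le> (\<integral>\<^sup>+u. g u \<partial>torus)"
proof -
  define h where "h v = g v * indicator (cbox 0 1) ((v - x) /\<^sub>R t)" for v
  have [measurable]: "h \<in> borel_measurable borel"
    unfolding h_def by measurable
  have "(\<integral>\<^sup>+v. h v \<partial>lborel) = (\<integral>\<^sup>+v. h v \<partial>density (distr lborel borel (\<lambda>u. x + t *\<^sub>R u)) (\<lambda>_. ennreal (\<bar>t\<bar> ^ DIM(real ^ 'n))))"
    using t by (subst lborel_affine[of t x]) auto
  also have "\<dots> = ennreal (t ^ CARD('n)) * (\<integral>\<^sup>+u. h (x + t *\<^sub>R u) \<partial>lborel)"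
    using t by (simp add: nn_integral_density nn_integral_distr nn_integral_cmult)
  also have "(\<integral>\<^sup>+u. h (x + t *\<^sub>R u) \<partial>lborel) = (\<integral>\<^sup>+u. g (x + t *\<^sub>R u) \<partial>torus)"
    using t by (simp add: h_def nn_integral_torus)
  finally have "ennreal (t ^ CARD('n)) * (\<integral>\<^sup>+u. g (x + t *\<^sub>R u) \<partial>torus) = (\<integral>\<^sup>+v. h v \<partial>lborel)" ..
  also have "\<dots> \<le> (\<integral>\<^sup>+v. g v * indicator (cbox 0 1) (v - x) \<partial>lborel)"
  proof (intro nn_integral_mono)
    fix v
    have "v - x \<in> cbox 0 1" if "(v - x) /\<^sub>R t \<in> cbox 0 1"
    proof -
      have "0 \<le> (v - x) $ i / t \<and> (v - x) $ i / t \<le> 1" for i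
        using that by (auto simp: mem_box_cart divide_inverse_commute)
      then have "0 \<le> (v - x) $ i \<and> (v - x) $ i \<le> t" for i
        using t by (auto simp: zero_le_divide_iff divide_le_eq_1 dest!: spec[of _ i])
      then show ?thesis using t by (auto simp: mem_box_cart intro: order_trans)
    qed
    then show "h v \<le> g v * indicator (cbox 0 1) (v - x)"
      by (auto simp: h_def split: split_indicator)
  qed
  also have "\<dots> = (\<integral>\<^sup>+v. g (v + x) * indicator (cbox 0 1) v \<partial>lborel)"
    by (subst nn_integral_lborel_shift[symmetric, of _ x]) auto
  also have "\<dots> = (\<integral>\<^sup>+v. g (v + x) \<partial>torus)"
    by (simp add: nn_integral_torus)
  also have "\<dots> = (\<integral>\<^sup>+v. g v \<partial>torus)"
    by (rule nn_integral_torus_shift) (auto simp: per)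
  finally show ?thesis .
qed

text \<open>Jensen on the unit cube passes to the \<open>L^p\<close> mean, and the dilation costs
  t^(-n) under the p-th root.\<close>

lemma Lp_norm_dilation:
  fixes g :: "real ^ 'n \<Rightarrow> complex"
  assumes cont: "continuous_on UNIV g" and per: "periodic g" and p: "1 \<le> p" and t: "0 < t" "t \<le> 1"
  shows "(\<integral>\<^sup>+u. ennreal (norm (g (x + t *\<^sub>R u))) \<partial>torus) \<le> ennreal (t powr (- CARD('n) / p) * Lp_norm p g)"
proof -
  have cont': "continuous_on UNIV (\<lambda>u. norm (g (x + t *\<^sub>R u)))"
    by (intro continuous_intros continuous_on_line[OF cont])
  have contp: "continuous_on UNIV (\<lambda>u. norm (g (x + t *\<^sub>R u)) powr p)" for x t
    using p by (intro continuous_on_powr' continuous_intros continuous_on_line[OF cont]) auto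
  note contp0 = contp[of 0 1, simplified]
  have "ennreal (t ^ CARD('n)) * (\<integral>\<^sup>+u. ennreal (norm (g (x + t *\<^sub>R u)) powr p) \<partial>torus)
     \<le> (\<integral>\<^sup>+u. ennreal (norm (g u) powr p) \<partial>torus)"
    using per t contp0 by (intro nn_integral_torus_dilation[where g = "\<lambda>u. ennreal (norm (g u) powr p)"])
      (auto intro!: borel_measurable_continuous_onI simp: periodic_def)
  then have "t ^ CARD('n) * (LINT u|torus. norm (g (x + t *\<^sub>R u)) powr p) \<le> (LINT u|torus. norm (g u) powr p)"
    using t by (simp add: nn_integral_eq_integral integrable_torus_continuous contp contp0 flip: ennreal_mult)
  then have "(LINT u|torus. norm (g (x + t *\<^sub>R u)) powr p) \<le> t powr (- CARD('n)) * (LINT u|torus. norm (g u) powr p)"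
    using t by (simp add: powr_minus powr_realpow field_simps)
  then have "(LINT u|torus. norm (g (x + t *\<^sub>R u)) powr p) powr (1 / p) \<le> (t powr (- CARD('n)) * (LINT u|torus. norm (g u) powr p)) powr (1 / p)"
    using p by (intro powr_mono2) auto
  then have "(LINT u|torus. norm (g (x + t *\<^sub>R u))) \<le> t powr (- CARD('n) / p) * Lp_norm p g"
    using integral_torus_le_powr[OF p cont'] t by (simp add: powr_mult powr_powr Lp_norm_def)
  then show ?thesis
    by (subst nn_integral_eq_integral) (auto intro!: ennreal_leI integrable_torus_continuous cont')
qed

text \<open>The second summand of the constant is the integral of t^(k - 1 - n/p) over the unit
  interval, which comes from the averaged Taylor remainder.\<close>

proposition sobolev_torus:
  fixes f :: "real ^ 'n \<Rightarrow> complex"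
  assumes f: "C_k k f" and per: "periodic f" and p: "1 \<le> p" and k: "real k > CARD('n) / p"
  shows "norm (f x) \<le> (1 + 1 / (k - CARD('n) / p)) * (\<Sum>i\<le>k. \<Sum>js\<in>index_lists i. Lp_norm p (foldr partial js f))"
proof -
  define d where "d = CARD('n) / p"
  have d: "d > 0" "d < k"
    using p k by (auto simp: d_def)
  then have k0: "k > 0" by auto
  note per' = foldr_partial_periodic[OF per]
  have cont: "continuous_on UNIV (foldr partial js f)" if "js \<in> index_lists i" "i \<le> k" for js i
    using that by (intro continuous_on_foldr_partial[OF f]) (auto simp: index_lists_def)
  have [measurable]: "foldr partial js f \<in> borel_measurable borel" if "js \<in> index_lists i" "i \<le> k" for js i
    using cont[OF that] by (rule borel_measurable_continuous_onI)
  define N where "N i = (\<Sum>js\<in>index_lists i. Lp_norm p (foldr partial js f))" for i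
  have N: "N i \<ge> 0" for i
    by (auto simp: N_def Lp_norm_def intro!: sum_nonneg)
  interpret torus: finite_measure "torus :: (real ^ 'n) measure"
    by (rule finite_measure_torus)
  define A where "A u = (\<Sum>i<k. \<Sum>js\<in>index_lists i. ennreal (norm (foldr partial js f (x + u))))" for u
  define B where "B u t = ennreal (t ^ (k - 1)) * (\<Sum>js\<in>index_lists k. ennreal (norm (foldr partial js f (x + t *\<^sub>R u)))) * indicator {0..1} t" for u t
  have A_meas: "A \<in> borel_measurable borel"
    unfolding A_def by measurable
  have B_meas: "(\<lambda>(u, t). B u t) \<in> borel_measurable (lborel \<Otimes>\<^sub>M lborel)"
  proof -
    have "(\<lambda>z. \<Sum>js\<in>index_lists k. ennreal (norm (foldr partial js f (x + snd z *\<^sub>R fst z)))) \<in> borel_measurable (borel :: ((real ^ 'n) \<times> real) measure)"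
      by (intro borel_measurable_sum measurable_compose[OF _ measurable_ennreal] borel_measurable_continuous_onI
         continuous_on_line[OF cont] continuous_intros) auto
    then have [measurable]: "(\<lambda>z. \<Sum>js\<in>index_lists k. ennreal (norm (foldr partial js f (x + snd z *\<^sub>R fst z)))) \<in> borel_measurable (borel \<Otimes>\<^sub>M borel :: ((real ^ 'n) \<times> real) measure)"
      by (simp add: borel_prod)
    show ?thesis
      unfolding B_def split_beta lborel_prod by (simp add: borel_prod[symmetric]) measurable
  qed
  have mt: "(\<lambda>u. ennreal (norm (foldr partial js f (x + t *\<^sub>R u)))) \<in> borel_measurable torus"
    if "js \<in> index_lists i" "i \<le> k" for js i t
    by (intro measurable_compose[OF _ measurable_ennreal] borel_measurable_torus_continuous
        continuous_on_norm continuous_on_line[OF cont[OF that]] continuous_intros)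
  have inner: "(\<integral>\<^sup>+u. ennreal (norm (foldr partial js f (x + t *\<^sub>R u))) \<partial>torus) \<le> ennreal (t powr (- d) * Lp_norm p (foldr partial js f))"
    if "js \<in> index_lists i" "i \<le> k" "0 < t" "t \<le> 1" for js i t
    using Lp_norm_dilation[OF cont[OF that(1,2)] per' p that(3,4)] by (simp add: d_def)
  \<comment> \<open>The torus has mass 1, so a constant equals its average over u.\<close>
  have "ennreal (norm (f x)) = (\<integral>\<^sup>+u. ennreal (norm (f x)) \<partial>(torus :: (real ^ 'n) measure))"
    by (simp add: emeasure_torus)
  also have "\<dots> \<le> (\<integral>\<^sup>+u. A u + (\<integral>\<^sup>+t. B u t \<partial>lborel) \<partial>torus)"
    unfolding A_def B_def using taylor_bound[OF f k0] by (intro nn_integral_mono) simp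
  also have "\<dots> = (\<integral>\<^sup>+u. A u \<partial>torus) + (\<integral>\<^sup>+u. (\<integral>\<^sup>+t. B u t \<partial>lborel) \<partial>torus)"
    using A_meas B_meas by (intro nn_integral_add borel_measurable_torus) (auto intro!: lborel.borel_measurable_nn_integral simp: split_beta)
  also have "(\<integral>\<^sup>+u. A u \<partial>torus) = (\<Sum>i<k. \<Sum>js\<in>index_lists i. \<integral>\<^sup>+u. ennreal (norm (foldr partial js f (x + u))) \<partial>torus)"
  proof -
    have m: "(\<lambda>u. ennreal (norm (foldr partial js f (x + u)))) \<in> borel_measurable torus"
      if "js \<in> index_lists i" "i < k" for js i
      using mt[of js i 1] that by simp
    show ?thesis
      unfolding A_def
      by (intro trans[OF nn_integral_sum] sum.cong refl nn_integral_sum borel_measurable_sum m) simp_all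
  qed
  also have "\<dots> \<le> (\<Sum>i<k. \<Sum>js\<in>index_lists i. ennreal (Lp_norm p (foldr partial js f)))"
    using inner[where t = 1] by (intro sum_mono) auto
  also have "\<dots> = ennreal (\<Sum>i<k. N i)"
    by (simp add: N_def Lp_norm_def sum_nonneg)
  also have "(\<integral>\<^sup>+u. (\<integral>\<^sup>+t. B u t \<partial>lborel) \<partial>torus) = (\<integral>\<^sup>+u. (\<integral>\<^sup>+t. B u t * indicator (cbox 0 1) u \<partial>lborel) \<partial>lborel)"
    unfolding nn_integral_torus using B_meas
    by (intro nn_integral_cong nn_integral_multc[symmetric]) (auto dest: measurable_Pair2[of _ lborel lborel])
  also have "\<dots> = (\<integral>\<^sup>+t. (\<integral>\<^sup>+u. B u t * indicator (cbox 0 1) u \<partial>lborel) \<partial>lborel)"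
    using B_meas by (intro lborel_pair.Fubini'[symmetric]) (auto simp: split_beta)
  also have "\<dots> = (\<integral>\<^sup>+t. (\<integral>\<^sup>+u. B u t \<partial>torus) \<partial>lborel)"
    by (simp add: nn_integral_torus)
  also have "\<dots> \<le> (\<integral>\<^sup>+t. ennreal (t powr (real k - 1 - d)) * indicator {0..1} t * ennreal (N k) \<partial>lborel)"
  \<comment> \<open>The dilation bound requires t > 0; the single point 0 is discarded.\<close>
  proof (rule nn_integral_mono_AE, use AE_lborel_singleton[of "0::real"] in eventually_elim)
    fix t :: real assume "t \<noteq> 0"
    show "(\<integral>\<^sup>+u. B u t \<partial>torus) \<le> ennreal (t powr (real k - 1 - d)) * indicator {0..1} t * ennreal (N k)"
    proof (cases "t \<in> {0..1}")
      case True
      with \<open>t \<noteq> 0\<close> have t: "0 < t" "t \<le> 1" by auto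
      have "(\<integral>\<^sup>+u. B u t \<partial>torus) = ennreal (t ^ (k - 1)) * (\<Sum>js\<in>index_lists k. \<integral>\<^sup>+u. ennreal (norm (foldr partial js f (x + t *\<^sub>R u))) \<partial>torus)"
        unfolding B_def using True
        by (simp del: sum_ennreal)
          (intro trans[OF nn_integral_cmult] arg_cong2[where f = "(*)"] refl nn_integral_sum borel_measurable_sum mt[OF _ order_refl], simp_all)
      also have "\<dots> \<le> ennreal (t ^ (k - 1)) * (\<Sum>js\<in>index_lists k. ennreal (t powr (- d) * Lp_norm p (foldr partial js f)))"
        by (intro mult_left_mono sum_mono inner[OF _ order_refl t]) auto
      also have "\<dots> = ennreal (t ^ (k - 1)) * ennreal (t powr (- d) * N k)"
        by (subst sum_ennreal) (auto simp: N_def Lp_norm_def sum_distrib_left)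
      also have "\<dots> = ennreal (t powr (real k - 1 - d) * N k)"
      proof -
        have "t ^ (k - 1) * t powr (- d) = t powr (real k - 1 - d)"
          using t k0 by (simp add: powr_diff powr_minus powr_realpow[symmetric] of_nat_diff divide_inverse)
        then show ?thesis
          using t N by (simp add: ennreal_mult[symmetric] mult.assoc[symmetric])
      qed
      also have "\<dots> = ennreal (t powr (real k - 1 - d)) * indicator {0..1} t * ennreal (N k)"
        using t N by (simp add: ennreal_mult)
      finally show ?thesis .
    qed (simp add: B_def)
  qed
  also have "\<dots> = (\<integral>\<^sup>+t. ennreal (t powr (real k - 1 - d)) * indicator {0..1} t \<partial>lborel) * ennreal (N k)"
    by (rule nn_integral_multc) auto
  also have "(\<integral>\<^sup>+t. ennreal (t powr (real k - 1 - d)) * indicator {0..1} t \<partial>lborel) = ennreal (1 / (k - d))"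
    using has_integral_powr_from_0[of "real k - 1 - d" 1] d by (intro nn_integral_has_integral_lebesgue') auto
  also have "ennreal (\<Sum>i<k. N i) + ennreal (1 / (k - d)) * ennreal (N k) = ennreal ((\<Sum>i<k. N i) + 1 / (k - d) * N k)"
    using d N by (subst ennreal_mult[symmetric], simp, simp) (subst ennreal_plus, auto intro!: sum_nonneg)
  finally have "ennreal (norm (f x)) \<le> ennreal ((\<Sum>i<k. N i) + 1 / (k - d) * N k)"
    by (simp add: add_mono)
  then have "norm (f x) \<le> (\<Sum>i<k. N i) + 1 / (k - d) * N k"
    using d N by (subst (asm) ennreal_le_iff) (auto intro!: add_nonneg_nonneg sum_nonneg)
  also have "\<dots> \<le> (1 + 1 / (k - d)) * (\<Sum>i\<le>k. N i)"
  proof -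
    have "(\<Sum>i\<le>k. N i) = (\<Sum>i<k. N i) + N k" "(\<Sum>i<k. N i) \<ge> 0"
      using N by (auto simp: lessThan_Suc_atMost[symmetric] intro!: sum_nonneg)
    moreover have "0 \<le> 1 / (k - d)"
      using d by simp
    ultimately show ?thesis
      using N[of k] by (simp add: distrib_left distrib_right)
  qed
  finally show ?thesis
    by (simp add: N_def d_def)
qed

section \<open>Trigonometric polynomials\<close>

definition tchar :: "real ^ 'n \<Rightarrow> int ^ 'n \<Rightarrow> complex" where
  "tchar x \<xi> = cis (2 * pi * (x \<bullet> int_vec \<xi>))"

lemma exp_eq_tchar: "exp (\<i> * 2 * pi * (x \<bullet> int_vec \<xi>)) = tchar x \<xi>"
  by (simp add: tchar_def cis_conv_exp mult.assoc)

lemma tchar_0 [simp]: "tchar x 0 = 1" "tchar 0 \<xi> = 1"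
  by (simp_all add: tchar_def)

lemma tchar_add: "tchar (x + y) \<xi> = tchar x \<xi> * tchar y \<xi>"
  by (simp add: tchar_def cis_mult inner_add_left distrib_left)

lemma tchar_add_right: "tchar x (\<xi> + \<eta>) = tchar x \<xi> * tchar x \<eta>"
  by (simp add: tchar_def cis_mult int_vec_add inner_add_right distrib_left)

lemma tchar_uminus: "tchar (- x) \<xi> = cnj (tchar x \<xi>)" "tchar x (- \<xi>) = cnj (tchar x \<xi>)"
  by (simp_all add: tchar_def cis_cnj int_vec_uminus)

lemma norm_tchar [simp]: "norm (tchar x \<xi>) = 1"
  by (simp add: tchar_def)

lemma tchar_int_vec [simp]: "tchar (int_vec k) \<xi> = 1"
proof -
  have "int_vec k \<bullet> int_vec \<xi> = of_int (\<Sum>i\<in>UNIV. k $ i * \<xi> $ i)"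
    by (simp add: inner_vec_def)
  then show ?thesis
    unfolding tchar_def using cis_multiple_2pi by (metis Ints_of_int)
qed

lemma periodic_tchar: "periodic (\<lambda>x. tchar x \<xi>)"
  by (simp add: periodic_def tchar_add)

lemma continuous_on_tchar [continuous_intros]:
  "continuous_on S f \<Longrightarrow> continuous_on S (\<lambda>x. tchar (f x) \<xi>)"
  unfolding tchar_def by (intro continuous_intros)

lemma tchar_axis: "tchar (x :: real ^ 'n) (axis i 1) = cis (2 * pi * x $ i)"
proof -
  have "int_vec (axis i 1) = (axis i 1 :: real ^ 'n)"
    by (simp add: vec_eq_iff axis_def)
  then show ?thesis
    by (simp add: tchar_def inner_axis)
qed

text \<open>Translation by half a wavelength, in a direction where \<xi> does not vanish, preserves
  the integral and reverses its sign.\<close>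

lemma integral_tchar: "(LINT x|torus. tchar (x :: real ^ 'n) \<xi>) = (if \<xi> = 0 then 1 else 0)"
proof (cases "\<xi> = 0")
  case False
  then obtain i where i: "\<xi> $ i \<noteq> 0"
    by (auto simp: vec_eq_iff)
  define h :: "real ^ 'n" where "h = axis i (1 / (2 * of_int (\<xi> $ i)))"
  have h: "tchar h \<xi> = -1"
    using i by (simp add: tchar_def h_def inner_axis' cis_conv_exp)
  have "(LINT x|torus. tchar x \<xi>) = (LINT x|torus. tchar (x + h) \<xi>)"
    by (rule integral_torus_shift[symmetric]) (auto intro!: continuous_intros periodic_tchar)
  also have "\<dots> = - (LINT x|torus. tchar x \<xi>)"
    by (simp add: tchar_add h)
  finally show ?thesis
    using False by simp
qed simp

text \<open>The sum runs over the support and is 0 by convention if that is infinite, so finite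
  support is assumed wherever the value matters.\<close>

definition trig :: "(int ^ 'n \<Rightarrow> complex) \<Rightarrow> real ^ 'n \<Rightarrow> complex" where
  "trig a x = (\<Sum>\<xi> | a \<xi> \<noteq> 0. a \<xi> * tchar x \<xi>)"

lemma trig_eq_sum:
  assumes "finite S" "\<And>\<xi>. \<xi> \<notin> S \<Longrightarrow> a \<xi> = 0"
  shows "trig a x = (\<Sum>\<xi>\<in>S. a \<xi> * tchar x \<xi>)"
  unfolding trig_def using assms by (intro sum.mono_neutral_left) auto

lemma continuous_on_trig [continuous_intros]: "continuous_on S f \<Longrightarrow> continuous_on S (\<lambda>x. trig a (f x))"
  unfolding trig_def by (intro continuous_intros)

lemma periodic_trig: "periodic (trig a)"
  by (simp add: periodic_def trig_def tchar_add)

lemma trig_periodic [simp]: "trig a (x + int_vec k) = trig a x"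
  using periodic_trig by (auto simp: periodic_def)

lemma finite_support_diff_op:
  assumes "finite {\<xi>. a \<xi> \<noteq> 0}"
  shows "finite {\<xi>. diff_op i a \<xi> \<noteq> 0}"
proof (rule finite_subset)
  show "{\<xi>. diff_op i a \<xi> \<noteq> 0} \<subseteq> {\<xi>. a \<xi> \<noteq> 0} \<union> (\<lambda>\<xi>. \<xi> - axis i 1) ` {\<xi>. a \<xi> \<noteq> 0}"
    by (auto simp: diff_op_def image_iff dest!: spec[of _ "_ + axis i 1"])
qed (use assms in auto)

text \<open>Summation by parts: shifting the coefficients by a unit vector multiplies the polynomial
  by a character.\<close>

lemma trig_diff_op:
  assumes "finite {\<xi>. a \<xi> \<noteq> 0}"
  shows "trig (diff_op i a) x = (tchar (- x) (axis i 1) - 1) * trig a x"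
proof -
  define S where "S = {\<xi>. a \<xi> \<noteq> 0}"
  \<comment> \<open>A difference can also be nonzero one step before the support of
    \<open>a\<close>, so sums run over S \<union> S'.\<close>
  define S' where "S' = (\<lambda>\<xi>. \<xi> - axis i 1) ` S"
  have fin: "finite S" "finite S'"
    using assms by (auto simp: S_def S'_def)
  have shift: "a (\<xi> + axis i 1) = 0" if "\<xi> \<notin> S'" for \<xi>
    using that by (auto simp: S_def S'_def image_iff dest!: spec[of _ "\<xi> + axis i 1"])
  have "trig (diff_op i a) x = (\<Sum>\<xi>\<in>S \<union> S'. diff_op i a \<xi> * tchar x \<xi>)"
    using fin shift by (intro trig_eq_sum) (auto simp: diff_op_def S_def)
  also have "\<dots> = (\<Sum>\<xi>\<in>S \<union> S'. a (\<xi> + axis i 1) * tchar x \<xi>) - (\<Sum>\<xi>\<in>S \<union> S'. a \<xi> * tchar x \<xi>)"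
    by (simp add: diff_op_def algebra_simps sum_subtractf)
  also have "(\<Sum>\<xi>\<in>S \<union> S'. a \<xi> * tchar x \<xi>) = trig a x"
    using fin by (intro trig_eq_sum[symmetric]) (auto simp: S_def)
  also have "(\<Sum>\<xi>\<in>S \<union> S'. a (\<xi> + axis i 1) * tchar x \<xi>) = (\<Sum>\<xi>\<in>S'. a (\<xi> + axis i 1) * tchar x \<xi>)"
    using fin shift by (intro sum.mono_neutral_right) auto
  also have "\<dots> = (\<Sum>\<xi>\<in>S. a \<xi> * tchar x (\<xi> - axis i 1))"
    unfolding S'_def by (subst sum.reindex) (auto simp: inj_on_def)
  also have "\<dots> = tchar (- x) (axis i 1) * trig a x"
  proof -
    have "tchar x (\<xi> - axis i 1) = tchar (- x) (axis i 1) * tchar x \<xi>" for \<xi>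
      using tchar_add_right[of x \<xi> "- axis i 1"] by (simp add: tchar_uminus)
    then show ?thesis
      by (simp add: trig_def S_def sum_distrib_left mult_ac)
  qed
  finally show ?thesis
    by (simp add: algebra_simps)
qed

lemma finite_support_diff_op_funpow:
  "finite {\<xi>. a \<xi> \<noteq> 0} \<Longrightarrow> finite {\<xi>. (diff_op i ^^ m) a \<xi> \<noteq> 0}"
  by (induction m) (auto intro: finite_support_diff_op)

lemma trig_diff_op_funpow:
  "finite {\<xi>. a \<xi> \<noteq> 0} \<Longrightarrow> trig ((diff_op i ^^ m) a) x = (tchar (- x) (axis i 1) - 1) ^ m * trig a x"
  by (induction m) (simp_all add: trig_diff_op finite_support_diff_op_funpow)

lemma parseval_trig:
  fixes a :: "int ^ 'n \<Rightarrow> complex"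
  assumes "finite {\<xi>. a \<xi> \<noteq> 0}"
  shows "(LINT x|torus. (norm (trig a x))\<^sup>2) = (\<Sum>\<xi> | a \<xi> \<noteq> 0. (norm (a \<xi>))\<^sup>2)"
proof -
  let ?S = "{\<xi>. a \<xi> \<noteq> 0}"
  have int: "integrable torus (\<lambda>x. c * tchar x \<xi>)" for c \<xi>
    by (intro integrable_torus_continuous continuous_intros)
  have "complex_of_real (LINT x|torus. (norm (trig a x))\<^sup>2) = (LINT x|torus. complex_of_real ((norm (trig a x))\<^sup>2))"
    by (rule integral_complex_of_real[symmetric])
  also have "\<dots> = (LINT x|torus. (\<Sum>\<xi>\<in>?S. \<Sum>\<eta>\<in>?S. (a \<xi> * cnj (a \<eta>)) * tchar x (\<xi> - \<eta>)))"
  proof (intro Bochner_Integration.integral_cong refl)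
    fix x :: "real ^ 'n"
    have "complex_of_real ((norm (trig a x))\<^sup>2) = trig a x * cnj (trig a x)"
      by (rule complex_norm_square)
    also have "\<dots> = (\<Sum>\<xi>\<in>?S. \<Sum>\<eta>\<in>?S. (a \<xi> * tchar x \<xi>) * cnj (a \<eta> * tchar x \<eta>))"
      by (simp add: trig_def sum_product)
    also have "\<dots> = (\<Sum>\<xi>\<in>?S. \<Sum>\<eta>\<in>?S. (a \<xi> * cnj (a \<eta>)) * tchar x (\<xi> - \<eta>))"
      by (intro sum.cong refl, subst diff_conv_add_uminus, subst tchar_add_right) (simp add: tchar_uminus)
    finally show "complex_of_real ((norm (trig a x))\<^sup>2) = (\<Sum>\<xi>\<in>?S. \<Sum>\<eta>\<in>?S. (a \<xi> * cnj (a \<eta>)) * tchar x (\<xi> - \<eta>))" .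
  qed
  also have "\<dots> = (\<Sum>\<xi>\<in>?S. \<Sum>\<eta>\<in>?S. (a \<xi> * cnj (a \<eta>)) * (if \<xi> = \<eta> then 1 else 0))"
    by (intro trans[OF Bochner_Integration.integral_sum] sum.cong refl Bochner_Integration.integrable_sum int)
       (simp add: integral_tchar)
  also have "\<dots> = (\<Sum>\<xi>\<in>?S. complex_of_real ((norm (a \<xi>))\<^sup>2))"
    using assms by (intro sum.cong refl) (simp add: if_distrib complex_norm_square[symmetric] cong: if_cong)
  finally show ?thesis
    by (simp only: of_real_sum[symmetric] of_real_eq_iff)
qed

subsection \<open>The kernel estimate\<close>

text \<open>
  By Cauchy-Schwarz the \<open>L^1\<close> norm of a trigonometric polynomial \<open>K\<close> is controlled by the \<open>L^2\<close> norm of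
  \<open>K\<close> times a weight that is of size 1 on the ball of radius \<open>R\<close> and grows like \<open>(|x| / R)^N\<close> outside;
  multiplication of \<open>K\<close> by \<open>cis (- 2 \<pi> x\<^sub>i) - 1\<close> is a difference operator on the coefficients.
\<close>

definition chord :: "real \<Rightarrow> real" where
  "chord t = norm (cis (2 * pi * t) - 1)"

lemma chord_nonneg [simp]: "0 \<le> chord t"
  by (simp add: chord_def)

lemma continuous_on_chord [continuous_intros]: "continuous_on S f \<Longrightarrow> continuous_on S (\<lambda>x. chord (f x))"
  unfolding chord_def by (intro continuous_intros)

lemma chord_measurable [measurable]: "chord \<in> borel_measurable borel"
  by (intro borel_measurable_continuous_onI continuous_on_chord continuous_on_id)

lemma chord_reflect: "chord (1 - t) = chord t"
proof -
  have "cis (2 * pi * (1 - t)) = cis (2 * pi) * cnj (cis (2 * pi * t))"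
    by (simp add: cis_mult cis_cnj algebra_simps)
  also have "cis (2 * pi) = 1"
    by (simp add: complex_eq_iff)
  finally have "cis (2 * pi * (1 - t)) - 1 = cnj (cis (2 * pi * t) - 1)"
    by simp
  then show ?thesis
    unfolding chord_def by (metis complex_mod_cnj)
qed

lemma norm_tchar_axis: "norm (tchar (- x) (axis i 1) - 1) = chord (x $ i)"
proof -
  have "tchar (- x) (axis i 1) - 1 = cnj (cis (2 * pi * x $ i) - 1)"
    by (simp add: tchar_uminus tchar_axis cis_cnj)
  then show ?thesis
    by (simp only: chord_def complex_mod_cnj)
qed

text \<open>The chord has length 2 |sin (\<pi> t)|. Up to the angle \<pi>/3 the sine is at least
  half the angle, by the mean value theorem; beyond it the real part alone reaches 1/2 \<ge>
  t.\<close>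

lemma chord_ge:
  assumes t: "0 \<le> t" "t \<le> 1 / 2"
  shows "t \<le> chord t"
proof -
  define \<theta> where "\<theta> = 2 * pi * t"
  have pi: "3 < pi" using pi_gt3 .
  have \<theta>: "0 \<le> \<theta>" "\<theta> \<le> pi" using t by (auto simp: \<theta>_def)
  have Re: "1 - cos \<theta> \<le> chord t"
    using complex_Re_le_cmod[of "1 - cis \<theta>"] by (simp add: chord_def \<theta>_def norm_minus_commute)
  have Im: "sin \<theta> \<le> chord t"
    using abs_Im_le_cmod[of "cis \<theta> - 1"] by (simp add: chord_def \<theta>_def)
  show ?thesis
  proof (cases "\<theta> \<le> pi / 3")
    case True
    show ?thesis
    proof (cases "\<theta> = 0")
      case False
      then have "0 < \<theta>" using \<theta> by simp
      then obtain z where z: "0 < z" "z < \<theta>" "sin \<theta> - sin 0 = (\<theta> - 0) * cos z"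
        using MVT2[of 0 \<theta> sin cos] by (auto intro: DERIV_sin)
      have "cos (pi / 3) \<le> cos z"
        using z True pi by (intro cos_monotone_0_pi_le) auto
      then have "1 / 2 \<le> cos z" by (simp add: cos_60)
      then have "\<theta> * (1 / 2) \<le> sin \<theta>"
        using z \<theta> by (simp add: mult_left_mono)
      moreover have "t \<le> \<theta> * (1 / 2)"
        using t pi mult_right_mono[of 1 pi t] by (simp add: \<theta>_def)
      ultimately show ?thesis using Im by linarith
    qed (use \<open>0 \<le> \<theta>\<close> pi in \<open>simp add: \<theta>_def\<close>)
  next
    case False
    then have "cos \<theta> \<le> cos (pi / 3)"
      using \<theta> pi by (intro cos_monotone_0_pi_le) auto
    then have "1 / 2 \<le> 1 - cos \<theta>" by (simp add: cos_60)
    then show ?thesis using Re t by linarith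
  qed
qed

text \<open>Reflection at 1/2 leaves two halves, where the chord dominates t. The majorant is 1 up
  to \<open>R\<close> and (t/R)^(-m/n) beyond, integrable because m > n. The exponent -1/n is the
  share of one coordinate among n in the product bound for the full weight.\<close>

lemma nn_integral_chord_decay:
  fixes s R :: real and m n :: nat
  assumes R: "0 < R" and n: "n > 0" and mn: "m > n"
  shows "(\<integral>\<^sup>+t. ennreal ((1 + (chord t / R) ^ m) powr (- 1 / n)) * indicator {0..1} t \<partial>lborel) \<le> ennreal (2 * (1 + 1 / (m / n - 1)) * R)"
proof -
  define s where "s = real m / n"
  have s: "s > 1" using mn n by (simp add: s_def)
  define w where "w t = indicator {0..R} t + ennreal ((t / R) powr (- s)) * indicator {R..} t" for t
  have [measurable]: "w \<in> borel_measurable borel"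
    unfolding w_def by measurable
  have v_le: "ennreal ((1 + (chord t / R) ^ m) powr (- 1 / n)) \<le> w t" if t: "0 \<le> t" "t \<le> 1 / 2" for t
  proof (cases "t \<le> R")
    case True
    have "1 \<le> (1 + (chord t / R) ^ m) powr (1 / n)"
      using R by (intro ge_one_powr_ge_zero) auto
    then have "(1 + (chord t / R) ^ m) powr (- 1 / n) \<le> 1"
      by (simp add: powr_minus inverse_le_1_iff)
    then have "ennreal ((1 + (chord t / R) ^ m) powr (- 1 / n)) \<le> 1"
      using ennreal_leI by fastforce
    then show ?thesis
      using True t by (auto simp: w_def intro: add_increasing2)
  next
    case False
    then have tR: "t / R > 0" using R by auto
    have "(t / R) ^ m \<le> 1 + (chord t / R) ^ m"
      using power_mono[of "t / R" "chord t / R" m] chord_ge[OF t] R t by (auto simp: divide_right_mono)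
    moreover have "0 < (t / R) ^ m"
      using tR by simp
    ultimately have "(1 + (chord t / R) ^ m) powr (- 1 / n) \<le> ((t / R) ^ m) powr (- 1 / n)"
      by (intro powr_mono2') auto
    also have "\<dots> = (t / R) powr (- s)"
      using tR by (simp add: powr_realpow[symmetric] powr_powr s_def)
    finally show ?thesis
      using False t R by (simp add: w_def ennreal_leI)
  qed
  have "(\<integral>\<^sup>+t. ennreal ((1 + (chord t / R) ^ m) powr (- 1 / n)) * indicator {0..1} t \<partial>lborel) \<le> (\<integral>\<^sup>+t. w t + w (1 - t) \<partial>lborel)"
  proof (rule nn_integral_mono)
    fix t :: real
    show "ennreal ((1 + (chord t / R) ^ m) powr (- 1 / n)) * indicator {0..1} t \<le> w t + w (1 - t)"
    proof (cases "t \<in> {0..1}")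
      case True
      then show ?thesis
        using v_le[of t] v_le[of "1 - t"] by (cases "t \<le> 1 / 2") (auto simp: chord_reflect intro: add_increasing add_increasing2)
    qed auto
  qed
  also have "\<dots> = (\<integral>\<^sup>+t. w t \<partial>lborel) + (\<integral>\<^sup>+t. w (1 - t) \<partial>lborel)"
    by (rule nn_integral_add) auto
  also have "(\<integral>\<^sup>+t. w (1 - t) \<partial>lborel) = (\<integral>\<^sup>+t. w t \<partial>lborel)"
    by (subst (2) nn_integral_real_affine[where t = 1 and c = "-1"]) auto
  also have "(\<integral>\<^sup>+t. w t \<partial>lborel) = ennreal R + (\<integral>\<^sup>+t. ennreal ((t / R) powr (- s)) * indicator {R..} t \<partial>lborel)"
    unfolding w_def using R by (subst nn_integral_add) auto
  also have "(\<integral>\<^sup>+t. ennreal ((t / R) powr (- s)) * indicator {R..} t \<partial>lborel) = ennreal (R / (s - 1))"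
  proof (rule nn_integral_has_integral_lebesgue')
    have "((\<lambda>t. R powr s * t powr (- s)) has_integral R powr s * (- (R powr (- s + 1)) / (- s + 1))) {R..}"
      using has_integral_powr_to_inf[of "- s" R] s R by (intro has_integral_mult_right) auto
    moreover have "R powr s * (- (R powr (- s + 1)) / (- s + 1)) = R / (s - 1)"
      using s R by (simp add: powr_add[symmetric] divide_simps) (simp add: algebra_simps powr_add powr_minus)?
    moreover have "R powr s * t powr (- s) = (t / R) powr (- s)" if "t \<in> {R..}" for t
      using that R by (simp add: powr_divide powr_minus divide_simps)
    ultimately show "((\<lambda>t. (t / R) powr (- s)) has_integral R / (s - 1)) {R..}"
      by (subst has_integral_cong[where g = "\<lambda>t. R powr s * t powr (- s)"]) auto
  qed auto
  also have "ennreal R + ennreal (R / (s - 1)) + (ennreal R + ennreal (R / (s - 1))) = ennreal (2 * (1 + 1 / (s - 1)) * R)"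
    using R s by (simp add: ennreal_plus[symmetric] algebra_simps del: ennreal_plus)
  finally show ?thesis
    by (simp add: s_def)
qed

lemma prod_Basis_vec: "(\<Prod>b\<in>Basis. g (x \<bullet> b)) = (\<Prod>i\<in>UNIV. g ((x :: real ^ 'n) $ i))"
proof -
  have "(Basis :: (real ^ 'n) set) = (\<lambda>i. axis i 1) ` UNIV"
    by (auto simp: Basis_vec_def)
  then have "(\<Prod>b\<in>Basis. g (x \<bullet> b)) = (\<Prod>b\<in>(\<lambda>i. axis i 1) ` UNIV. g (x \<bullet> b))"
    by (rule arg_cong)
  also have "\<dots> = (\<Prod>i\<in>UNIV. g (x $ i))"
    by (subst prod.reindex) (auto simp: inj_on_def axis_eq_axis inner_axis)
  finally show ?thesis .
qed

text \<open>Each 1 + a_i is at most 1 + \<Sum> a_i, so taking n-th roots gives 1 / (1 + \<Sum> a_i)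
  \<le> \<Prod> (1 + a_i)^(-1/n). The product separates the variables into n copies of the
  one-dimensional integral.\<close>

lemma nn_integral_weight:
  fixes R :: real and m :: nat
  assumes R: "0 < R" and m: "m > CARD('n)"
  shows "(\<integral>\<^sup>+x. ennreal (1 / (1 + (\<Sum>i\<in>UNIV. (chord (x $ i) / R) ^ m))) \<partial>(torus :: (real ^ 'n) measure)) 
    \<le> ennreal ((2 * (1 + 1 / (m / CARD('n) - 1))) ^ CARD('n) * R ^ CARD('n))"
proof -
  define c where "c = 2 * (1 + 1 / (m / CARD('n) - 1))"
  define v where "v t = ennreal ((1 + (chord t / R) ^ m) powr (- 1 / CARD('n)))" for t
  have [measurable]: "v \<in> borel_measurable borel"
    unfolding v_def by measurable
  have "(\<integral>\<^sup>+x. ennreal (1 / (1 + (\<Sum>i\<in>UNIV. (chord (x $ i) / R) ^ m))) \<partial>(torus :: (real ^ 'n) measure))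
     \<le> (\<integral>\<^sup>+x. (\<Prod>b\<in>Basis. v (x \<bullet> b)) \<partial>(torus :: (real ^ 'n) measure))"
  proof (rule nn_integral_mono)
    fix x :: "real ^ 'n"
    define a where "a i = (chord (x $ i) / R) ^ m" for i
    have a: "0 \<le> a i" for i
      using R by (simp add: a_def)
    define A where "A = 1 + (\<Sum>i\<in>UNIV. a i)"
    have A: "A \<ge> 1" using a by (simp add: A_def sum_nonneg)
    have "A powr - 1 = (\<Prod>i\<in>(UNIV :: 'n set). A powr (- 1 / CARD('n)))"
      using A by (simp add: powr_realpow[symmetric] powr_powr)
    also have "\<dots> \<le> (\<Prod>i\<in>UNIV. (1 + a i) powr (- 1 / CARD('n)))"
      using a by (intro prod_mono conjI powr_mono2') (auto simp: A_def intro!: member_le_sum add_pos_nonneg)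
    finally have "1 / A \<le> (\<Prod>i\<in>UNIV. (1 + a i) powr (- 1 / CARD('n)))"
      using A by (simp add: powr_minus_divide)
    then have "ennreal (1 / A) \<le> ennreal (\<Prod>i\<in>UNIV. (1 + a i) powr (- 1 / CARD('n)))"
      by (rule ennreal_leI)
    also have "\<dots> = (\<Prod>b\<in>Basis. v (x \<bullet> b))"
      unfolding prod_Basis_vec[of v x] unfolding v_def a_def by (rule prod_ennreal[symmetric]) auto
    finally show "ennreal (1 / (1 + (\<Sum>i\<in>UNIV. (chord (x $ i) / R) ^ m))) \<le> (\<Prod>b\<in>Basis. v (x \<bullet> b))"
      by (simp add: A_def a_def)
  qed
  also have "\<dots> = (\<integral>\<^sup>+x. (\<Prod>b\<in>Basis. v (x \<bullet> b) * indicator {0..1} (x \<bullet> b)) \<partial>(lborel :: (real ^ 'n) measure))"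
    unfolding nn_integral_torus
  proof (intro nn_integral_cong)
    fix x :: "real ^ 'n"
    have "indicator (cbox 0 1) x = (\<Prod>i\<in>UNIV. indicator {0..1} (x $ i) :: ennreal)"
      by (cases "x \<in> cbox 0 1") (auto simp: mem_box_cart indicator_def)
    then show "(\<Prod>b\<in>Basis. v (x \<bullet> b)) * indicator (cbox 0 1) x = (\<Prod>b\<in>Basis. v (x \<bullet> b) * indicator {0..1} (x \<bullet> b))"
      using prod_Basis_vec[of "indicator {0..1} :: real \<Rightarrow> ennreal" x] by (simp only: prod.distrib)
  qed
  also have "\<dots> = (\<integral>\<^sup>+t. v t * indicator {0..1} t \<partial>lborel) ^ CARD('n)"
    by (subst nn_integral_lborel_prod) auto
  also have "\<dots> \<le> ennreal (c * R) ^ CARD('n)"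
    unfolding v_def c_def using nn_integral_chord_decay[OF R _ m] by (intro power_mono) auto
  also have "\<dots> = ennreal (c ^ CARD('n) * R ^ CARD('n))"
    using R m by (subst ennreal_power) (auto simp: c_def power_mult_distrib)
  finally show ?thesis
    by (simp add: c_def)
qed

definition l2_norm_sq :: "(int ^ 'n \<Rightarrow> complex) \<Rightarrow> real" where
  "l2_norm_sq a = (\<Sum>\<xi> | a \<xi> \<noteq> 0. (norm (a \<xi>))\<^sup>2)"

proposition trig_L1_bound:
  fixes a :: "int ^ 'n \<Rightarrow> complex"
  assumes fin: "finite {\<xi>. a \<xi> \<noteq> 0}" and R: "0 < R" and N: "2 * N > CARD('n)"
  defines "c \<equiv> (2 * (1 + 1 / (real (2 * N) / CARD('n) - 1))) ^ CARD('n)"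
  shows "(LINT x|torus. norm (trig a x)) ^ 2 \<le> 
    c * R ^ CARD('n) * (l2_norm_sq a + (\<Sum>i\<in>UNIV. l2_norm_sq ((diff_op i ^^ N) a) / R ^ (2 * N)))"
proof -
  define w :: "real ^ 'n \<Rightarrow> real" where "w x = 1 + (\<Sum>i\<in>UNIV. (chord (x $ i) / R) ^ (2 * N))" for x
  have w: "w x \<ge> 1" for x
    using R by (simp add: w_def sum_nonneg)
  have w_pos: "w x \<noteq> 0" for x
    using w[of x] by linarith
  have w_cont: "continuous_on UNIV w"
    unfolding w_def using R by (intro continuous_intros) auto
  define D where "D = l2_norm_sq a + (\<Sum>i\<in>UNIV. l2_norm_sq ((diff_op i ^^ N) a) / R ^ (2 * N))"
  have l2: "l2_norm_sq b \<ge> 0" for b :: "int ^ 'n \<Rightarrow> complex"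
    by (simp add: l2_norm_sq_def sum_nonneg)
  have c0: "c \<ge> 0"
    using N by (simp add: c_def field_simps)
  have D0: "D \<ge> 0"
    using R l2 unfolding D_def by (intro add_nonneg_nonneg sum_nonneg divide_nonneg_nonneg) auto
  have parts: "(LINT x|torus. (norm (trig ((diff_op i ^^ m) a) x))\<^sup>2) = l2_norm_sq ((diff_op i ^^ m) a)" for i m
    unfolding l2_norm_sq_def by (intro parseval_trig finite_support_diff_op_funpow fin)
  have integrable: "integrable torus (\<lambda>x. (norm (trig b x))\<^sup>2)" for b :: "int ^ 'n \<Rightarrow> complex"
    by (intro integrable_torus_continuous continuous_intros)
  have weighted: "(norm (trig a x))\<^sup>2 * w x = (norm (trig a x))\<^sup>2 + (\<Sum>i\<in>UNIV. (norm (trig ((diff_op i ^^ N) a) x))\<^sup>2 / R ^ (2 * N))" for x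
    by (simp add: w_def trig_diff_op_funpow[OF fin] norm_mult norm_power norm_tchar_axis power_mult_distrib
        power_divide distrib_left sum_distrib_left power_mult[symmetric] mult_ac)
  have "(LINT x|torus. (norm (trig a x))\<^sup>2 * w x) = D"
    unfolding weighted D_def
    using parts[where m = N] parts[where m = 0] integrable
    by (subst Bochner_Integration.integral_add) (auto intro!: Bochner_Integration.integrable_sum)
  moreover have "integrable torus (\<lambda>x. (norm (trig a x))\<^sup>2 * w x)"
    using w_cont by (intro integrable_torus_continuous continuous_intros)
  ultimately have D: "(\<integral>\<^sup>+x. ennreal ((norm (trig a x))\<^sup>2 * w x) \<partial>torus) = ennreal D"
    using w by (subst nn_integral_eq_integral) (auto intro!: AE_I2 mult_nonneg_nonneg intro: order_trans[OF zero_le_one])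
  have meas: "(\<lambda>x. ennreal (norm (trig a x) * sqrt (w x))) \<in> borel_measurable torus" "(\<lambda>x. ennreal (1 / sqrt (w x))) \<in> borel_measurable torus"
    using w_pos by (intro measurable_compose[OF _ measurable_ennreal] borel_measurable_torus_continuous continuous_intros w_cont; simp)+
  have "ennreal ((LINT x|torus. norm (trig a x)) ^ 2) = (\<integral>\<^sup>+x. ennreal (norm (trig a x)) \<partial>torus) ^ 2"
    by (subst nn_integral_eq_integral) (auto intro!: integrable_torus_continuous continuous_intros simp: ennreal_power integral_nonneg_AE)
  also have "(\<integral>\<^sup>+x. ennreal (norm (trig a x)) \<partial>torus) = (\<integral>\<^sup>+x. ennreal (norm (trig a x) * sqrt (w x)) * ennreal (1 / sqrt (w x)) \<partial>torus)"
  proof (intro nn_integral_cong)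
    fix x
    have "sqrt (w x) > 0" using w[of x] by simp
    then show "ennreal (norm (trig a x)) = ennreal (norm (trig a x) * sqrt (w x)) * ennreal (1 / sqrt (w x))"
      by (subst ennreal_mult[symmetric]) auto
  qed
  also have "\<dots>\<^sup>2 \<le> (\<integral>\<^sup>+x. ennreal (norm (trig a x) * sqrt (w x)) ^ 2 \<partial>torus) * (\<integral>\<^sup>+x. ennreal (1 / sqrt (w x)) ^ 2 \<partial>torus)"
    by (intro Cauchy_Schwarz_nn_integral meas)
  also have "(\<integral>\<^sup>+x. ennreal (norm (trig a x) * sqrt (w x)) ^ 2 \<partial>torus) = ennreal D"
    unfolding D[symmetric] 
  proof (intro nn_integral_cong)
    fix x show "ennreal (norm (trig a x) * sqrt (w x)) ^ 2 = ennreal ((norm (trig a x))\<^sup>2 * w x)"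
      using w[of x] by (subst ennreal_power) (auto simp: power_mult_distrib)
  qed
  also have "(\<integral>\<^sup>+x. ennreal (1 / sqrt (w x)) ^ 2 \<partial>torus) = (\<integral>\<^sup>+x. ennreal (1 / w x) \<partial>torus)"
  proof (intro nn_integral_cong)
    fix x show "ennreal (1 / sqrt (w x)) ^ 2 = ennreal (1 / w x)"
      using w[of x] by (subst ennreal_power) (auto simp: power_divide)
  qed
  also have "ennreal D * (\<integral>\<^sup>+x. ennreal (1 / w x) \<partial>torus) \<le> ennreal D * ennreal (c * R ^ CARD('n))"
    unfolding w_def c_def using N by (intro mult_left_mono nn_integral_weight R) auto
  also have "\<dots> = ennreal (c * R ^ CARD('n) * D)"
    using D0 c0 R by (subst ennreal_mult[symmetric]) (auto simp: mult_ac)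
  finally show ?thesis
    using D0 c0 R unfolding D_def by (subst (asm) ennreal_le_iff) auto
qed

section \<open>Dyadic cutoffs\<close>

text \<open>
  Averaging over \<open>L\<close> consecutive integers gains a factor \<open>2 / L\<close> per difference, so \<open>N\<close> averages of an
  indicator function give a cutoff whose differences up to order \<open>N\<close> behave like those of a smooth
  cutoff at scale \<open>L\<close>.
\<close>

definition dif :: "(int \<Rightarrow> complex) \<Rightarrow> int \<Rightarrow> complex" where
  "dif f m = f (m + 1) - f m"

definition avg :: "nat \<Rightarrow> (int \<Rightarrow> complex) \<Rightarrow> int \<Rightarrow> complex" where
  "avg L f m = (\<Sum>l<L. f (m - int l)) / of_nat L"

lemma dif_funpow_Suc: "(dif ^^ Suc k) f = (\<lambda>m. (dif ^^ k) f (m + 1) - (dif ^^ k) f m)"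
  by (auto simp: dif_def)

lemma avg_funpow_Suc: "(avg L ^^ Suc k) f = (\<lambda>m. (\<Sum>l<L. (avg L ^^ k) f (m - int l)) / of_nat L)"
  by (auto simp: avg_def)

lemma diff_op_funpow_Suc: "(diff_op i ^^ Suc k) f = (\<lambda>\<xi>. (diff_op i ^^ k) f (\<xi> + axis i 1) - (diff_op i ^^ k) f \<xi>)"
  by (auto simp: diff_op_def)

lemma dif_funpow_shift:
  "(dif ^^ k) (\<lambda>m. (f (m + a) - f (m + b)) / c) = (\<lambda>m. ((dif ^^ k) f (m + a) - (dif ^^ k) f (m + b)) / c)"
proof (induction k)
  case (Suc k)
  show ?case
    unfolding dif_funpow_Suc Suc.IH by (simp add: fun_eq_iff algebra_simps diff_divide_distrib add_divide_distrib)
qed simp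

text \<open>The average telescopes: its difference sees only two points at distance
  \<open>L\<close>, which is the source of the gain 1 / L.\<close>

lemma dif_avg:
  assumes "L > 0"
  shows "dif (avg L f) = (\<lambda>m. (f (m + 1) - f (m + (1 - int L))) / of_nat L)"
proof
  fix m
  have "(\<Sum>l<L. f (m + 1 - int l) - f (m + 1 - int (Suc l))) = f (m + 1 - int 0) - f (m + 1 - int L)"
    by (rule sum_lessThan_telescope')
  then have "(\<Sum>l<L. f (m + 1 - int l)) - (\<Sum>l<L. f (m - int l)) = f (m + 1) - f (m + (1 - int L))"
    by (simp add: sum_subtractf algebra_simps)
  then show "dif (avg L f) m = (f (m + 1) - f (m + (1 - int L))) / of_nat L"
    by (simp add: dif_def avg_def diff_divide_distrib[symmetric])
qed

lemma norm_avg_le: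
  assumes "L > 0" "\<And>m. norm (f m) \<le> B"
  shows "norm (avg L f m) \<le> B"
proof -
  have "norm (\<Sum>l<L. f (m - int l)) \<le> (\<Sum>l<L. B)"
    by (intro order_trans[OF norm_sum] sum_mono assms)
  then show ?thesis
    using assms(1) by (simp add: avg_def norm_divide divide_le_eq mult.commute)
qed

text \<open>Each difference uses up one average and leaves a two-point difference divided by
  \<open>L\<close>; the averages left over do not increase the sup bound.\<close>

lemma norm_dif_funpow_avg:
  assumes L: "L > 0" and f: "\<And>m. norm (f m) \<le> B"
  shows "k \<le> N \<Longrightarrow> norm ((dif ^^ k) ((avg L ^^ N) f) m) \<le> (2 / L) ^ k * B"
proof (induction k arbitrary: N m)
  case 0
  have "norm ((avg L ^^ N) f m) \<le> B" for m
    by (induction N arbitrary: m) (auto intro: f norm_avg_le[OF L])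
  then show ?case by simp
next
  case (Suc k)
  then obtain N' where N: "N = Suc N'" "k \<le> N'"
    by (cases N) auto
  define g where "g = (dif ^^ k) ((avg L ^^ N') f)"
  have "(dif ^^ Suc k) ((avg L ^^ N) f) m = (dif ^^ k) (dif (avg L ((avg L ^^ N') f))) m"
    by (simp add: N funpow_swap1)
  also have "\<dots> = (g (m + 1) - g (m + (1 - int L))) / of_nat L"
    unfolding dif_avg[OF L] dif_funpow_shift g_def ..
  also have "norm \<dots> \<le> ((2 / L) ^ k * B + (2 / L) ^ k * B) / L"
    unfolding norm_divide g_def norm_of_nat
    by (intro divide_right_mono order_trans[OF norm_triangle_ineq4] add_mono Suc.IH[OF N(2)]) simp
  also have "\<dots> = (2 / L) ^ Suc k * B"
    using L by (simp add: field_simps)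
  finally show ?case .
qed

text \<open>\<open>N\<close> averages look back over at most N L points. Starting from an indicator
  of radius (N + 1) L preserves the value 1 up to L and confines the support to (2 N + 1) L.\<close>

definition cutoff1 :: "nat \<Rightarrow> nat \<Rightarrow> int \<Rightarrow> complex" where
  "cutoff1 N L = (avg L ^^ N) (\<lambda>m. if \<bar>m\<bar> \<le> int ((N + 1) * L) then 1 else 0)"

lemma norm_dif_cutoff1:
  "L > 0 \<Longrightarrow> k \<le> N \<Longrightarrow> norm ((dif ^^ k) (cutoff1 N L) m) \<le> (2 / L) ^ k"
  unfolding cutoff1_def by (rule order_trans[OF norm_dif_funpow_avg[where B = 1]]) auto

text \<open>At m, \<open>k\<close> averages read \<open>f\<close> only at points m - l with l \<le>
  k L, so local constancy suffices.\<close>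

lemma avg_funpow_const:
  assumes L: "L > 0"
  shows "(\<And>l. l \<le> k * L \<Longrightarrow> f (m - int l) = c) \<Longrightarrow> (avg L ^^ k) f m = c"
proof (induction k arbitrary: m)
  case (Suc k)
  have "(avg L ^^ k) f (m - int l) = c" if "l < L" for l
  proof (rule Suc.IH)
    fix l' assume "l' \<le> k * L"
    then show "f (m - int l - int l') = c"
      using Suc.prems[of "l + l'"] that by (simp add: algebra_simps)
  qed
  then show ?case
    using L by (simp add: avg_funpow_Suc del: funpow.simps)
next
  case 0
  show ?case using 0[of 0] by simp
qed

lemma cutoff1_eq_1: "L > 0 \<Longrightarrow> \<bar>m\<bar> \<le> int L \<Longrightarrow> cutoff1 N L m = 1"
  unfolding cutoff1_def
proof (rule avg_funpow_const)
  fix l assume "0 < L" "\<bar>m\<bar> \<le> int L" "l \<le> N * L"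
  moreover from this have "int l \<le> int (N * L)" by (simp only: of_nat_le_iff)
  ultimately show "(if \<bar>m - int l\<bar> \<le> int ((N + 1) * L) then 1 else 0 :: complex) = 1"
    by (auto simp: algebra_simps)
qed

lemma cutoff1_eq_0: 
  assumes L: "L > 0" and m: "int ((2 * N + 1) * L) < \<bar>m\<bar>"
  shows "cutoff1 N L m = 0"
  unfolding cutoff1_def
proof (rule avg_funpow_const[OF L])
  fix l assume "l \<le> N * L"
  then have "int l \<le> int (N * L)" by (simp only: of_nat_le_iff)
  then show "(if \<bar>m - int l\<bar> \<le> int ((N + 1) * L) then 1 else 0 :: complex) = 0"
    using m by (auto simp: algebra_simps)
qed

section \<open>Dyadic decomposition of the frequency lattice\<close>

definition cutoff :: "nat \<Rightarrow> nat \<Rightarrow> int ^ 'n \<Rightarrow> complex" where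
  "cutoff N j \<xi> = (\<Prod>i\<in>UNIV. cutoff1 N (2 ^ j) (\<xi> $ i))"

text \<open>Subtraction on the naturals gives 0 - 1 = 0, so j = 0 needs its own case: it keeps the
  whole low-frequency cutoff, and sums over j telescope without remainder.\<close>

definition dyadic_piece :: "nat \<Rightarrow> nat \<Rightarrow> int ^ 'n \<Rightarrow> complex" where
  "dyadic_piece N j \<xi> = cutoff N j \<xi> - (if j = 0 then 0 else cutoff N (j - 1) \<xi>)"

definition int_box :: "nat \<Rightarrow> (int ^ 'n) set" where
  "int_box L = {\<xi>. \<forall>i. \<bar>\<xi> $ i\<bar> \<le> int L}"

lemma int_box_eq: "int_box L = vec_lambda ` (PiE UNIV (\<lambda>_. {- int L..int L}))"
proof (intro equalityI subsetI)
  fix \<xi> :: "int ^ 'n" assume "\<xi> \<in> int_box L"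
  then have "vec_nth \<xi> \<in> PiE UNIV (\<lambda>_. {- int L..int L})"
    by (auto simp: int_box_def abs_le_iff minus_le_iff[of "int L"])
  then show "\<xi> \<in> vec_lambda ` (PiE UNIV (\<lambda>_. {- int L..int L}))"
    by (metis image_eqI vec_nth_inverse)
qed (auto simp: int_box_def abs_le_iff PiE_iff minus_le_iff[of _ "int L"])

lemma inj_vec_lambda: "inj_on vec_lambda A"
  by (auto simp: inj_on_def vec_lambda_inject)

lemma finite_int_box [simp]: "finite (int_box L :: (int ^ 'n) set)"
  unfolding int_box_eq by (intro finite_imageI finite_PiE) auto

lemma card_int_box: "card (int_box L :: (int ^ 'n) set) = (2 * L + 1) ^ CARD('n)"
  unfolding int_box_eq by (simp add: card_image[OF inj_vec_lambda] card_PiE nat_add_distrib nat_mult_distrib)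

lemma int_box_mono: "L \<le> L' \<Longrightarrow> int_box L \<subseteq> int_box L'"
  by (auto simp: int_box_def intro: order_trans[of _ "int L"])

lemma cutoff_eq_1: "\<xi> \<in> int_box (2 ^ j) \<Longrightarrow> cutoff N j \<xi> = 1"
  unfolding cutoff_def by (intro prod.neutral ballI cutoff1_eq_1) (auto simp: int_box_def)

lemma cutoff_eq_0:
  assumes "\<xi> \<notin> int_box ((2 * N + 1) * 2 ^ j)"
  shows "cutoff N j \<xi> = 0"
proof -
  obtain i where "int ((2 * N + 1) * 2 ^ j) < \<bar>\<xi> $ i\<bar>"
    using assms by (auto simp: int_box_def not_le)
  then have "cutoff1 N (2 ^ j) (\<xi> $ i) = 0"
    by (intro cutoff1_eq_0) auto
  then show ?thesis
    unfolding cutoff_def by (intro prod_zero) auto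
qed

text \<open>The tensor product form lets differences in direction \<open>i\<close> act on a single
  factor.\<close>

lemma diff_op_funpow_cutoff:
  "(diff_op i ^^ k) (cutoff N j) \<xi> = (\<Prod>l\<in>UNIV - {i}. cutoff1 N (2 ^ j) (\<xi> $ l)) * (dif ^^ k) (cutoff1 N (2 ^ j)) (\<xi> $ i)"
proof (induction k arbitrary: \<xi>)
  case 0
  show ?case
    unfolding cutoff_def by (subst prod.remove[of UNIV i]) auto
next
  case (Suc k)
  have "(\<xi> + axis i 1) $ l = \<xi> $ l" if "l \<noteq> i" for l
    using that by (simp add: axis_def)
  moreover have "(\<xi> + axis i 1) $ i = \<xi> $ i + 1"
    by simp
  ultimately show ?case
    by (simp add: diff_op_funpow_Suc dif_funpow_Suc Suc.IH right_diff_distrib del: funpow.simps)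
qed

lemma norm_diff_op_cutoff:
  assumes "k \<le> N"
  shows "norm ((diff_op i ^^ k) (cutoff N j) \<xi>) \<le> (2 / 2 ^ j) ^ k"
proof -
  have prod: "norm (\<Prod>l\<in>UNIV - {i}. cutoff1 N (2 ^ j) (\<xi> $ l)) \<le> 1"
    unfolding prod_norm[symmetric] using norm_dif_cutoff1[of "2 ^ j" 0 N] by (intro prod_le_1) auto
  show ?thesis
  proof -
    have "norm ((dif ^^ k) (cutoff1 N (2 ^ j)) (\<xi> $ i)) \<le> (2 / 2 ^ j) ^ k"
      using norm_dif_cutoff1[of "2 ^ j" k N "\<xi> $ i"] assms by simp
    with prod have "norm (\<Prod>l\<in>UNIV - {i}. cutoff1 N (2 ^ j) (\<xi> $ l)) * norm ((dif ^^ k) (cutoff1 N (2 ^ j)) (\<xi> $ i)) \<le> 1 * (2 / 2 ^ j) ^ k"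
      by (rule mult_mono) auto
    then show ?thesis
      by (simp add: diff_op_funpow_cutoff norm_mult)
  qed
qed

lemma norm_cutoff_le: "norm (cutoff N j \<xi>) \<le> 1"
  using norm_diff_op_cutoff[of 0 N _ j \<xi>] by simp

lemma diff_op_funpow_diff:
  "(diff_op i ^^ k) (\<lambda>\<xi>. f \<xi> - g \<xi>) = (\<lambda>\<xi>. (diff_op i ^^ k) f \<xi> - (diff_op i ^^ k) g \<xi>)"
  by (induction k) (auto simp: diff_op_def fun_eq_iff)

lemma diff_op_funpow_add:
  "(diff_op i ^^ k) (\<lambda>\<xi>. f \<xi> + g \<xi>) = (\<lambda>\<xi>. (diff_op i ^^ k) f \<xi> + (diff_op i ^^ k) g \<xi>)"
  by (induction k) (auto simp: diff_op_def fun_eq_iff)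

text \<open>The coarser cutoff has length 2^(j-1), hence the rate 4 / 2^j; the leading 2 counts the
  two cutoffs.\<close>

lemma norm_diff_op_dyadic_piece:
  assumes k: "k \<le> N"
  shows "norm ((diff_op i ^^ k) (dyadic_piece N j) \<xi>) \<le> 2 * (4 / 2 ^ j) ^ k"
proof (cases j)
  case 0
  then have "dyadic_piece N j = (cutoff N j :: int ^ 'a \<Rightarrow> complex)"
    by (auto simp: dyadic_piece_def fun_eq_iff)
  then have "norm ((diff_op i ^^ k) (dyadic_piece N j) \<xi>) \<le> (2 / 2 ^ j) ^ k"
    using norm_diff_op_cutoff[OF k] by simp
  also have "\<dots> \<le> 1 * (4 / 2 ^ j) ^ k"
    unfolding mult_1 by (intro power_mono divide_right_mono) auto
  also have "\<dots> \<le> 2 * (4 / 2 ^ j) ^ k"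
    by (intro mult_right_mono) auto
  finally show ?thesis .
next
  case (Suc j')
  then have "dyadic_piece N j = (\<lambda>\<xi> :: int ^ 'a. cutoff N j \<xi> - cutoff N j' \<xi>)"
    by (auto simp: dyadic_piece_def fun_eq_iff)
  then have "norm ((diff_op i ^^ k) (dyadic_piece N j) \<xi>) \<le> (2 / 2 ^ j) ^ k + (2 / 2 ^ j') ^ k"
    by (simp only: diff_op_funpow_diff) (intro order_trans[OF norm_triangle_ineq4] add_mono norm_diff_op_cutoff k)
  also have "\<dots> \<le> (4 / 2 ^ j) ^ k + (4 / 2 ^ j) ^ k"
    by (intro add_mono power_mono) (auto simp: Suc field_simps)
  finally show ?thesis by simp
qed

lemma dyadic_piece_eq_0:
  assumes "\<xi> \<notin> int_box ((2 * N + 1) * 2 ^ j)"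
  shows "dyadic_piece N j \<xi> = 0"
proof -
  have "(2 * N + 1) * 2 ^ (j - 1) \<le> (2 * N + 1) * 2 ^ j"
    by (intro mult_left_mono power_increasing) auto
  then have "\<xi> \<notin> int_box ((2 * N + 1) * 2 ^ (j - 1))"
    using assms int_box_mono by blast
  then show ?thesis
    using cutoff_eq_0[OF assms] cutoff_eq_0[of \<xi> N "j - 1"] by (auto simp: dyadic_piece_def)
qed

lemma sum_dyadic_piece: "(\<Sum>j<Suc J. dyadic_piece N j \<xi>) = cutoff N J \<xi>"
  by (induction J) (auto simp: dyadic_piece_def)

section \<open>The Japanese bracket on the supports of the pieces\<close>

lemma japanese_ge_1: "1 \<le> japanese \<xi>"
  by (simp add: japanese_def)

lemma norm_le_japanese: "norm (int_vec \<xi>) \<le> japanese \<xi>"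
  unfolding japanese_def by (rule real_le_rsqrt) simp

lemma japanese_shift: "japanese \<xi> \<le> japanese (\<xi> + \<eta>) + norm (int_vec \<eta>)"
proof -
  define a where "a = norm (int_vec (\<xi> + \<eta>))"
  define b where "b = norm (int_vec \<eta>)"
  have ab: "0 \<le> a" "0 \<le> b" by (auto simp: a_def b_def)
  have "norm (int_vec \<xi>) \<le> a + b"
    using norm_triangle_ineq4[of "int_vec (\<xi> + \<eta>)" "int_vec \<eta>"] by (simp add: a_def b_def int_vec_add)
  then have "1 + (norm (int_vec \<xi>))\<^sup>2 \<le> 1 + (a + b)\<^sup>2"
    by (intro add_left_mono power_mono) auto
  also have "\<dots> \<le> (sqrt (1 + a\<^sup>2) + b)\<^sup>2"
  proof -
    have "a \<le> sqrt (1 + a\<^sup>2)" by (rule real_le_rsqrt) simp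
    then have "a * b \<le> sqrt (1 + a\<^sup>2) * b" using ab by (intro mult_right_mono) auto
    then show ?thesis by (simp add: power2_sum algebra_simps)
  qed
  finally have "sqrt (1 + (norm (int_vec \<xi>))\<^sup>2) \<le> sqrt ((sqrt (1 + a\<^sup>2) + b)\<^sup>2)"
    by (rule real_sqrt_le_mono)
  then show ?thesis
    using ab by (simp add: japanese_def a_def b_def)
qed

text \<open>On the box of radius 2^(j-1) both cutoffs equal 1 and cancel, so for j > 0 a point of
  the support has a coordinate beyond 2^(j-1).\<close>

lemma dyadic_piece_nonzero_japanese:
  assumes "dyadic_piece N j \<xi> \<noteq> 0"
  shows "2 ^ j / 2 \<le> japanese \<xi>"
proof (cases j)
  case 0
  then show ?thesis using japanese_ge_1[of \<xi>] by simp
next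
  case (Suc j')
  have "\<xi> \<notin> int_box (2 ^ j')"
  proof
    assume \<xi>: "\<xi> \<in> int_box (2 ^ j')"
    then have "\<xi> \<in> int_box (2 ^ j)"
      using int_box_mono[of "2 ^ j'" "2 ^ j"] Suc by auto
    with \<xi> have "dyadic_piece N j \<xi> = 0"
      by (simp add: dyadic_piece_def cutoff_eq_1 Suc)
    with assms show False by simp
  qed
  then obtain i where i: "2 ^ j' < \<bar>\<xi> $ i\<bar>"
    by (auto simp: int_box_def not_le)
  then have "(2 :: real) ^ j' \<le> of_int \<bar>\<xi> $ i\<bar>"
    by (metis less_imp_le of_int_le_iff of_int_numeral of_int_power)
  also have "\<dots> \<le> norm (int_vec \<xi>)"
    using component_le_norm_cart[of "int_vec \<xi>" i] by simp
  also have "\<dots> \<le> japanese \<xi>"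
    by (rule norm_le_japanese)
  finally show ?thesis by (simp add: Suc)
qed

section \<open>A local Leibniz estimate for differences\<close>

lemma axis_add: "axis i (a :: int) + axis i b = axis i (a + b)"
  by (simp add: axis_def vec_eq_iff)

lemma diff_op_funpow_shift:
  "(diff_op i ^^ k) (\<lambda>\<xi>. f (\<xi> + \<eta>)) = (\<lambda>\<xi>. (diff_op i ^^ k) f (\<xi> + \<eta>))"
  by (induction k) (auto simp: diff_op_def fun_eq_iff algebra_simps)

text \<open>Geometric bounds A a^l and B b^l combine to (a + b)^N by induction, without binomial
  sums. They are asked for only where l + t \<le> N, which is all that an N-th difference reads,
  because the bounds on a symbol are available only away from low frequencies.\<close>

lemma norm_diff_op_mult_le:
  fixes f g :: "int ^ 'n \<Rightarrow> complex"
  assumes "\<And>l t. l + t \<le> N \<Longrightarrow> norm ((diff_op i ^^ l) f (\<xi> + axis i (int t))) \<le> A * a ^ l"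
    and "\<And>l t. l + t \<le> N \<Longrightarrow> norm ((diff_op i ^^ l) g (\<xi> + axis i (int t))) \<le> B * b ^ l"
  shows "norm ((diff_op i ^^ N) (\<lambda>\<xi>. f \<xi> * g \<xi>) \<xi>) \<le> A * B * (a + b) ^ N"
  using assms
proof (induction N arbitrary: f g A B)
  case 0
  have "norm (f \<xi>) \<le> A" "norm (g \<xi>) \<le> B"
    using 0(1)[of 0 0] 0(2)[of 0 0] by (simp_all add: axis_def zero_vec_def[symmetric])
  then show ?case
    by (auto simp: norm_mult intro!: mult_mono order_trans[OF norm_ge_zero])
next
  case (Suc N)
  \<comment> \<open>The discrete product rule evaluates \<open>g\<close> one step ahead; the offset
    t in the hypotheses absorbs this.\<close>
  have split: "diff_op i (\<lambda>\<xi>. f \<xi> * g \<xi>) = (\<lambda>\<xi>. diff_op i f \<xi> * g (\<xi> + axis i 1) + f \<xi> * diff_op i g \<xi>)"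
    by (auto simp: diff_op_def fun_eq_iff algebra_simps)
  have "(diff_op i ^^ Suc N) (\<lambda>\<xi>. f \<xi> * g \<xi>) \<xi> = 
    (diff_op i ^^ N) (\<lambda>\<xi>. diff_op i f \<xi> * g (\<xi> + axis i 1)) \<xi> + (diff_op i ^^ N) (\<lambda>\<xi>. f \<xi> * diff_op i g \<xi>) \<xi>"
    by (simp only: funpow_Suc_right o_def split diff_op_funpow_add)
  also have "norm \<dots> \<le> (A * a) * B * (a + b) ^ N + A * (B * b) * (a + b) ^ N"
  proof (intro order_trans[OF norm_triangle_ineq] add_mono Suc.IH)
    fix l t assume lt: "l + t \<le> N"
    show "norm ((diff_op i ^^ l) (diff_op i f) (\<xi> + axis i (int t))) \<le> A * a * a ^ l"
      using Suc.prems(1)[of "Suc l" t] lt by (simp add: funpow_swap1 mult.assoc)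
    show "norm ((diff_op i ^^ l) (diff_op i g) (\<xi> + axis i (int t))) \<le> B * b * b ^ l"
      using Suc.prems(2)[of "Suc l" t] lt by (simp add: funpow_swap1 mult.assoc)
    show "norm ((diff_op i ^^ l) f (\<xi> + axis i (int t))) \<le> A * a ^ l"
      using Suc.prems(1) lt by simp
    show "norm ((diff_op i ^^ l) (\<lambda>\<xi>. g (\<xi> + axis i 1)) (\<xi> + axis i (int t))) \<le> B * b ^ l"
      using Suc.prems(2)[of l "Suc t"] lt
      by (simp add: diff_op_funpow_shift add.assoc axis_add add.commute[of 1])
  qed
  also have "\<dots> = A * B * (a + b) ^ Suc N"
    by (simp add: algebra_simps)
  finally show ?case .
qed

lemma diff_op_funpow_eq_0:
  assumes "\<And>t. t \<le> N \<Longrightarrow> f (\<xi> + axis i (int t)) = 0"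
  shows "(diff_op i ^^ N) f \<xi> = 0"
  using assms
proof (induction N arbitrary: f)
  case 0
  then show ?case using 0[of 0] by (simp add: axis_def zero_vec_def[symmetric])
next
  case (Suc N)
  have "diff_op i f (\<xi> + axis i (int t)) = 0" if "t \<le> N" for t
    using Suc.prems[of t] Suc.prems[of "Suc t"] that
    by (simp add: diff_op_def add.assoc axis_add add.commute[of 1])
  then have "(diff_op i ^^ N) (diff_op i f) \<xi> = 0"
    by (rule Suc.IH)
  then show ?case
    by (simp add: funpow_swap1)
qed

lemma l2_norm_sq_le:
  assumes S: "finite S" "\<And>\<xi>. \<xi> \<notin> S \<Longrightarrow> a \<xi> = 0" and B: "\<And>\<xi>. norm (a \<xi>) \<le> (B :: real)"
  shows "l2_norm_sq a \<le> real (card S) * B\<^sup>2"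
proof -
  have "l2_norm_sq a = (\<Sum>\<xi>\<in>S. (norm (a \<xi>))\<^sup>2)"
    unfolding l2_norm_sq_def using S by (intro sum.mono_neutral_left) auto
  also have "\<dots> \<le> (\<Sum>\<xi>\<in>S. B\<^sup>2)"
    using B by (intro sum_mono power_mono) auto
  finally show ?thesis by simp
qed

lemma norm_axis: "norm (axis i (x :: real) :: real ^ 'n) = \<bar>x\<bar>"
proof -
  have "axis i x = x *\<^sub>R (axis i 1 :: real ^ 'n)"
    by (simp add: vec_eq_iff axis_def)
  then show ?thesis by simp
qed

lemma norm_axis_int: "norm (int_vec (axis i (int t)) :: real ^ 'n) = real t"
proof -
  have "int_vec (axis i (int t)) = (axis i (real t) :: real ^ 'n)"
    by (simp add: vec_eq_iff axis_def)
  then show ?thesis by (simp add: norm_axis)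
qed

lemma powr_minus_divide_eq:
  fixes a b x :: real
  assumes "0 < a" "0 < b"
  shows "(a / b) powr (- x) = b powr x * a powr (- x)"
  using assms powr_divide[of a b "- x"] by (simp add: powr_minus field_simps)

context
  fixes N j :: nat and g :: "int ^ 'n \<Rightarrow> complex" and \<Lambda> V \<rho> h :: real
  assumes \<Lambda>: "\<Lambda> = 2 ^ j / (2 * (1 + real N))" and \<rho>: "0 \<le> \<rho>" "\<rho> \<le> 1"
    and g: "\<And>\<xi> i m. m \<le> N \<Longrightarrow> \<Lambda> \<le> japanese \<xi> \<Longrightarrow> norm ((diff_op i ^^ m) g \<xi>) \<le> V * \<Lambda> powr (- h - \<rho> * m)"
begin

text \<open>The bracket is at least 2^j / 2 at a point of the support. A move by at most
  \<open>N\<close> changes it by at most \<open>N\<close>, which costs a factor 1 + N since brackets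
  are at least 1. This is the origin of \<open>\<Lambda>\<close>.\<close>

lemma window_japanese:
  fixes \<xi> :: "int ^ 'n"
  assumes "dyadic_piece N j (\<xi> + axis i (int t)) \<noteq> 0" "t \<le> N" "s \<le> N"
  shows "\<Lambda> \<le> japanese (\<xi> + axis i (int s))"
proof -
  define \<eta> where "\<eta> = \<xi> + axis i (int s)"
  have "japanese (\<xi> + axis i (int t)) \<le> japanese (\<xi> + axis i (int t) + axis i (int s - int t)) + norm (int_vec (axis i (int s - int t)) :: real ^ 'n)"
    by (rule japanese_shift)
  also have "int_vec (axis i (int s - int t)) = (axis i (real s - real t) :: real ^ 'n)"
    by (simp add: vec_eq_iff axis_def)
  also have "\<xi> + axis i (int t) + axis i (int s - int t) = \<eta>"
    by (simp add: add.assoc axis_add \<eta>_def)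
  finally have "japanese (\<xi> + axis i (int t)) \<le> japanese \<eta> + N"
    using assms by (simp add: norm_axis)
  also have "\<dots> \<le> (1 + N) * japanese \<eta>"
    using mult_left_mono[OF japanese_ge_1[of \<eta>], of "real N"] by (simp add: distrib_right)
  finally have "2 ^ j / 2 \<le> (1 + N) * japanese \<eta>"
    using dyadic_piece_nonzero_japanese[OF assms(1)] by linarith
  then show ?thesis
    by (simp add: \<Lambda> \<eta>_def field_simps)
qed

text \<open>Either the piece vanishes on the whole window and so does the difference, or the window
  lies where the bound on \<open>g\<close> holds. The rates 4 / 2^j of the cutoff and
  \<Lambda>^(-\<rho>) of \<open>g\<close> are both at most multiples of 2^(-j \<rho>), as \<rho>
  \<le> 1.\<close>

lemma norm_diff_op_piece_mult:
  assumes "M \<le> N" 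
  shows "norm ((diff_op i ^^ M) (\<lambda>\<xi>. dyadic_piece N j \<xi> * g \<xi>) \<xi>) 
    \<le> 2 * (V * \<Lambda> powr (- h)) * ((6 + 2 * N) * (2 ^ j) powr (- \<rho>)) ^ M"
proof -
  have \<Lambda>0: "\<Lambda> > 0" by (simp add: \<Lambda>)
  have V: "0 \<le> V * \<Lambda> powr (- h)"
  proof -
    \<comment> \<open>Nonnegativity is read off from the bound on \<open>g\<close> at a lattice
      point far enough out.\<close>
    obtain k where k: "of_nat k > \<Lambda>" using reals_Archimedean2 by blast
    have "\<Lambda> \<le> japanese (axis i (int k))"
      using k norm_le_japanese[of "axis i (int k)"] norm_axis_int[of i k] by linarith
    from g[OF _ this, of 0 i] show ?thesis
      by (simp add: order_trans[OF norm_ge_zero])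
  qed
  show ?thesis
  proof (cases "\<forall>t\<le>M. dyadic_piece N j (\<xi> + axis i (int t)) = 0")
    case True
    then have "(diff_op i ^^ M) (\<lambda>\<xi>. dyadic_piece N j \<xi> * g \<xi>) \<xi> = 0"
      by (intro diff_op_funpow_eq_0) auto
    then show ?thesis
      using V by (auto intro!: mult_nonneg_nonneg)
  next
    case False
    then obtain t where t: "t \<le> M" "dyadic_piece N j (\<xi> + axis i (int t)) \<noteq> 0" by auto
    have "norm ((diff_op i ^^ M) (\<lambda>\<xi>. dyadic_piece N j \<xi> * g \<xi>) \<xi>) \<le> 2 * (V * \<Lambda> powr (- h)) * (4 / 2 ^ j + \<Lambda> powr (- \<rho>)) ^ M"
    proof (rule norm_diff_op_mult_le)
      fix l s assume ls: "l + s \<le> M"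
      show "norm ((diff_op i ^^ l) (dyadic_piece N j) (\<xi> + axis i (int s))) \<le> 2 * (4 / 2 ^ j) ^ l"
        using ls assms by (intro norm_diff_op_dyadic_piece) auto
      have "norm ((diff_op i ^^ l) g (\<xi> + axis i (int s))) \<le> V * \<Lambda> powr (- h - \<rho> * l)"
        using ls assms t by (intro g window_japanese[OF t(2)]) auto
      also have "\<Lambda> powr (- h - \<rho> * l) = \<Lambda> powr (- h) * (\<Lambda> powr (- \<rho>)) ^ l"
        using \<Lambda>0 by (simp add: powr_diff powr_minus powr_powr powr_realpow[symmetric] divide_inverse power_inverse)
      finally show "norm ((diff_op i ^^ l) g (\<xi> + axis i (int s))) \<le> V * \<Lambda> powr (- h) * (\<Lambda> powr (- \<rho>)) ^ l"
        by (simp add: mult.assoc)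
    qed
    also have "\<dots> \<le> 2 * (V * \<Lambda> powr (- h)) * ((6 + 2 * N) * (2 ^ j) powr (- \<rho>)) ^ M"
    proof (intro mult_left_mono power_mono)
      have "1 / 2 ^ j = (2 ^ j :: real) powr (- 1)"
        by (simp add: powr_minus_divide)
      also have "\<dots> \<le> (2 ^ j) powr (- \<rho>)"
        using \<rho> by (intro powr_mono) auto
      finally have 1: "4 / 2 ^ j \<le> 4 * (2 ^ j :: real) powr (- \<rho>)" by simp
      have "\<Lambda> powr (- \<rho>) = (2 * (1 + real N)) powr \<rho> * (2 ^ j) powr (- \<rho>)"
        unfolding \<Lambda> by (rule powr_minus_divide_eq) auto
      also have "(2 * (1 + real N)) powr \<rho> \<le> (2 * (1 + real N)) powr 1"
        using \<rho> by (intro powr_mono) auto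
      finally have "\<Lambda> powr (- \<rho>) \<le> (2 * (1 + real N)) * (2 ^ j) powr (- \<rho>)"
        by (simp add: mult_right_mono)
      with 1 show "4 / 2 ^ j + \<Lambda> powr (- \<rho>) \<le> (6 + 2 * N) * (2 ^ j) powr (- \<rho>)"
        by (simp add: algebra_simps)
    qed (use V in auto)
    finally show ?thesis .
  qed
qed

text \<open>At most \<open>N\<close> forward differences enlarge the support by N \<le> N 2^j in
  each coordinate.\<close>

lemma diff_op_piece_mult_eq_0:
  fixes \<xi> :: "int ^ 'n"
  assumes "M \<le> N" "\<xi> \<notin> int_box ((3 * N + 1) * 2 ^ j)"
  shows "(diff_op i ^^ M) (\<lambda>\<xi>. dyadic_piece N j \<xi> * g \<xi>) \<xi> = 0"
proof (rule diff_op_funpow_eq_0)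
  fix t assume t: "t \<le> M"
  have "\<xi> + axis i (int t) \<notin> int_box ((2 * N + 1) * 2 ^ j)"
  proof
    assume *: "\<xi> + axis i (int t) \<in> int_box ((2 * N + 1) * 2 ^ j)"
    obtain l where l: "int ((3 * N + 1) * 2 ^ j) < \<bar>\<xi> $ l\<bar>"
      using assms by (auto simp: int_box_def not_le)
    have "\<bar>\<xi> $ l\<bar> \<le> \<bar>(\<xi> + axis i (int t)) $ l\<bar> + int N"
      using t assms by (auto simp: axis_def)
    also have "\<dots> \<le> int ((2 * N + 1) * 2 ^ j) + int N"
      using * by (auto simp: int_box_def)
    also have "\<dots> \<le> int ((3 * N + 1) * 2 ^ j)"
    proof -
      have "N * 1 \<le> N * 2 ^ j" by (intro mult_left_mono) auto
      then have "(2 * N + 1) * 2 ^ j + N \<le> (3 * N + 1) * 2 ^ j" by (simp add: algebra_simps)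
      then show ?thesis unfolding of_nat_add[symmetric] of_nat_le_iff .
    qed
    finally show False using l by simp
  qed
  then show "dyadic_piece N j (\<xi> + axis i (int t)) * g (\<xi> + axis i (int t)) = 0"
    by (simp add: dyadic_piece_eq_0)
qed

end

text \<open>First the constant of the weight integral; then 4 from the squared bound on a piece, the
  count of lattice points relative to 2^j, and the loss from 2^j to \<Lambda>; last the
  \<open>L^2\<close> shares of the coefficients and of their differences in the n
  directions.\<close>

definition kernel_const :: "'n itself \<Rightarrow> nat \<Rightarrow> real" where
  "kernel_const _ N = (2 * (1 + 1 / (real (2 * N) / CARD('n) - 1))) ^ CARD('n)
     * (4 * (6 * N + 3) ^ CARD('n) * (2 * (1 + N)) ^ CARD('n)) * (1 + CARD('n) * (6 + 2 * N) ^ (2 * N))"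

text \<open>With R = 2^(-j \<rho>) the squared N-th differences, of relative size (\<kappa> R)^(2N),
  meet R^(-2N) from the weight and leave \<kappa>^(2N).\<close>

proposition dyadic_kernel_L1_bound:
  fixes g :: "int ^ 'n \<Rightarrow> complex"
  assumes \<Lambda>: "\<Lambda> = 2 ^ j / (2 * (1 + real N))" and \<rho>: "0 \<le> \<rho>" "\<rho> \<le> 1" and N: "2 * N > CARD('n)" and V: "0 \<le> V"
    and h: "h = CARD('n) / 2 * (1 - \<rho>)"
    and g: "\<And>\<xi> i m. m \<le> N \<Longrightarrow> \<Lambda> \<le> japanese \<xi> \<Longrightarrow> norm ((diff_op i ^^ m) g \<xi>) \<le> V * \<Lambda> powr (- h - \<rho> * m)"
  shows "(LINT x|torus. norm (trig (\<lambda>\<xi>. dyadic_piece N j \<xi> * g \<xi>) x)) \<le> sqrt (kernel_const TYPE('n) N) * V"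
proof -
  define a where "a = (\<lambda>\<xi>. dyadic_piece N j \<xi> * g \<xi>)"
  define R where "R = (2 ^ j :: real) powr (- \<rho>)"
  define B where "B = 2 * (V * \<Lambda> powr (- h))"
  define \<kappa> where "\<kappa> = 6 + 2 * real N"
  define n where "n = CARD('n)"
  define c where "c = (2 * (1 + 1 / (real (2 * N) / CARD('n) - 1))) ^ CARD('n)"
  have R: "R > 0" by (simp add: R_def)
  have n: "n > 0" by (simp add: n_def)
  have c: "c \<ge> 0" using N by (simp add: c_def field_simps)
  have \<Lambda>0: "\<Lambda> > 0" by (simp add: \<Lambda>)
  define S :: "(int ^ 'n) set" where "S = int_box ((3 * N + 1) * 2 ^ j)"
  have bound: "norm ((diff_op i ^^ M) a \<xi>) \<le> B * (\<kappa> * R) ^ M" if "M \<le> N" for i M \<xi>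
    unfolding a_def B_def \<kappa>_def R_def using norm_diff_op_piece_mult[OF \<Lambda> \<rho> g that] by simp
  have supp: "(diff_op i ^^ M) a \<xi> = 0" if "M \<le> N" "\<xi> \<notin> S" for i M \<xi>
    unfolding a_def using diff_op_piece_mult_eq_0[OF \<Lambda> \<rho> g that(1)] that(2) by (simp add: S_def)
  have S: "finite S" by (simp add: S_def)
  have fin: "finite {\<xi>. a \<xi> \<noteq> 0}"
    using supp[of 0] by (intro finite_subset[OF _ S]) auto
  have l2: "l2_norm_sq ((diff_op i ^^ M) a) \<le> card S * (B * (\<kappa> * R) ^ M)\<^sup>2" if "M \<le> N" for i M
    using S supp[OF that] bound[OF that] by (rule l2_norm_sq_le)
  have card: "real (card S) \<le> ((6 * N + 3) * 2 ^ j) ^ n"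
  proof -
    have "2 * ((3 * N + 1) * 2 ^ j) + 1 \<le> (6 * N + 3) * 2 ^ j"
      by (simp add: algebra_simps)
    then have "(2 * ((3 * N + 1) * 2 ^ j) + 1) ^ n \<le> ((6 * N + 3) * 2 ^ j) ^ n"
      by (intro power_mono) auto
    then show ?thesis
      unfolding S_def card_int_box n_def of_nat_le_iff[symmetric, where 'a = real] by simp
  qed
  have "(LINT x|torus. norm (trig a x)) ^ 2 \<le> c * R ^ n * (l2_norm_sq a + (\<Sum>i\<in>UNIV. l2_norm_sq ((diff_op i ^^ N) a) / R ^ (2 * N)))"
    unfolding c_def n_def by (rule trig_L1_bound[OF fin R N])
  also have "\<dots> \<le> c * R ^ n * (card S * B\<^sup>2 + (\<Sum>i\<in>(UNIV :: 'n set). card S * B\<^sup>2 * \<kappa> ^ (2 * N)))"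
  proof (intro mult_left_mono add_mono sum_mono)
    show "l2_norm_sq a \<le> card S * B\<^sup>2"
      using l2[of 0] by simp
    fix i
    have "l2_norm_sq ((diff_op i ^^ N) a) / R ^ (2 * N) \<le> card S * (B * (\<kappa> * R) ^ N)\<^sup>2 / R ^ (2 * N)"
      using R l2[of N] by (intro divide_right_mono) auto
    also have "\<dots> = card S * B\<^sup>2 * \<kappa> ^ (2 * N)"
      using R by (simp add: power_mult_distrib power_mult[symmetric] mult.commute)
    finally show "l2_norm_sq ((diff_op i ^^ N) a) / R ^ (2 * N) \<le> card S * B\<^sup>2 * \<kappa> ^ (2 * N)" .
  qed (use c R in auto)
  also have "\<dots> = (c * R ^ n * B\<^sup>2 * (1 + n * \<kappa> ^ (2 * N))) * card S"
    by (simp add: n_def algebra_simps)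
  also have "\<dots> \<le> (c * R ^ n * B\<^sup>2 * (1 + n * \<kappa> ^ (2 * N))) * ((6 * N + 3) * 2 ^ j) ^ n"
    using c R card by (intro mult_left_mono mult_nonneg_nonneg) (auto simp: \<kappa>_def)
  also have "\<dots> = c * (4 * (6 * N + 3) ^ n * (R ^ n * (2 ^ j) ^ n * (\<Lambda> powr (- h))\<^sup>2)) * (1 + n * \<kappa> ^ (2 * N)) * V\<^sup>2"
    unfolding power_mult_distrib[of "real _" "2 ^ j"] B_def power_mult_distrib[of 2] power_mult_distrib[of V]
    by (simp only: mult_ac of_nat_mult) (simp add: power_mult_distrib)
  \<comment> \<open>The exponents of 2^j add up to - \<rho> n + n - n (1 - \<rho>) = 0; only the
    fixed ratio of 2^j to \<Lambda> survives.\<close>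
  also have "R ^ n * (2 ^ j) ^ n * (\<Lambda> powr (- h))\<^sup>2 = (2 * (1 + real N)) powr (n * (1 - \<rho>))"
  proof -
    have "(\<Lambda> powr (- h))\<^sup>2 = \<Lambda> powr (- (n * (1 - \<rho>)))"
      using \<Lambda>0 by (simp add: powr_realpow[symmetric] powr_powr h n_def)
    also have "\<dots> = (2 * (1 + real N)) powr (n * (1 - \<rho>)) * (2 ^ j) powr (- (n * (1 - \<rho>)))"
      unfolding \<Lambda> by (rule powr_minus_divide_eq) auto
    moreover have "R ^ n * (2 ^ j) ^ n * (2 ^ j) powr (- (n * (1 - \<rho>))) = 1"
    proof -
      have "R ^ n = (2 ^ j) powr (- (\<rho> * n))"
        by (simp add: R_def powr_realpow[symmetric] powr_powr mult_ac)
      moreover have "(2 ^ j :: real) ^ n = (2 ^ j) powr n"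
        by (simp add: powr_realpow)
      ultimately show ?thesis
        by (simp add: powr_add[symmetric] algebra_simps del: powr_realpow)
    qed
    ultimately show ?thesis
      by (simp add: mult.left_commute)
  qed
  also have "c * (4 * (6 * N + 3) ^ n * (2 * (1 + real N)) powr (n * (1 - \<rho>))) * (1 + n * \<kappa> ^ (2 * N)) * V\<^sup>2
     \<le> c * (4 * (6 * N + 3) ^ n * (2 * (1 + real N)) ^ n) * (1 + n * \<kappa> ^ (2 * N)) * V\<^sup>2"
  proof -
    have "(2 * (1 + real N)) powr (n * (1 - \<rho>)) \<le> (2 * (1 + real N)) powr n"
      using \<rho> by (intro powr_mono) (auto simp: mult_left_le)
    also have "\<dots> = (2 * (1 + real N)) ^ n"
      by (simp add: powr_realpow)
    finally show ?thesis
      using c by (intro mult_right_mono mult_left_mono) (auto simp: \<kappa>_def)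
  qed
  also have "\<dots> = kernel_const TYPE('n) N * V\<^sup>2"
    by (simp add: kernel_const_def c_def n_def \<kappa>_def)
  finally have "sqrt ((LINT x|torus. norm (trig a x)) ^ 2) \<le> sqrt (kernel_const TYPE('n) N * V\<^sup>2)"
    by (rule real_sqrt_le_mono)
  then show ?thesis
    using V by (simp add: a_def real_sqrt_mult integral_nonneg_AE)
qed

section \<open>Fourier coefficients of smooth functions\<close>

lemma fourier_eq: "fourier f \<xi> = (LINT x|torus. cnj (tchar x \<xi>) * f x)"
proof -
  have "exp (- \<i> * 2 * pi * (x \<bullet> int_vec \<xi>)) = cnj (tchar x \<xi>)" for x
    unfolding exp_eq_tchar[symmetric] exp_cnj by simp
  then show ?thesis
    by (simp add: fourier_def)
qed

text \<open>The integral of a translate of \<open>g\<close> is constant in the translation, and its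
  derivative at 0 in direction \<open>j\<close> is the integral of
  \<open>partial j g\<close>.\<close>

lemma integral_partial_eq_0:
  fixes g :: "real ^ 'n \<Rightarrow> complex"
  assumes g: "C_k (Suc 0) g" and per: "periodic g"
  shows "(LINT x|torus. partial j g x) = 0"
proof -
  have hp: "has_partial j g" and c: "continuous_on UNIV g" and c': "continuous_on UNIV (partial j g)"
    using g by auto
  have eq: "integral (cbox 0 1) f = (LINT x|torus. f x)" if "continuous_on UNIV f" for f :: "real ^ 'n \<Rightarrow> complex"
    using integrable_torus_continuous[OF that] unfolding torus_def
    by (intro lebesgue_integral_eq_integral[symmetric]) auto
  define G where "G t = integral (cbox 0 1) (\<lambda>x. g (x + t *\<^sub>R axis j 1))" for t
  have "(G has_vector_derivative integral (cbox 0 1) (\<lambda>x. partial j g (x + 0 *\<^sub>R axis j 1))) (at 0 within UNIV)"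
    unfolding G_def
  proof (rule leibniz_rule_vector_derivative)
    fix t :: real and x :: "real ^ 'n"
    show "((\<lambda>t. g (x + t *\<^sub>R axis j 1)) has_vector_derivative partial j g (x + t *\<^sub>R axis j 1)) (at t within UNIV)"
      by (rule partial_has_vector_derivative[OF hp])
    show "(\<lambda>x. g (x + t *\<^sub>R axis j 1)) integrable_on cbox 0 1"
      by (intro integrable_continuous continuous_on_line[OF c] continuous_intros)
    show "continuous_on (UNIV \<times> cbox 0 1) (\<lambda>(t, x). partial j g (x + t *\<^sub>R axis j 1))"
      unfolding split_beta by (intro continuous_on_line[OF c'] continuous_intros)
  qed auto
  moreover have "G t = (LINT x|torus. g x)" for t
  proof -
    have "G t = (LINT x|torus. g (x + t *\<^sub>R axis j 1))"
      unfolding G_def by (intro eq continuous_on_line[OF c] continuous_intros)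
    also have "\<dots> = (LINT x|torus. g x)"
      by (rule integral_torus_shift[OF c per])
    finally show ?thesis .
  qed
  then have "(G has_vector_derivative 0) (at 0)"
    using has_vector_derivative_const[of "LINT x|torus. g x"] by (subst ext[of G]) auto
  ultimately have "integral (cbox 0 1) (\<lambda>x. partial j g x) = 0"
    using vector_derivative_unique_at by fastforce
  then show ?thesis
    using eq[OF c'] by simp
qed

lemma partial_cnj_tchar:
  fixes \<xi> :: "int ^ 'n"
  shows "has_partial j (\<lambda>x. cnj (tchar x \<xi>))"
    and "partial j (\<lambda>x. cnj (tchar x \<xi>)) = (\<lambda>x. - (\<i> * of_real (2 * pi * of_int (\<xi> $ j))) * cnj (tchar x \<xi>))"
proof -
  have "((\<lambda>t. cnj (tchar (x + t *\<^sub>R axis j 1) \<xi>)) has_vector_derivative 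
     - (\<i> * of_real (2 * pi * of_int (\<xi> $ j))) * cnj (tchar x \<xi>)) (at 0)" for x
  proof -
    define c where "c = 2 * pi * of_int (\<xi> $ j)"
    have "cnj (tchar (x + t *\<^sub>R axis j 1) \<xi>) = cnj (tchar x \<xi>) * exp (- (\<i> * of_real c) * of_real t)" for t
      by (simp add: tchar_add) (simp add: tchar_def c_def inner_axis' cis_cnj cis_conv_exp exp_cnj mult_ac)
    moreover have "((\<lambda>z. cnj (tchar x \<xi>) * exp (- (\<i> * of_real c) * z)) has_field_derivative - (\<i> * of_real c) * cnj (tchar x \<xi>)) (at (of_real 0))"
      by (auto intro!: derivative_eq_intros)
    then have "((\<lambda>t. cnj (tchar x \<xi>) * exp (- (\<i> * of_real c) * of_real t)) has_vector_derivative - (\<i> * of_real c) * cnj (tchar x \<xi>)) (at 0)"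
      by (rule has_vector_derivative_real_field)
    ultimately show ?thesis by (simp add: c_def)
  qed
  then show "has_partial j (\<lambda>x. cnj (tchar x \<xi>))"
    and "partial j (\<lambda>x. cnj (tchar x \<xi>)) = (\<lambda>x. - (\<i> * of_real (2 * pi * of_int (\<xi> $ j))) * cnj (tchar x \<xi>))"
    by (rule has_partialI)+
qed

text \<open>Integration by parts: the derivative of the product of \<open>f\<close> with a conjugate
  character has integral 0.\<close>

lemma fourier_partial:
  fixes f :: "real ^ 'n \<Rightarrow> complex"
  assumes f: "C_k (Suc 0) f" and per: "periodic f"
  shows "fourier (partial j f) \<xi> = \<i> * of_real (2 * pi * of_int (\<xi> $ j)) * fourier f \<xi>"
proof -
  define g where "g x = cnj (tchar x \<xi>) * f x" for x
  have hp: "has_partial i f" and c: "continuous_on UNIV f" and c': "continuous_on UNIV (partial i f)" for i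
    using f by auto
  have dg: "partial i g = (\<lambda>x. cnj (tchar x \<xi>) * partial i f x + - (\<i> * of_real (2 * pi * of_int (\<xi> $ i))) * g x)" for i
    unfolding g_def[abs_def] by (subst partial_mult(2)[OF partial_cnj_tchar(1) hp]) (simp add: partial_cnj_tchar(2) mult.assoc)
  have cg: "continuous_on UNIV g"
    unfolding g_def[abs_def] by (intro continuous_intros c)
  have hpg: "has_partial i g" for i
    unfolding g_def[abs_def] by (rule partial_mult(1)[OF partial_cnj_tchar(1) hp])
  have "C_k (Suc 0) g"
    using cg hpg
    by (auto simp: dg g_def[abs_def, symmetric] g_def[symmetric] intro!: continuous_intros c')
  moreover have "periodic g"
    using per by (simp add: periodic_def g_def tchar_add)
  ultimately have "0 = (LINT x|torus. partial j g x)"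
    by (rule integral_partial_eq_0[symmetric])
  also have "\<dots> = (LINT x|torus. cnj (tchar x \<xi>) * partial j f x) + (LINT x|torus. - (\<i> * of_real (2 * pi * of_int (\<xi> $ j))) * g x)"
    unfolding dg by (intro Bochner_Integration.integral_add integrable_torus_continuous continuous_intros c' cg)
  also have "(LINT x|torus. - (\<i> * of_real (2 * pi * of_int (\<xi> $ j))) * g x) = - (\<i> * of_real (2 * pi * of_int (\<xi> $ j))) * (LINT x|torus. g x)"
    by (rule integral_mult_right_zero)
  finally show ?thesis
    unfolding fourier_eq g_def by (simp add: algebra_simps)
qed

lemma fourier_foldr_partial:
  assumes "C_k m f" "periodic f"
  shows "fourier (foldr partial (replicate m j) f) \<xi> = (\<i> * of_real (2 * pi * of_int (\<xi> $ j))) ^ m * fourier f \<xi>"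
  using assms(1)
proof (induction m)
  case (Suc m)
  have "C_k (Suc 0) (foldr partial (replicate m j) f)" "C_k m f"
    using Suc.prems C_k_mono[of "Suc m" f m] C_k_foldr_partial[of "replicate m j" "Suc 0" f]
    by (simp_all del: C_k.simps foldr_replicate)
  with Suc.IH show ?case
    using fourier_partial[OF _ foldr_partial_periodic[OF assms(2)], of "replicate m j"] by (simp del: foldr_replicate)
qed simp

lemma norm_fourier_le: "norm (fourier f \<xi>) \<le> (LINT x|torus. norm (f x))"
proof -
  have "norm (fourier f \<xi>) \<le> (LINT x|torus. norm (cnj (tchar x \<xi>) * f x))"
    unfolding fourier_eq by (rule integral_norm_bound)
  then show ?thesis by (simp add: norm_mult)
qed

text \<open>The subtracted term lets the induction telescope: the two new summands 2 / (1 + (L+1)^2)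
  are at most 4/(L+1) - 4/(L+2).\<close>

lemma sum_inverse_square_le: "(\<Sum>m = - int L..int L. 1 / (1 + (real_of_int m)\<^sup>2)) \<le> 5 - 4 / (real L + 1)"
proof (induction L)
  case (Suc L)
  have "{- int (Suc L)..int (Suc L)} = insert (- int (Suc L)) (insert (int (Suc L)) {- int L..int L})"
    by auto
  then have "(\<Sum>m = - int (Suc L)..int (Suc L). 1 / (1 + (real_of_int m)\<^sup>2)) 
      = 2 / (1 + (real L + 1)\<^sup>2) + (\<Sum>m = - int L..int L. 1 / (1 + (real_of_int m)\<^sup>2))"
    by (simp add: power2_eq_square algebra_simps)
  also have "\<dots> \<le> (4 / (real L + 1) - 4 / (real L + 2)) + (5 - 4 / (real L + 1))"
  proof (intro add_mono Suc.IH)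
    have "2 * ((real L + 1) * (real L + 2)) \<le> 4 * (1 + (real L + 1)\<^sup>2)"
      by (simp add: power2_eq_square algebra_simps)
    then have "2 / (1 + (real L + 1)\<^sup>2) \<le> 4 / ((real L + 1) * (real L + 2))"
      by (simp add: divide_simps add_pos_nonneg)
    also have "\<dots> = 4 / (real L + 1) - 4 / (real L + 2)"
      by (simp add: field_simps)
    finally show "2 / (1 + (real L + 1)\<^sup>2) \<le> 4 / (real L + 1) - 4 / (real L + 2)" .
  qed
  finally show ?case by (simp add: add_ac)
qed simp

text \<open>Over a box the product weight factors into one-dimensional sums, each at most 5, and
  every finite set lies in a box.\<close>

lemma abs_summable_int_vec:
  fixes c :: "int ^ 'n \<Rightarrow> complex"
  assumes B: "\<And>\<xi>. norm (c \<xi>) \<le> B / (\<Prod>i\<in>UNIV. 1 + (real_of_int (\<xi> $ i))\<^sup>2)"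
  shows "(\<lambda>\<xi>. norm (c \<xi>)) summable_on UNIV"
proof -
  have "0 \<le> B / (\<Prod>i\<in>(UNIV :: 'n set). 1 + (real_of_int ((0 :: int ^ 'n) $ i))\<^sup>2)"
    using B[of 0] norm_ge_zero order_trans by blast
  then have B0: "B \<ge> 0" by simp
  have box: "(\<Sum>\<xi>\<in>int_box L. norm (c \<xi>)) \<le> B * 5 ^ CARD('n)" for L
  proof -
    have "(\<Sum>\<xi>\<in>int_box L. norm (c \<xi>)) \<le> (\<Sum>\<xi>\<in>int_box L. B * (\<Prod>i\<in>(UNIV :: 'n set). 1 / (1 + (real_of_int (\<xi> $ i))\<^sup>2)))"
    proof (rule sum_mono)
      fix \<xi> :: "int ^ 'n"
      show "norm (c \<xi>) \<le> B * (\<Prod>i\<in>UNIV. 1 / (1 + (real_of_int (\<xi> $ i))\<^sup>2))"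
        using B[of \<xi>] by (simp add: prod_dividef)
    qed
    also have "\<dots> = B * (\<Sum>\<xi>\<in>PiE UNIV (\<lambda>_. {- int L..int L}). \<Prod>i\<in>(UNIV :: 'n set). 1 / (1 + (real_of_int (\<xi> i))\<^sup>2))"
      unfolding int_box_eq sum_distrib_left by (subst sum.reindex[OF inj_vec_lambda]) simp
    also have "(\<Sum>\<xi>\<in>PiE UNIV (\<lambda>_. {- int L..int L}). \<Prod>i\<in>(UNIV :: 'n set). 1 / (1 + (real_of_int (\<xi> i))\<^sup>2)) 
        = (\<Prod>i\<in>(UNIV :: 'n set). \<Sum>m = - int L..int L. 1 / (1 + (real_of_int m)\<^sup>2))"
      by (rule prod_sum_PiE[symmetric]) auto
    also have "\<dots> = (\<Sum>m = - int L..int L. 1 / (1 + (real_of_int m)\<^sup>2)) ^ CARD('n)"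
      by simp
    also have "\<dots> \<le> 5 ^ CARD('n)"
    proof (intro power_mono sum_nonneg)
      have "4 / (real L + 1) \<ge> 0" by simp
      then show "(\<Sum>m = - int L..int L. 1 / (1 + (real_of_int m)\<^sup>2)) \<le> 5"
        using sum_inverse_square_le[of L] by linarith
    qed auto
    finally show ?thesis using B0 by (simp add: mult_left_mono)
  qed
  have "(\<Sum>\<xi>\<in>F. norm (c \<xi>)) \<le> B * 5 ^ CARD('n)" if F: "finite F" for F
  proof -
    define L where "L = (\<Sum>\<xi>\<in>F. \<Sum>i\<in>UNIV. nat \<bar>\<xi> $ i\<bar>)"
    have "F \<subseteq> int_box L"
    proof
      fix \<xi> assume \<xi>: "\<xi> \<in> F"
      have "nat \<bar>\<xi> $ i\<bar> \<le> L" for i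
      proof -
        have "nat \<bar>\<xi> $ i\<bar> \<le> (\<Sum>i\<in>UNIV. nat \<bar>\<xi> $ i\<bar>)" by (rule member_le_sum) auto
        also have "\<dots> \<le> L" unfolding L_def using F \<xi> by (intro member_le_sum) auto
        finally show ?thesis .
      qed
      then show "\<xi> \<in> int_box L" by (auto simp: int_box_def nat_le_iff)
    qed
    then have "(\<Sum>\<xi>\<in>F. norm (c \<xi>)) \<le> (\<Sum>\<xi>\<in>int_box L. norm (c \<xi>))"
      by (intro sum_mono2) auto
    also note box
    finally show ?thesis .
  qed
  then show ?thesis
    by (intro nonneg_bdd_above_summable_on) (auto intro!: bdd_aboveI2)
qed

text \<open>Derivatives in the direction of the largest coordinate of \<xi> already control the
  product over all coordinates. For a bounded symbol this makes the series in
  \<open>periodic_op\<close> converge absolutely on smooth functions.\<close>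

proposition fourier_abs_summable:
  fixes f :: "real ^ 'n \<Rightarrow> complex"
  assumes "f \<in> smooth_torus"
  shows "(\<lambda>\<xi>. norm (fourier f \<xi>)) summable_on UNIV"
proof -
  have per: "periodic f" and f: "C_k k f" for k
    using assms by (auto simp: smooth_torus_def)
  \<comment> \<open>The product of n factors, each at most 1 + \<mu>^2 for the largest modulus
    \<mu>, is matched by 2 n derivatives.\<close>
  define M where "M = 2 * CARD('n)"
  define D where "D j = (LINT x|torus. norm (foldr partial (replicate M j) f x))" for j
  define B where "B = (LINT x|torus. norm (f x)) + (\<Sum>j\<in>UNIV. D j)"
  have D: "0 \<le> D j" for j
    by (simp add: D_def integral_nonneg_AE)
  have "norm (fourier f \<xi>) \<le> (2 ^ CARD('n) * B) / (\<Prod>i\<in>UNIV. 1 + (real_of_int (\<xi> $ i))\<^sup>2)" for \<xi>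
  proof -
    obtain j where j: "\<And>i. \<bar>\<xi> $ i\<bar> \<le> \<bar>\<xi> $ j\<bar>"
    proof -
      have "Max (range (\<lambda>i. \<bar>\<xi> $ i\<bar>)) \<in> range (\<lambda>i. \<bar>\<xi> $ i\<bar>)"
        by (intro Max_in) auto
      then obtain j where "Max (range (\<lambda>i. \<bar>\<xi> $ i\<bar>)) = \<bar>\<xi> $ j\<bar>" by blast
      then have "\<bar>\<xi> $ i\<bar> \<le> \<bar>\<xi> $ j\<bar>" for i
        using Max_ge[of "range (\<lambda>i. \<bar>\<xi> $ i\<bar>)" "\<bar>\<xi> $ i\<bar>"] by simp
      then show thesis by (rule that)
    qed
    define \<mu> where "\<mu> = \<bar>real_of_int (\<xi> $ j)\<bar>"
    have \<mu>: "\<mu> \<ge> 0" by (simp add: \<mu>_def)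
    have "(\<Prod>i\<in>UNIV. 1 + (real_of_int (\<xi> $ i))\<^sup>2) \<le> (\<Prod>i\<in>(UNIV :: 'n set). 1 + \<mu>\<^sup>2)"
    proof (intro prod_mono conjI add_left_mono)
      fix i
      have "\<bar>real_of_int (\<xi> $ i)\<bar> \<le> \<mu>"
        unfolding \<mu>_def using j[of i] by (simp only: of_int_abs[symmetric] of_int_le_iff)
      then have "\<bar>real_of_int (\<xi> $ i)\<bar>\<^sup>2 \<le> \<mu>\<^sup>2"
        by (intro power_mono) auto
      then show "(real_of_int (\<xi> $ i))\<^sup>2 \<le> \<mu>\<^sup>2" by simp
    qed auto
    also have "\<dots> = (1 + \<mu>\<^sup>2) ^ CARD('n)" by simp
    also have "\<dots> \<le> 2 ^ CARD('n) * (1 + \<mu> ^ M)"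
    proof (cases "\<mu> \<le> 1")
      case True
      then have "(1 + \<mu>\<^sup>2) ^ CARD('n) \<le> 2 ^ CARD('n)"
        using \<mu> power_le_one[of \<mu> 2] by (intro power_mono) auto
      also have "\<dots> \<le> 2 ^ CARD('n) * (1 + \<mu> ^ M)"
        using \<mu> by simp
      finally show ?thesis .
    next
      case False
      then have "1 \<le> \<mu>\<^sup>2" by (simp add: one_le_power)
      then have "(1 + \<mu>\<^sup>2) ^ CARD('n) \<le> (2 * \<mu>\<^sup>2) ^ CARD('n)"
        by (intro power_mono) auto
      also have "\<dots> = 2 ^ CARD('n) * \<mu> ^ M"
        by (simp add: power_mult_distrib M_def power_mult[symmetric])
      finally show ?thesis by (simp add: distrib_left add_increasing)
    qed
    finally have prod: "(\<Prod>i\<in>UNIV. 1 + (real_of_int (\<xi> $ i))\<^sup>2) \<le> 2 ^ CARD('n) * (1 + \<mu> ^ M)" .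
    have "\<mu> ^ M * norm (fourier f \<xi>) \<le> D j"
    proof -
      have "\<mu> ^ M * norm (fourier f \<xi>) \<le> (2 * pi * \<mu>) ^ M * norm (fourier f \<xi>)"
        using \<mu> pi_gt3 mult_right_mono[of 1 "2 * pi" \<mu>] by (intro mult_right_mono power_mono) auto
      also have "\<dots> = norm (fourier (foldr partial (replicate M j) f) \<xi>)"
        unfolding fourier_foldr_partial[OF f per] by (simp add: norm_mult norm_power \<mu>_def abs_mult)
      also have "\<dots> \<le> D j"
        unfolding D_def by (rule norm_fourier_le)
      finally show ?thesis .
    qed
    also have "\<dots> \<le> (\<Sum>j\<in>UNIV. D j)"
      using D by (intro member_le_sum) auto
    finally have "(1 + \<mu> ^ M) * norm (fourier f \<xi>) \<le> B"
      using norm_fourier_le[of f \<xi>] by (simp add: B_def distrib_right)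
    then have "2 ^ CARD('n) * ((1 + \<mu> ^ M) * norm (fourier f \<xi>)) \<le> 2 ^ CARD('n) * B"
      by (intro mult_left_mono) auto
    moreover have "(\<Prod>i\<in>UNIV. 1 + (real_of_int (\<xi> $ i))\<^sup>2) * norm (fourier f \<xi>) \<le> 2 ^ CARD('n) * (1 + \<mu> ^ M) * norm (fourier f \<xi>)"
      using prod by (intro mult_right_mono) auto
    moreover have "0 < (\<Prod>i\<in>UNIV. 1 + (real_of_int (\<xi> $ i))\<^sup>2)"
      by (intro prod_pos) (auto intro: add_pos_nonneg)
    ultimately show ?thesis
      by (simp only: pos_le_divide_eq mult.assoc mult.commute[of "norm _"])
  qed
  then show ?thesis
    by (rule abs_summable_int_vec)
qed

section \<open>Series in \<open>L^p\<close> and the Dini condition\<close>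

lemma Lp_norm_nonneg [simp]: "0 \<le> Lp_norm p f"
  by (simp add: Lp_norm_def)

lemma Lp_norm_powr:
  assumes "1 \<le> p"
  shows "Lp_norm p f powr p = (LINT x|torus. norm (f x) powr p)"
  using assms by (simp add: Lp_norm_def powr_powr integral_nonneg_AE)

lemma Lp_normI:
  assumes "1 \<le> p" "0 \<le> c" "(LINT x|torus. norm (f x) powr p) \<le> c powr p"
  shows "Lp_norm p f \<le> c"
proof -
  have "Lp_norm p f \<le> (c powr p) powr (1 / p)"
    unfolding Lp_norm_def using assms by (intro powr_mono2) (auto intro: integral_nonneg_AE)
  then show ?thesis
    using assms by (simp add: powr_powr)
qed

text \<open>Jensen with weights \<open>a j\<close> takes the place of Minkowski's inequality:
  (\<Sum> |g_j|)^p \<le> A^(p-1) \<Sum> a_j^(1-p) |g_j|^p, and the norm bounds turn a_j^(1-p) a_j^p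
  into a_j. The division by \<open>a j\<close> is the reason for asking strict positivity.\<close>

proposition Lp_series:
  fixes g :: "nat \<Rightarrow> real ^ 'n \<Rightarrow> complex"
  assumes p: "1 \<le> p" and meas [measurable]: "\<And>j. g j \<in> borel_measurable torus"
    and int: "\<And>j. integrable torus (\<lambda>x. norm (g j x) powr p)"
    and bound: "\<And>j. Lp_norm p (g j) \<le> a j * c" and a: "\<And>j. 0 < a j" "summable a" and c: "0 \<le> c"
  shows "AE x in torus. summable (\<lambda>j. norm (g j x))"
    and "(\<lambda>x. \<Sum>j. g j x) \<in> borel_measurable torus"
    and "integrable torus (\<lambda>x. norm (\<Sum>j. g j x) powr p)"
    and "Lp_norm p (\<lambda>x. \<Sum>j. g j x) \<le> suminf a * c"
proof -
  define A where "A = suminf a"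
  define S where "S J x = (\<Sum>j<J. norm (g j x))" for J x
  have A: "A > 0" "(\<Sum>j<J. a j) \<le> A" for J
    unfolding A_def using a by (auto intro!: suminf_pos sum_le_suminf simp: less_imp_le)
  have S0: "0 \<le> S J x" for J x
    by (simp add: S_def sum_nonneg)
  have S_meas [measurable]: "S J \<in> borel_measurable torus" for J
    unfolding S_def by measurable
  have g_int: "(LINT x|torus. norm (g j x) powr p) \<le> a j powr p * c powr p" for j
  proof -
    have "Lp_norm p (g j) powr p \<le> (a j * c) powr p"
      using p bound by (intro powr_mono2) auto
    then show ?thesis
      using p a(1)[of j] c by (simp add: Lp_norm_powr powr_mult less_imp_le)
  qed
  have S_le: "S J x powr p \<le> A powr (p - 1) * (\<Sum>j<J. a j powr (1 - p) * norm (g j x) powr p)" for J x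
  proof -
    have "S J x = (\<Sum>j<J. a j * (norm (g j x) / a j))"
      using a(1) by (auto simp: S_def less_imp_neq[symmetric] intro!: sum.cong)
    then have "S J x powr p \<le> (\<Sum>j<J. a j) powr (p - 1) * (\<Sum>j<J. a j * (norm (g j x) / a j) powr p)"
      using p a(1) by (simp only:) (intro powr_sum_le, auto simp: less_imp_le)
    also have "(\<Sum>j<J. a j * (norm (g j x) / a j) powr p) = (\<Sum>j<J. a j powr (1 - p) * norm (g j x) powr p)"
      using a(1) by (intro sum.cong refl) (simp add: powr_divide powr_diff less_imp_le)
    also have "(\<Sum>j<J. a j) powr (p - 1) * \<dots> \<le> A powr (p - 1) * \<dots>"
      using A(2) p a(1) by (intro mult_right_mono powr_mono2 sum_nonneg) (auto simp: less_imp_le)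
    finally show ?thesis .
  qed
  have S_nn: "(\<integral>\<^sup>+x. ennreal (S J x powr p) \<partial>torus) \<le> ennreal ((A * c) powr p)" for J
  proof -
    have "(\<integral>\<^sup>+x. ennreal (S J x powr p) \<partial>torus) \<le> (\<integral>\<^sup>+x. ennreal (A powr (p - 1) * (\<Sum>j<J. a j powr (1 - p) * norm (g j x) powr p)) \<partial>torus)"
      by (intro nn_integral_mono ennreal_leI S_le)
    also have "\<dots> = ennreal (LINT x|torus. A powr (p - 1) * (\<Sum>j<J. a j powr (1 - p) * norm (g j x) powr p))"
      using int by (intro nn_integral_eq_integral) (auto intro!: AE_I2 mult_nonneg_nonneg sum_nonneg)
    also have "(LINT x|torus. A powr (p - 1) * (\<Sum>j<J. a j powr (1 - p) * norm (g j x) powr p))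
        = A powr (p - 1) * (\<Sum>j<J. a j powr (1 - p) * (LINT x|torus. norm (g j x) powr p))"
      using int by simp
    also have "\<dots> \<le> A powr (p - 1) * (\<Sum>j<J. a j powr (1 - p) * (a j powr p * c powr p))"
      by (intro mult_left_mono sum_mono g_int) auto
    also have "\<dots> = A powr (p - 1) * ((\<Sum>j<J. a j) * c powr p)"
      using a(1) by (simp add: sum_distrib_right mult.assoc[symmetric] powr_add[symmetric] less_imp_le)
    also have "\<dots> \<le> A powr (p - 1) * (A * c powr p)"
      using A by (intro mult_left_mono mult_right_mono) auto
    also have "\<dots> = (A * c) powr p"
      using A(1) c powr_mult_base[of A "p - 1"] by (simp add: powr_mult mult_ac)
    finally show ?thesis
      by (simp add: ennreal_leI)
  qed
  \<comment> \<open>The partial sums increase, so monotone convergence bounds the integral of their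
    supremum; it is therefore finite almost everywhere and dominates the limit.\<close>
  define u where "u x = (SUP J. ennreal (S J x powr p))" for x
  have S_mono: "S J x \<le> S J' x" if "J \<le> J'" for J J' x
    unfolding S_def using that by (intro sum_mono2) auto
  have "(\<integral>\<^sup>+x. u x \<partial>torus) = (SUP J. \<integral>\<^sup>+x. ennreal (S J x powr p) \<partial>torus)"
    unfolding u_def
    using p S0 S_mono by (intro nn_integral_monotone_convergence_SUP) (auto simp: incseq_def le_fun_def intro!: ennreal_leI powr_mono2)
  also have "\<dots> \<le> ennreal ((A * c) powr p)"
    by (intro SUP_least S_nn)
  finally have u_nn: "(\<integral>\<^sup>+x. u x \<partial>torus) \<le> ennreal ((A * c) powr p)" .
  have [measurable]: "u \<in> borel_measurable torus"
    unfolding u_def by measurable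
  have "AE x in torus. u x \<noteq> \<infinity>"
    using u_nn by (intro nn_integral_PInf_AE) (auto simp: top_unique)
  then have key: "AE x in torus. summable (\<lambda>j. norm (g j x)) \<and> ennreal (norm (\<Sum>j. g j x) powr p) \<le> u x"
  proof eventually_elim
    case (elim x)
    then obtain r where r: "u x = ennreal r" "0 \<le> r"
      by (cases "u x") auto
    have S_r: "S J x powr p \<le> r" for J
    proof -
      have "ennreal (S J x powr p) \<le> ennreal r"
        unfolding r(1)[symmetric] u_def by (rule SUP_upper) simp
      then show ?thesis using r by simp
    qed
    have "S J x \<le> r powr (1 / p)" for J
    proof -
      have "(S J x powr p) powr (1 / p) \<le> r powr (1 / p)"
        using p S_r by (intro powr_mono2) auto
      then show ?thesis using p S0 by (simp add: powr_powr)
    qed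
    then have summ: "summable (\<lambda>j. norm (g j x))"
      unfolding S_def by (intro summableI_nonneg_bounded) auto
    have lim: "(\<lambda>J. norm (\<Sum>j<J. g j x) powr p) \<longlonglongrightarrow> norm (\<Sum>j. g j x) powr p"
      using p summable_LIMSEQ[OF summable_norm_cancel[OF summ]] by (intro tendsto_powr' tendsto_norm tendsto_const) auto
    have "norm (\<Sum>j<J. g j x) powr p \<le> r" for J
      using p S_r[of J] powr_mono2[of p "norm (\<Sum>j<J. g j x)" "S J x"] norm_sum[of "\<lambda>j. g j x" "{..<J}"] 
      by (simp add: S_def)
    then have "norm (\<Sum>j. g j x) powr p \<le> r"
      by (intro LIMSEQ_le_const2[OF lim]) auto
    with summ r show ?case by (simp add: ennreal_leI)
  qed
  then show "AE x in torus. summable (\<lambda>j. norm (g j x))" by auto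
  show meas_sum: "(\<lambda>x. \<Sum>j. g j x) \<in> borel_measurable torus" by measurable
  have "(\<integral>\<^sup>+x. ennreal (norm (\<Sum>j. g j x) powr p) \<partial>torus) \<le> (\<integral>\<^sup>+x. u x \<partial>torus)"
    using key by (intro nn_integral_mono_AE) auto
  with u_nn have nn: "(\<integral>\<^sup>+x. ennreal (norm (\<Sum>j. g j x) powr p) \<partial>torus) \<le> ennreal ((A * c) powr p)"
    by (rule order_trans[rotated])
  show integrable: "integrable torus (\<lambda>x. norm (\<Sum>j. g j x) powr p)"
  proof (rule integrableI_bounded)
    show "(\<lambda>x. norm (\<Sum>j. g j x) powr p) \<in> borel_measurable torus"
      using meas_sum by measurable
    show "(\<integral>\<^sup>+x. ennreal (norm (norm (\<Sum>j. g j x) powr p)) \<partial>torus) < \<infinity>"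
      using nn by (auto intro: le_less_trans)
  qed
  have "ennreal (LINT x|torus. norm (\<Sum>j. g j x) powr p) \<le> ennreal ((A * c) powr p)"
    using nn nn_integral_eq_integral[OF integrable] by simp
  then show "Lp_norm p (\<lambda>x. \<Sum>j. g j x) \<le> suminf a * c"
    using A c p by (intro Lp_normI) (auto simp: A_def)
qed

text \<open>The integral test on a geometric grid: on (B q^(j+1), B q^j] monotonicity gives
  \<omega>(t) / t \<ge> \<omega>(B q^(j+1)) / (B q^j), and the interval has length (1 - q) B
  q^j.\<close>

lemma dini_summable:
  fixes \<omega> :: "real \<Rightarrow> real"
  assumes nonneg: "\<And>t. 0 \<le> t \<Longrightarrow> 0 \<le> \<omega> t" and mono: "mono_on {0..} \<omega>"
    and int: "set_integrable lborel {0<..1} (\<lambda>t. \<omega> t / t)" and A: "0 < A" and q: "0 < q" "q < 1"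
  shows "summable (\<lambda>j. \<omega> (A * q ^ j))"
proof -
  \<comment> \<open>Dropping finitely many terms brings the grid into (0,1], where the integral is
    finite.\<close>
  obtain m where "q ^ m < 1 / A"
    using A q real_arch_pow_inv[of "1 / A" q] by auto
  then have m: "A * q ^ m \<le> 1"
    using A by (simp add: field_simps)
  define B where "B = A * q ^ m"
  have B: "0 < B" "B \<le> 1"
    using A q m by (auto simp: B_def)
  define J where "J j = {B * q ^ Suc j<..B * q ^ j}" for j
  define \<phi> where "\<phi> t = indicator {0<..1} t *\<^sub>R (\<omega> t / t)" for t
  have \<phi>: "integrable lborel \<phi>" "\<And>t. 0 \<le> \<phi> t"
    using int nonneg by (auto simp: \<phi>_def[abs_def] set_integrable_def indicator_def)
  have J_le: "B * q ^ j \<le> 1" for j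
    using B q by (intro mult_le_one power_le_one) auto
  have J_sub: "J j \<subseteq> {0<..1}" for j
  proof
    fix t assume t: "t \<in> J j"
    have "0 < B * q ^ Suc j" using B q by simp
    with t J_le[of j] show "t \<in> {0<..1}" by (auto simp: J_def simp del: power_Suc)
  qed
  have sum_ind: "(\<Sum>j<k. indicator (J j) t) = (indicator {B * q ^ k<..B} t :: real)" for k t
  proof (induction k)
    case (Suc k)
    have "B * q ^ Suc k \<le> B * q ^ k" "B * q ^ k \<le> B"
      using B q by (auto simp: mult_left_le power_le_one mult_le_one)
    with Suc show ?case by (auto simp: J_def indicator_def)
  qed simp
  have intJ: "integrable lborel (\<lambda>t. indicator (J j) t * \<phi> t)" for j
    using integrable_mult_indicator[OF _ \<phi>(1), of "J j"] by (simp add: J_def)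
  have lower: "(1 - q) * \<omega> (B * q ^ Suc j) \<le> (LINT t|lborel. indicator (J j) t * \<phi> t)" for j
  proof -
    define r where "r = B * q ^ j"
    have r: "0 < r" "0 < r * q" "r * q \<le> r" using B q by (auto simp: r_def mult_left_le)
    have J: "J j = {r * q<..r}" by (simp add: J_def r_def mult_ac)
    have "(1 - q) * \<omega> (r * q) = (LINT t|lborel. indicator (J j) t * (\<omega> (r * q) / r))"
      using r by (simp add: J measure_def field_simps)
    also have "\<dots> \<le> (LINT t|lborel. indicator (J j) t * \<phi> t)"
    proof (intro integral_mono intJ)
      show "integrable lborel (\<lambda>t. indicator (J j) t * (\<omega> (r * q) / r))"
        using r by (intro integrable_mult_left integrable_real_indicator) (auto simp: J)
      fix t
      have "\<omega> (r * q) / r \<le> \<phi> t" if t: "t \<in> J j"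
      proof -
        have t': "0 < t" "t \<le> r" "r * q \<le> t" using t r unfolding J by auto
        have "\<omega> (r * q) / r \<le> \<omega> t / t"
          using t' r nonneg mono by (intro frac_le) (auto simp: mono_on_def)
        then show ?thesis
          using t J_sub[of j] by (auto simp: \<phi>_def)
      qed
      then show "indicator (J j) t * (\<omega> (r * q) / r) \<le> indicator (J j) t * \<phi> t"
        by (auto simp: indicator_def)
    qed
    finally show ?thesis by (simp add: r_def mult_ac)
  qed
  have partial: "(\<Sum>j<k. \<omega> (B * q ^ Suc j)) \<le> (LINT t|lborel. \<phi> t) / (1 - q)" for k
  proof -
    have "(1 - q) * (\<Sum>j<k. \<omega> (B * q ^ Suc j)) \<le> (\<Sum>j<k. LINT t|lborel. indicator (J j) t * \<phi> t)"
      unfolding sum_distrib_left by (intro sum_mono lower)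
    also have "\<dots> = (LINT t|lborel. (\<Sum>j<k. indicator (J j) t * \<phi> t))"
      using intJ by (intro Bochner_Integration.integral_sum[symmetric])
    also have "\<dots> \<le> (LINT t|lborel. \<phi> t)"
    proof (intro integral_mono \<phi> Bochner_Integration.integrable_sum intJ)
      fix t
      have "(\<Sum>j<k. indicator (J j) t * \<phi> t) = indicator {B * q ^ k<..B} t * \<phi> t"
        by (simp add: sum_distrib_right[symmetric] sum_ind)
      also have "\<dots> \<le> \<phi> t"
        using \<phi>(2)[of t] by (simp add: indicator_def)
      finally show "(\<Sum>j<k. indicator (J j) t * \<phi> t) \<le> \<phi> t" .
    qed
    finally show ?thesis using q by (simp add: field_simps)
  qed
  have "summable (\<lambda>j. \<omega> (B * q ^ Suc j))"
    using B q by (intro summableI_nonneg_bounded[OF nonneg partial]) auto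
  then have "summable (\<lambda>j. \<omega> (A * q ^ (j + Suc m)))"
    by (simp add: B_def power_add mult_ac)
  then show ?thesis
    by (subst (asm) summable_iff_shift[of "\<lambda>j. \<omega> (A * q ^ j)"])
qed

section \<open>Convolution with trigonometric polynomials\<close>

text \<open>The map x \<mapsto> 1 - x preserves the cube and differs from x \<mapsto> - x by a
  period.\<close>

lemma nn_integral_torus_reflect:
  fixes f :: "real ^ 'n \<Rightarrow> ennreal"
  assumes [measurable]: "f \<in> borel_measurable borel" and per: "\<And>x k. f (x + int_vec k) = f x"
  shows "(\<integral>\<^sup>+x. f (- x) \<partial>torus) = (\<integral>\<^sup>+x. f x \<partial>torus)"
proof -
  have one: "int_vec 1 = (1 :: real ^ 'n)"
    by (simp add: vec_eq_iff)
  have "(\<integral>\<^sup>+x. f x \<partial>torus) = (\<integral>\<^sup>+x. f x * indicator (cbox 0 1) x \<partial>lborel)"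
    by (rule nn_integral_torus)
  also have "\<dots> = (\<integral>\<^sup>+x. f x * indicator (cbox 0 1) x \<partial>density (distr lborel borel (\<lambda>u. 1 + (- 1) *\<^sub>R u)) (\<lambda>_. ennreal (\<bar>- 1\<bar> ^ DIM(real ^ 'n))))"
    by (subst lborel_affine[of "- 1" 1]) auto
  also have "\<dots> = (\<integral>\<^sup>+x. f (1 - x) * indicator (cbox 0 1) (1 - x) \<partial>lborel)"
    by (simp add: nn_integral_density nn_integral_distr)
  also have "\<dots> = (\<integral>\<^sup>+x. f (- x) * indicator (cbox 0 1) x \<partial>lborel)"
  proof (intro nn_integral_cong)
    fix x :: "real ^ 'n"
    have "1 - x \<in> cbox 0 1 \<longleftrightarrow> x \<in> cbox 0 1"
      by (auto simp: mem_box_cart)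
    moreover have "f (1 - x) = f (- x)"
      using per[of "- x" 1] by (simp add: one)
    ultimately show "f (1 - x) * indicator (cbox 0 1) (1 - x) = f (- x) * indicator (cbox 0 1) x"
      by (simp add: indicator_def)
  qed
  also have "\<dots> = (\<integral>\<^sup>+x. f (- x) \<partial>torus)"
    by (rule nn_integral_torus[symmetric])
  finally show ?thesis ..
qed

lemma integral_torus_reflect_shift:
  fixes g :: "real ^ 'n \<Rightarrow> real"
  assumes g: "continuous_on UNIV g" "\<And>x k. g (x + int_vec k) = g x" "\<And>x. 0 \<le> g x"
  shows "(LINT y|torus. g (x - y)) = (LINT y|torus. g y)"
proof -
  have meas: "(\<lambda>y. ennreal (g y)) \<in> borel_measurable borel"
    using g(1) by (intro measurable_compose[OF _ measurable_ennreal] borel_measurable_continuous_onI)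
  have c: "continuous_on UNIV (\<lambda>y. g (x - y))"
    by (rule continuous_on_compose2[OF g(1)]) (auto intro!: continuous_intros)
  have "ennreal (LINT y|torus. g (x - y)) = (\<integral>\<^sup>+y. ennreal (g (x + - y)) \<partial>torus)"
    using c g by (subst nn_integral_eq_integral) (auto intro!: integrable_torus_continuous)
  also have "\<dots> = (\<integral>\<^sup>+y. ennreal (g (x + y)) \<partial>torus)"
    using meas g(2) by (intro nn_integral_torus_reflect[where f = "\<lambda>y. ennreal (g (x + y))"]) (auto simp: add.assoc[symmetric])
  also have "\<dots> = (\<integral>\<^sup>+y. ennreal (g y) \<partial>torus)"
    using nn_integral_torus_shift[OF meas, of x] g(2) by (simp add: add.commute)
  also have "\<dots> = ennreal (LINT y|torus. g y)"
    using g by (subst nn_integral_eq_integral) (auto intro!: integrable_torus_continuous)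
  finally show ?thesis
    using g(3) by (simp add: integral_nonneg_AE)
qed

lemma Lp_integrable:
  assumes p: "1 \<le> p" and f: "f \<in> Lp p"
  shows "integrable torus f"
proof (rule Bochner_Integration.integrable_bound)
  interpret finite_measure "torus :: (real ^ 'a) measure" by (rule finite_measure_torus)
  show "integrable torus (\<lambda>x. 1 + norm (f x) powr p)"
    using f by (auto simp: Lp_def)
  show "f \<in> borel_measurable torus"
    using f by (auto simp: Lp_def)
  show "AE x in torus. norm (f x) \<le> norm (1 + norm (f x) powr p)"
  proof (rule AE_I2)
    fix x
    show "norm (f x) \<le> norm (1 + norm (f x) powr p)"
    proof (cases "norm (f x) \<le> 1")
      case False
      then have "norm (f x) powr 1 \<le> norm (f x) powr p"
        using p by (intro powr_mono) auto
      then show ?thesis using False by simp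
    qed (simp add: add_increasing2)
  qed
qed

lemma trig_fourier_convolution:
  assumes fin: "finite {\<xi>. a \<xi> \<noteq> 0}" and f: "integrable torus f"
  shows "trig (\<lambda>\<xi>. a \<xi> * fourier f \<xi>) x = (LINT y|torus. trig a (x - y) * f y)"
proof -
  have int: "integrable torus (\<lambda>y. tchar (x - y) \<xi> * f y)" for \<xi>
  proof (rule Bochner_Integration.integrable_bound[OF f])
    show "(\<lambda>y. tchar (x - y) \<xi> * f y) \<in> borel_measurable torus"
      by (intro borel_measurable_times borel_measurable_torus_continuous[OF continuous_on_tchar]
          borel_measurable_integrable[OF f] continuous_intros)
  qed (simp add: norm_mult)
  have "trig (\<lambda>\<xi>. a \<xi> * fourier f \<xi>) x = (\<Sum>\<xi> | a \<xi> \<noteq> 0. a \<xi> * fourier f \<xi> * tchar x \<xi>)"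
    using fin by (intro trig_eq_sum) auto
  also have "\<dots> = (\<Sum>\<xi> | a \<xi> \<noteq> 0. LINT y|torus. a \<xi> * (tchar (x - y) \<xi> * f y))"
  proof (intro sum.cong refl)
    fix \<xi>
    have shift: "tchar (x - y) \<xi> = tchar x \<xi> * cnj (tchar y \<xi>)" for y
      using tchar_add[of x "- y" \<xi>] by (simp add: tchar_uminus)
    show "a \<xi> * fourier f \<xi> * tchar x \<xi> = (LINT y|torus. a \<xi> * (tchar (x - y) \<xi> * f y))"
      by (simp add: fourier_eq shift mult.assoc)
  qed
  also have "\<dots> = (LINT y|torus. (\<Sum>\<xi> | a \<xi> \<noteq> 0. a \<xi> * (tchar (x - y) \<xi> * f y)))"
    using int by (intro Bochner_Integration.integral_sum[symmetric] integrable_mult_right)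
  also have "\<dots> = (LINT y|torus. trig a (x - y) * f y)"
    by (simp add: trig_def sum_distrib_right mult.assoc)
  finally show ?thesis .
qed

text \<open>Jensen with weight y \<mapsto> |K (x - y)|, whose mass W does not depend on x, gives the
  factor W^(p-1); Tonelli and translation invariance supply the remaining W.\<close>

proposition young_trig:
  fixes a :: "int ^ 'n \<Rightarrow> complex"
  assumes p: "1 \<le> p" and f: "f \<in> Lp p" and fin: "finite {\<xi>. a \<xi> \<noteq> 0}"
  shows "(\<integral>\<^sup>+x. ennreal (norm (trig (\<lambda>\<xi>. a \<xi> * fourier f \<xi>) x) powr p) \<partial>torus)
    \<le> ennreal ((LINT x|torus. norm (trig a x)) powr p * (LINT x|torus. norm (f x) powr p))"
proof -
  define K where "K x = norm (trig a x)" for x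
  define W where "W = (LINT x|torus. K x)"
  define F where "F x = norm (f x) powr p" for x
  interpret torus: finite_measure "torus :: (real ^ 'n) measure" by (rule finite_measure_torus)
  interpret pair: pair_sigma_finite "torus :: (real ^ 'n) measure" "torus :: (real ^ 'n) measure" ..
  have f_int: "integrable torus f" by (rule Lp_integrable[OF p f])
  have F_int: "integrable torus F" and [measurable]: "f \<in> borel_measurable torus"
    using f by (auto simp: Lp_def F_def[abs_def])
  have [measurable]: "F \<in> borel_measurable torus"
    unfolding F_def by measurable
  have K_cont: "continuous_on UNIV K"
    unfolding K_def by (intro continuous_intros)
  have Kx_cont: "continuous_on UNIV (\<lambda>y. K (x - y))" for x
    unfolding K_def by (intro continuous_intros)
  have K_per: "K (x + int_vec k) = K x" for x k
    by (simp add: K_def)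
  have K0: "0 \<le> K x" for x by (simp add: K_def)
  have W0: "0 \<le> W" unfolding W_def using K0 by (simp add: integral_nonneg_AE)
  have KW: "(LINT y|torus. K (x - y)) = W" for x
    unfolding W_def by (intro integral_torus_reflect_shift K_cont K_per K0)
  \<comment> \<open>\<open>K\<close> is bounded by the sum of the moduli of its coefficients, which
    makes its products with integrable functions integrable.\<close>
  obtain M where M: "\<And>x. K x \<le> M"
  proof
    fix x
    have "K x \<le> (\<Sum>\<xi> | a \<xi> \<noteq> 0. norm (a \<xi> * tchar x \<xi>))"
      unfolding K_def trig_def by (rule norm_sum)
    then show "K x \<le> (\<Sum>\<xi> | a \<xi> \<noteq> 0. norm (a \<xi>))"
      by (simp add: norm_mult)
  qed
  have Kint: "integrable torus (\<lambda>y. K (x - y) * g y)" if "integrable torus g" for x and g :: "real ^ 'n \<Rightarrow> real"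
  proof (rule Bochner_Integration.integrable_bound)
    show "integrable torus (\<lambda>y. M * g y)" using that by simp
    show "(\<lambda>y. K (x - y) * g y) \<in> borel_measurable torus"
      by (intro borel_measurable_times borel_measurable_torus_continuous[OF Kx_cont] borel_measurable_integrable[OF that])
    show "AE y in torus. norm (K (x - y) * g y) \<le> norm (M * g y)"
    proof (rule AE_I2)
      fix y
      have "\<bar>K (x - y)\<bar> \<le> \<bar>M\<bar>" using M[of "x - y"] K0[of "x - y"] by linarith
      then show "norm (K (x - y) * g y) \<le> norm (M * g y)"
        by (simp add: abs_mult mult_right_mono)
    qed
  qed
  have pointwise: "norm (trig (\<lambda>\<xi>. a \<xi> * fourier f \<xi>) x) powr p \<le> W powr (p - 1) * (LINT y|torus. K (x - y) * F y)" for x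
  proof -
    have "norm (trig (\<lambda>\<xi>. a \<xi> * fourier f \<xi>) x) \<le> (LINT y|torus. norm (trig a (x - y) * f y))"
      unfolding trig_fourier_convolution[OF fin f_int] by (rule integral_norm_bound)
    also have "\<dots> = (LINT y|torus. K (x - y) * norm (f y))"
      by (simp add: K_def norm_mult)
    finally have "norm (trig (\<lambda>\<xi>. a \<xi> * fourier f \<xi>) x) powr p \<le> (LINT y|torus. K (x - y) * norm (f y)) powr p"
      using p by (intro powr_mono2) auto
    also have "\<dots> \<le> (LINT y|torus. K (x - y)) powr (p - 1) * (LINT y|torus. K (x - y) * norm (f y) powr p)"
      using p K0 Kint[OF integrable_norm[OF f_int]] Kint[OF F_int] integrable_torus_continuous[OF Kx_cont]
      by (intro powr_integral_le) (auto simp: F_def)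
    finally show ?thesis by (simp add: KW F_def)
  qed
  have K_meas: "(\<lambda>z. K (fst z - snd z)) \<in> borel_measurable (torus \<Otimes>\<^sub>M torus)"
  proof -
    have id: "(\<lambda>x. x) \<in> borel_measurable (torus :: (real ^ 'n) measure)"
      by (rule borel_measurable_torus) simp
    have "(\<lambda>z. fst z - snd z) \<in> borel_measurable (torus \<Otimes>\<^sub>M (torus :: (real ^ 'n) measure))"
      using measurable_compose[OF measurable_fst id] measurable_compose[OF measurable_snd id]
      by (rule borel_measurable_diff)
    then show ?thesis
      by (rule measurable_compose) (rule borel_measurable_continuous_onI[OF K_cont])
  qed
  have "(\<integral>\<^sup>+x. ennreal (norm (trig (\<lambda>\<xi>. a \<xi> * fourier f \<xi>) x) powr p) \<partial>torus)
      \<le> (\<integral>\<^sup>+x. ennreal (W powr (p - 1)) * (\<integral>\<^sup>+y. ennreal (K (x - y)) * ennreal (F y) \<partial>torus) \<partial>torus)"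
  proof (rule nn_integral_mono)
    fix x
    have "(\<integral>\<^sup>+y. ennreal (K (x - y)) * ennreal (F y) \<partial>torus) = ennreal (LINT y|torus. K (x - y) * F y)"
      using K0 by (subst nn_integral_eq_integral[symmetric, OF Kint[OF F_int]]) (auto simp: F_def ennreal_mult)
    then show "ennreal (norm (trig (\<lambda>\<xi>. a \<xi> * fourier f \<xi>) x) powr p)
       \<le> ennreal (W powr (p - 1)) * (\<integral>\<^sup>+y. ennreal (K (x - y)) * ennreal (F y) \<partial>torus)"
      using pointwise[of x] by (simp add: ennreal_mult[symmetric] integral_nonneg_AE K0 F_def ennreal_leI)
  qed
  also have "\<dots> = ennreal (W powr (p - 1)) * (\<integral>\<^sup>+x. (\<integral>\<^sup>+y. ennreal (K (x - y)) * ennreal (F y) \<partial>torus) \<partial>torus)"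
    using K_meas by (intro nn_integral_cmult torus.borel_measurable_nn_integral) (simp add: split_beta)
  also have "(\<integral>\<^sup>+x. (\<integral>\<^sup>+y. ennreal (K (x - y)) * ennreal (F y) \<partial>torus) \<partial>torus)
      = (\<integral>\<^sup>+y. (\<integral>\<^sup>+x. ennreal (K (x - y)) * ennreal (F y) \<partial>torus) \<partial>torus)"
    using K_meas by (intro pair.Fubini'[symmetric]) (simp add: split_beta)
  also have "\<dots> = (\<integral>\<^sup>+y. ennreal W * ennreal (F y) \<partial>torus)"
  proof (intro nn_integral_cong)
    fix y
    have m: "(\<lambda>x. ennreal (K x)) \<in> borel_measurable borel"
      using K_cont by (intro measurable_compose[OF _ measurable_ennreal] borel_measurable_continuous_onI)
    have "(\<lambda>x. ennreal (K (x - y))) \<in> borel_measurable (torus :: (real ^ 'n) measure)"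
      by (intro borel_measurable_torus measurable_compose[OF _ m]) simp
    then have "(\<integral>\<^sup>+x. ennreal (K (x - y)) * ennreal (F y) \<partial>torus) = (\<integral>\<^sup>+x. ennreal (K (x - y)) \<partial>torus) * ennreal (F y)"
      by (rule nn_integral_multc)
    also have "(\<integral>\<^sup>+x. ennreal (K (x - y)) \<partial>torus) = (\<integral>\<^sup>+x. ennreal (K x) \<partial>torus)"
      using nn_integral_torus_shift[OF m, of "- y"] by (simp add: K_per)
    also have "\<dots> = ennreal W"
      unfolding W_def using K0 K_cont by (intro nn_integral_eq_integral integrable_torus_continuous) auto
    finally show "(\<integral>\<^sup>+x. ennreal (K (x - y)) * ennreal (F y) \<partial>torus) = ennreal W * ennreal (F y)" .
  qed
  also have "\<dots> = ennreal W * ennreal (LINT x|torus. F x)"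
    using nn_integral_eq_integral[OF F_int] by (subst nn_integral_cmult) (auto simp: F_def[abs_def])
  also have "ennreal (W powr (p - 1)) * (ennreal W * ennreal (LINT x|torus. F x)) = ennreal (W powr p * (LINT x|torus. F x))"
    using W0 powr_mult_base[OF W0, of "p - 1"]
    by (simp add: ennreal_mult[symmetric] integral_nonneg_AE F_def mult.assoc[symmetric] mult.commute)
  finally show ?thesis
    by (simp add: W_def K_def F_def)
qed

section \<open>Dyadic pieces of the operator\<close>

text \<open>A finite sum over frequencies, so no question of convergence arises for any
  \<open>f\<close>; this is what carries the operator beyond smooth functions.\<close>

definition piece_op ::
    "(real ^ 'n \<Rightarrow> int ^ 'n \<Rightarrow> complex) \<Rightarrow> nat \<Rightarrow> nat \<Rightarrow> (real ^ 'n \<Rightarrow> complex) \<Rightarrow> real ^ 'n \<Rightarrow> complex" where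
  "piece_op \<sigma> N j f x = trig (\<lambda>\<xi>. dyadic_piece N j \<xi> * \<sigma> x \<xi> * fourier f \<xi>) x"

lemma piece_op_eq_sum:
  "piece_op \<sigma> N j f x = (\<Sum>\<xi>\<in>int_box ((2 * N + 1) * 2 ^ j). dyadic_piece N j \<xi> * \<sigma> x \<xi> * fourier f \<xi> * tchar x \<xi>)"
  unfolding piece_op_def by (rule trig_eq_sum) (use dyadic_piece_eq_0 in auto)

lemma continuous_on_piece_op:
  assumes "\<And>\<xi>. continuous_on UNIV (\<lambda>x. \<sigma> x \<xi>)"
  shows "continuous_on UNIV (piece_op \<sigma> N j f)"
  unfolding piece_op_eq_sum[abs_def] by (intro continuous_intros assms)

lemma periodic_piece_op:
  assumes "\<And>\<xi>. periodic (\<lambda>x. \<sigma> x \<xi>)"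
  shows "periodic (piece_op \<sigma> N j f)"
  using assms by (simp add: periodic_def piece_op_eq_sum tchar_add)

text \<open>The hypothesis on the symbol has the differences inside the derivatives, the kernel
  estimate needs them outside; being finite linear combinations, they commute with
  derivatives.\<close>

lemma diff_op_foldr_partial:
  assumes "\<And>\<xi>. C_k (length js) (\<lambda>x. \<sigma> x \<xi>)"
  shows "C_k (length js) (\<lambda>y. (diff_op i ^^ m) (\<sigma> y) \<xi>)"
    and "(diff_op i ^^ m) (\<lambda>\<eta>. foldr partial js (\<lambda>y. \<sigma> y \<eta>) z) \<xi> = foldr partial js (\<lambda>y. (diff_op i ^^ m) (\<sigma> y) \<xi>) z"
proof -
  have *: "C_k (length js) (\<lambda>y. (diff_op i ^^ m) (\<sigma> y) \<xi>) \<and>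
     (diff_op i ^^ m) (\<lambda>\<eta>. foldr partial js (\<lambda>y. \<sigma> y \<eta>) z) \<xi> = foldr partial js (\<lambda>y. (diff_op i ^^ m) (\<sigma> y) \<xi>) z"
    by (induction m arbitrary: \<xi>) (simp_all add: assms diff_op_funpow_Suc C_k_diff foldr_partial_diff del: funpow.simps(2))
  then show "C_k (length js) (\<lambda>y. (diff_op i ^^ m) (\<sigma> y) \<xi>)"
    and "(diff_op i ^^ m) (\<lambda>\<eta>. foldr partial js (\<lambda>y. \<sigma> y \<eta>) z) \<xi> = foldr partial js (\<lambda>y. (diff_op i ^^ m) (\<sigma> y) \<xi>) z"
    by auto
qed

text \<open>In order: the Sobolev constant, the number of derivatives in that inequality, and the
  bound for the \<open>L^1\<close> norm of a kernel.\<close>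

definition piece_const :: "'n itself \<Rightarrow> real \<Rightarrow> nat \<Rightarrow> nat \<Rightarrow> real" where
  "piece_const _ p k N = (1 + 1 / (k - CARD('n) / p)) * 
     card (SIGMA i:{..k}. (index_lists i :: 'n list set)) * sqrt (kernel_const TYPE('n) N)"

text \<open>
  For fixed \<open>x\<close> the Sobolev inequality is applied to \<open>z \<mapsto> \<Sum>\<^sub>\<xi> \<psi>\<^sub>j(\<xi>) \<sigma>(z, \<xi>) fourier f \<xi> tchar x \<xi>\<close>, which freezes
  the symbol at \<open>z\<close>; what remains is an \<open>x\<close>-convolution with kernel bounds uniform in \<open>z\<close>.
\<close>

proposition piece_op_bound:
  fixes \<sigma> :: "real ^ 'n \<Rightarrow> int ^ 'n \<Rightarrow> complex"
  assumes p: "1 \<le> p" and k: "real k > CARD('n) / p" and N: "2 * N > CARD('n)" and \<rho>: "0 \<le> \<rho>" "\<rho> \<le> 1" and V: "0 \<le> V"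
    and per: "\<And>\<xi>. periodic (\<lambda>x. \<sigma> x \<xi>)" and smooth: "\<And>\<xi>. C_k k (\<lambda>x. \<sigma> x \<xi>)"
    and \<Lambda>: "\<Lambda> = 2 ^ j / (2 * (1 + real N))" and h: "h = CARD('n) / 2 * (1 - \<rho>)"
    and bound: "\<And>js z \<xi> i m. length js \<le> k \<Longrightarrow> m \<le> N \<Longrightarrow> \<Lambda> \<le> japanese \<xi> \<Longrightarrow>
       norm (foldr partial js (\<lambda>y. (diff_op i ^^ m) (\<sigma> y) \<xi>) z) \<le> V * \<Lambda> powr (- h - \<rho> * m)"
    and f: "f \<in> Lp p"
  shows "Lp_norm p (piece_op \<sigma> N j f) \<le> piece_const TYPE('n) p k N * V * Lp_norm p f"
proof -
  interpret torus: finite_measure "torus :: (real ^ 'n) measure" by (rule finite_measure_torus)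
  interpret pair: pair_sigma_finite "torus :: (real ^ 'n) measure" "torus :: (real ^ 'n) measure" ..
  define I where "I = (SIGMA i:{..k}. (index_lists i :: 'n list set))"
  define S :: "(int ^ 'n) set" where "S = int_box ((2 * N + 1) * 2 ^ j)"
  define d where "d = 1 + 1 / (k - CARD('n) / p)"
  define M where "M = sqrt (kernel_const TYPE('n) N)"
  define c where "c x \<xi> = dyadic_piece N j \<xi> * fourier f \<xi> * tchar x \<xi>" for x \<xi>
  define F where "F x z = (\<Sum>\<xi>\<in>S. c x \<xi> * \<sigma> z \<xi>)" for x z
  define G where "G js x z = (\<Sum>\<xi>\<in>S. c x \<xi> * foldr partial js (\<lambda>y. \<sigma> y \<xi>) z)" for js x z
  have d0: "d \<ge> 0" using k by (simp add: d_def)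
  have M0: "M \<ge> 0"
    using N by (auto simp: M_def kernel_const_def field_simps intro!: mult_nonneg_nonneg)
  have I: "length (snd m) \<le> k" if "m \<in> I" for m
    using that by (auto simp: I_def index_lists_def)
  have finI: "finite I" by (simp add: I_def)
  have smooth': "C_k (length js) (\<lambda>x. \<sigma> x \<xi>)" if "length js \<le> k" for js \<xi>
    using C_k_mono[OF smooth that] .
  have cont: "continuous_on UNIV (foldr partial js (\<lambda>y. \<sigma> y \<xi>))" if "length js \<le> k" for js \<xi>
    by (rule continuous_on_foldr_partial[OF smooth that])
  have c_cont: "continuous_on A (\<lambda>x. c (g x) \<xi>)" if "continuous_on A g" for A \<xi> and g :: "real ^ 'n \<Rightarrow> real ^ 'n"
    unfolding c_def by (intro continuous_intros that)
  have F_smooth: "C_k k (F x)" for x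
    unfolding F_def by (intro C_k_sum C_k_mult_left smooth)
  have F_per: "periodic (F x)" for x
    using per by (simp add: F_def periodic_def)
  have F_partial: "foldr partial js (F x) = G js x" if "length js \<le> k" for js x
    unfolding F_def G_def using smooth'[OF that] C_k_mult_left
    by (subst foldr_partial_sum) (auto simp: foldr_partial_mult_left fun_eq_iff)
  have G_cont: "continuous_on UNIV (G js x)" if "length js \<le> k" for js x
    unfolding F_partial[OF that, symmetric] by (rule continuous_on_foldr_partial[OF F_smooth that])
  have G_meas: "(\<lambda>z. G js (fst z) (snd z)) \<in> borel_measurable (torus \<Otimes>\<^sub>M torus)" if "length js \<le> k" for js
    unfolding G_def 
    by (intro borel_measurable_sum borel_measurable_times measurable_compose[OF measurable_fst] measurable_compose[OF measurable_snd]
       borel_measurable_torus_continuous c_cont continuous_on_id cont[OF that])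
  have piece: "piece_op \<sigma> N j f x = F x x" for x
    unfolding piece_op_eq_sum F_def c_def S_def by (simp add: mult_ac)
  have pointwise: "norm (F x x) powr p \<le> (d powr p * card I powr (p - 1)) * (\<Sum>m\<in>I. LINT z|torus. norm (G (snd m) x z) powr p)" for x
  proof -
    have "norm (F x x) \<le> d * (\<Sum>i\<le>k. \<Sum>js\<in>index_lists i. Lp_norm p (foldr partial js (F x)))"
      unfolding d_def by (rule sobolev_torus[OF F_smooth F_per p k])
    also have "(\<Sum>i\<le>k. \<Sum>js\<in>index_lists i. Lp_norm p (foldr partial js (F x))) = (\<Sum>m\<in>I. 1 * Lp_norm p (G (snd m) x))"
    proof -
      have "(\<Sum>i\<le>k. \<Sum>js\<in>index_lists i. Lp_norm p (foldr partial js (F x))) = (\<Sum>m\<in>I. Lp_norm p (foldr partial (snd m) (F x)))"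
        unfolding I_def by (subst sum.Sigma) (auto simp: split_beta)
      also have "\<dots> = (\<Sum>m\<in>I. 1 * Lp_norm p (G (snd m) x))"
        by (intro sum.cong refl) (simp add: F_partial I)
      finally show ?thesis .
    qed
    finally have "norm (F x x) powr p \<le> (d * (\<Sum>m\<in>I. 1 * Lp_norm p (G (snd m) x))) powr p"
      using p by (intro powr_mono2) auto
    also have "\<dots> = d powr p * (\<Sum>m\<in>I. 1 * Lp_norm p (G (snd m) x)) powr p"
      by (rule powr_mult)
    \<comment> \<open>Unit weights on the derivatives; the factor card I^(p-1) will combine with
      card I equal bounds into card I^p.\<close>
    also have "\<dots> \<le> d powr p * ((\<Sum>m\<in>I. 1) powr (p - 1) * (\<Sum>m\<in>I. 1 * Lp_norm p (G (snd m) x) powr p))"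
      using p finI by (intro mult_left_mono powr_sum_le) auto
    finally show ?thesis
      by (simp add: Lp_norm_powr[OF p] mult.assoc)
  qed
  have slice: "(\<integral>\<^sup>+x. ennreal (norm (G js x z) powr p) \<partial>torus) \<le> ennreal ((M * V) powr p * Lp_norm p f powr p)" if js: "length js \<le> k" for js z
  proof -
    define g where "g \<xi> = foldr partial js (\<lambda>y. \<sigma> y \<xi>) z" for \<xi>
    have fin: "finite {\<xi>. dyadic_piece N j \<xi> * g \<xi> \<noteq> 0}"
    proof (rule finite_subset)
      show "{\<xi>. dyadic_piece N j \<xi> * g \<xi> \<noteq> 0} \<subseteq> S"
        using dyadic_piece_eq_0[of _ N j] by (auto simp: S_def simp del: of_nat_mult)
    qed (simp add: S_def)
    have "G js x z = trig (\<lambda>\<xi>. dyadic_piece N j \<xi> * g \<xi> * fourier f \<xi>) x" for x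
      unfolding G_def by (subst trig_eq_sum[of S]) (auto simp: S_def dyadic_piece_eq_0 c_def g_def mult_ac)
    then have "(\<integral>\<^sup>+x. ennreal (norm (G js x z) powr p) \<partial>torus)
        \<le> ennreal ((LINT x|torus. norm (trig (\<lambda>\<xi>. dyadic_piece N j \<xi> * g \<xi>) x)) powr p * (LINT x|torus. norm (f x) powr p))"
      using young_trig[OF p f fin] by simp
    also have "\<dots> \<le> ennreal ((M * V) powr p * Lp_norm p f powr p)"
    proof (intro ennreal_leI mult_mono powr_mono2)
      show "(LINT x|torus. norm (trig (\<lambda>\<xi>. dyadic_piece N j \<xi> * g \<xi>) x)) \<le> M * V"
        unfolding M_def
      proof (rule dyadic_kernel_L1_bound[OF \<Lambda> \<rho> N V h])
        fix \<xi> :: "int ^ 'n" and i m assume m: "m \<le> N" "\<Lambda> \<le> japanese \<xi>"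
        have "(diff_op i ^^ m) g \<xi> = foldr partial js (\<lambda>y. (diff_op i ^^ m) (\<sigma> y) \<xi>) z"
          unfolding g_def[abs_def] by (rule diff_op_foldr_partial(2)[OF smooth'[OF js]])
        then show "norm ((diff_op i ^^ m) g \<xi>) \<le> V * \<Lambda> powr (- h - \<rho> * m)"
          using bound[OF js m] by simp
      qed
    qed (use p in \<open>auto simp: Lp_norm_powr[OF p] integral_nonneg_AE\<close>)
    finally show ?thesis .
  qed
  have Fx_cont: "continuous_on UNIV (\<lambda>x. F x x)"
    unfolding F_def by (intro continuous_intros c_cont C_k_continuous[OF smooth])
  have "(\<integral>\<^sup>+x. ennreal (norm (F x x) powr p) \<partial>torus)
    \<le> (\<integral>\<^sup>+x. ennreal (d powr p * card I powr (p - 1)) * (\<Sum>m\<in>I. \<integral>\<^sup>+z. ennreal (norm (G (snd m) x z) powr p) \<partial>torus) \<partial>torus)"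
  proof (rule nn_integral_mono)
    fix x
    have "(\<Sum>m\<in>I. \<integral>\<^sup>+z. ennreal (norm (G (snd m) x z) powr p) \<partial>torus) = (\<Sum>m\<in>I. ennreal (LINT z|torus. norm (G (snd m) x z) powr p))"
      using I p by (intro sum.cong refl nn_integral_eq_integral integrable_torus_continuous continuous_on_powr_const continuous_on_norm G_cont) auto
    then show "ennreal (norm (F x x) powr p) \<le> ennreal (d powr p * card I powr (p - 1)) * (\<Sum>m\<in>I. \<integral>\<^sup>+z. ennreal (norm (G (snd m) x z) powr p) \<partial>torus)"
      using pointwise[of x] by (simp add: ennreal_mult[symmetric] sum_nonneg integral_nonneg_AE ennreal_leI)
  qed
  also have "\<dots> = ennreal (d powr p * card I powr (p - 1)) * (\<Sum>m\<in>I. \<integral>\<^sup>+x. (\<integral>\<^sup>+z. ennreal (norm (G (snd m) x z) powr p) \<partial>torus) \<partial>torus)"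
  proof -
    have m: "(\<lambda>x. \<integral>\<^sup>+z. ennreal (norm (G (snd m) x z) powr p) \<partial>torus) \<in> borel_measurable torus" if "m \<in> I" for m
      using G_meas[OF I[OF that]] by (intro torus.borel_measurable_nn_integral) (simp add: split_beta)
    then show ?thesis
      by (subst nn_integral_cmult) (auto simp: nn_integral_sum)
  qed
  \<comment> \<open>Now the integral over \<open>x\<close> is taken first at a fixed
    \<open>z\<close>, which is the situation of \<open>slice\<close>.\<close>
  also have "(\<Sum>m\<in>I. \<integral>\<^sup>+x. (\<integral>\<^sup>+z. ennreal (norm (G (snd m) x z) powr p) \<partial>torus) \<partial>torus)
      = (\<Sum>m\<in>I. \<integral>\<^sup>+z. (\<integral>\<^sup>+x. ennreal (norm (G (snd m) x z) powr p) \<partial>torus) \<partial>torus)"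
    using G_meas I by (intro sum.cong refl pair.Fubini'[symmetric]) (simp add: split_beta)
  also have "\<dots> \<le> (\<Sum>m\<in>I. \<integral>\<^sup>+z. ennreal ((M * V) powr p * Lp_norm p f powr p) \<partial>(torus :: (real ^ 'n) measure))"
    by (intro sum_mono nn_integral_mono slice I)
  also have "\<dots> = (\<Sum>m\<in>I. ennreal ((M * V) powr p * Lp_norm p f powr p))"
    by (simp add: emeasure_torus)
  also have "ennreal (d powr p * card I powr (p - 1)) * \<dots> = ennreal ((d powr p * card I powr (p - 1)) * (card I * ((M * V) powr p * Lp_norm p f powr p)))"
    by (simp add: ennreal_mult ennreal_of_nat_eq_real_of_nat)
  also have "(d powr p * card I powr (p - 1)) * (card I * ((M * V) powr p * Lp_norm p f powr p)) = (d * card I * (M * V) * Lp_norm p f) powr p"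
    using d0 M0 V powr_mult_base[of "card I" "p - 1"] by (simp add: powr_mult mult_ac)
  finally have nn: "(\<integral>\<^sup>+x. ennreal (norm (F x x) powr p) \<partial>torus) \<le> ennreal ((d * card I * (M * V) * Lp_norm p f) powr p)"
    by (simp add: mult_left_mono)
  have "(LINT x|torus. norm (F x x) powr p) \<le> (d * card I * (M * V) * Lp_norm p f) powr p"
    using nn p by (subst (asm) nn_integral_eq_integral) (auto intro!: integrable_torus_continuous continuous_on_powr_const continuous_on_norm Fx_cont)
  then have "Lp_norm p (piece_op \<sigma> N j f) \<le> d * card I * (M * V) * Lp_norm p f"
    using p d0 M0 V by (intro Lp_normI) (auto simp: piece)
  then show ?thesis
    by (simp add: piece_const_def d_def I_def M_def mult_ac)
qed

section \<open>Reassembling the operator\<close>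

text \<open>Every piece up to \<open>J\<close> vanishes outside the box of the last one; on this
  common box the pieces telescope to a single cutoff.\<close>

lemma sum_piece_op:
  "(\<Sum>j<Suc J. piece_op \<sigma> N j f x) = 
    (\<Sum>\<xi>\<in>int_box ((2 * N + 1) * 2 ^ J). cutoff N J \<xi> * (\<sigma> x \<xi> * fourier f \<xi> * tchar x \<xi>))"
proof -
  have "piece_op \<sigma> N j f x = (\<Sum>\<xi>\<in>int_box ((2 * N + 1) * 2 ^ J). dyadic_piece N j \<xi> * \<sigma> x \<xi> * fourier f \<xi> * tchar x \<xi>)"
    if "j \<le> J" for j
  proof -
    have "(2 * N + 1) * 2 ^ j \<le> (2 * N + 1) * 2 ^ J"
      using that by (intro mult_left_mono power_increasing) auto
    then have "int_box ((2 * N + 1) * 2 ^ j) \<subseteq> (int_box ((2 * N + 1) * 2 ^ J) :: (int ^ 'a) set)"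
      by (rule int_box_mono)
    then have zero: "dyadic_piece N j \<xi> = 0" if "\<xi> \<notin> int_box ((2 * N + 1) * 2 ^ J)" for \<xi> :: "int ^ 'a"
      using that by (intro dyadic_piece_eq_0) auto
    show ?thesis
      unfolding piece_op_def by (rule trig_eq_sum) (simp_all add: zero)
  qed
  then have "(\<Sum>j<Suc J. piece_op \<sigma> N j f x) = 
    (\<Sum>j<Suc J. \<Sum>\<xi>\<in>int_box ((2 * N + 1) * 2 ^ J). dyadic_piece N j \<xi> * \<sigma> x \<xi> * fourier f \<xi> * tchar x \<xi>)"
    by (intro sum.cong refl) auto
  also have "\<dots> = (\<Sum>\<xi>\<in>int_box ((2 * N + 1) * 2 ^ J). (\<Sum>j<Suc J. dyadic_piece N j \<xi>) * (\<sigma> x \<xi> * fourier f \<xi> * tchar x \<xi>))"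
    by (subst sum.swap) (simp only: sum_distrib_right mult.assoc)
  finally show ?thesis
    by (simp only: sum_dyadic_piece)
qed

lemma cutoff_tendsto_1: "(\<lambda>J. cutoff N J \<xi>) \<longlonglongrightarrow> 1"
proof (rule tendsto_eventually)
  define L where "L = (\<Sum>i\<in>UNIV. nat \<bar>\<xi> $ i\<bar>)"
  have "cutoff N J \<xi> = 1" if "J \<ge> L" for J
  proof (rule cutoff_eq_1)
    have "nat \<bar>\<xi> $ i\<bar> \<le> 2 ^ J" for i
    proof -
      have "nat \<bar>\<xi> $ i\<bar> \<le> L"
        unfolding L_def by (rule member_le_sum) auto
      also have "L < 2 ^ L" by (rule less_exp)
      also have "(2 :: nat) ^ L \<le> 2 ^ J"
        using that by (intro power_increasing) auto
      finally show ?thesis by simp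
    qed
    then show "\<xi> \<in> int_box (2 ^ J)"
      unfolding int_box_def nat_le_iff by blast
  qed
  then show "\<forall>\<^sub>F J in sequentially. cutoff N J \<xi> = 1"
    by (auto simp: eventually_sequentially)
qed

text \<open>Partial sums are the full series with the factor \<open>cutoff N J\<close>, which is
  bounded by 1 and tends to 1, so dominated convergence for the counting measure applies.\<close>

lemma piece_op_sums:
  fixes f :: "real ^ 'n \<Rightarrow> complex"
  assumes f: "(\<lambda>\<xi>. norm (fourier f \<xi>)) summable_on UNIV" and B: "\<And>\<xi>. norm (\<sigma> x \<xi>) \<le> B"
  shows "(\<lambda>j. piece_op \<sigma> N j f x) sums periodic_op \<sigma> f x"
proof -
  define c where "c \<xi> = \<sigma> x \<xi> * fourier f \<xi> * tchar x \<xi>" for \<xi>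
  have summ: "(\<lambda>\<xi>. norm (c \<xi>)) summable_on UNIV"
  proof (rule summable_on_comparison_test)
    show "(\<lambda>\<xi>. B * norm (fourier f \<xi>)) summable_on UNIV"
      by (intro summable_on_cmult_right f)
    show "norm (c \<xi>) \<le> B * norm (fourier f \<xi>)" for \<xi>
      using B by (simp add: c_def norm_mult mult_right_mono)
  qed auto
  then have abs: "Infinite_Set_Sum.abs_summable_on c UNIV"
    by (simp add: abs_summable_equivalent)
  then have int: "integrable (count_space UNIV) c"
    by (simp add: Infinite_Set_Sum.abs_summable_on_def)
  have lim: "(\<lambda>J. LINT \<xi>|count_space UNIV. cutoff N J \<xi> * c \<xi>) \<longlonglongrightarrow> (LINT \<xi>|count_space UNIV. c \<xi>)"
  proof (rule integral_dominated_convergence)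
    show "integrable (count_space UNIV) (\<lambda>\<xi>. norm (c \<xi>))"
      using int by (rule integrable_norm)
    show "AE \<xi> in count_space UNIV. (\<lambda>J. cutoff N J \<xi> * c \<xi>) \<longlonglongrightarrow> c \<xi>"
    proof (rule AE_I2)
      fix \<xi>
      show "(\<lambda>J. cutoff N J \<xi> * c \<xi>) \<longlonglongrightarrow> c \<xi>"
        using tendsto_mult[OF cutoff_tendsto_1[of N \<xi>] tendsto_const[of "c \<xi>"]] by simp
    qed
    show "AE \<xi> in count_space UNIV. norm (cutoff N J \<xi> * c \<xi>) \<le> norm (c \<xi>)" for J
    proof (rule AE_I2)
      fix \<xi>
      show "norm (cutoff N J \<xi> * c \<xi>) \<le> norm (c \<xi>)"
        using mult_right_mono[OF norm_cutoff_le[of N J \<xi>], of "norm (c \<xi>)"] by (simp add: norm_mult)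
    qed
  qed auto
  have "(LINT \<xi>|count_space UNIV. cutoff N J \<xi> * c \<xi>) = (\<Sum>j<Suc J. piece_op \<sigma> N j f x)" for J
  proof -
    let ?S = "int_box ((2 * N + 1) * 2 ^ J) :: (int ^ 'n) set"
    have zero: "cutoff N J \<xi> * c \<xi> = 0" if "\<xi> \<notin> ?S" for \<xi>
      using cutoff_eq_0[OF that] by simp
    have fin: "finite {\<xi>. cutoff N J \<xi> * c \<xi> \<noteq> 0}"
    proof (rule finite_subset)
      show "{\<xi>. cutoff N J \<xi> * c \<xi> \<noteq> 0} \<subseteq> ?S"
        using zero by blast
    qed simp
    have "(LINT \<xi>|count_space UNIV. cutoff N J \<xi> * c \<xi>) = (\<Sum>\<xi> | \<xi> \<in> UNIV \<and> cutoff N J \<xi> * c \<xi> \<noteq> 0. cutoff N J \<xi> * c \<xi>)"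
      by (rule lebesgue_integral_count_space_finite_support) (use fin in simp)
    also have "\<dots> = (\<Sum>\<xi>\<in>?S. cutoff N J \<xi> * c \<xi>)"
    proof (rule sum.mono_neutral_left)
      show "{\<xi>. \<xi> \<in> UNIV \<and> cutoff N J \<xi> * c \<xi> \<noteq> 0} \<subseteq> ?S"
        using zero by blast
    qed auto
    finally show ?thesis
      unfolding sum_piece_op c_def .
  qed
  moreover have "(LINT \<xi>|count_space UNIV. c \<xi>) = periodic_op \<sigma> f x"
  proof -
    have "periodic_op \<sigma> f x = infsum c UNIV"
      unfolding periodic_op_def exp_eq_tchar c_def by (simp add: mult_ac)
    then show ?thesis
      using infsetsum_infsum[OF abs] by (simp add: infsetsum_def)
  qed
  ultimately have "(\<lambda>J. \<Sum>j<Suc J. piece_op \<sigma> N j f x) \<longlonglongrightarrow> periodic_op \<sigma> f x"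
    using lim by simp
  then show ?thesis
    unfolding sums_def by (rule LIMSEQ_imp_Suc)
qed

lemma fourier_add:
  fixes f g :: "real ^ 'n \<Rightarrow> complex"
  assumes "integrable torus f" "integrable torus g"
  shows "fourier (\<lambda>y. f y + g y) \<xi> = fourier f \<xi> + fourier g \<xi>"
proof -
  have "integrable torus (\<lambda>x. cnj (tchar x \<xi>) * h x)" if "integrable torus h" for h :: "real ^ 'n \<Rightarrow> complex"
  proof (rule Bochner_Integration.integrable_bound[OF that])
    show "(\<lambda>x. cnj (tchar x \<xi>) * h x) \<in> borel_measurable torus"
      by (intro borel_measurable_times borel_measurable_torus_continuous continuous_on_cnj continuous_on_tchar continuous_on_id
          borel_measurable_integrable[OF that])
  qed (simp add: norm_mult)
  then show ?thesis
    using assms unfolding fourier_eq by (simp add: distrib_left)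
qed

lemma fourier_cmult: "fourier (\<lambda>y. c * f y) \<xi> = c * fourier f \<xi>"
  unfolding fourier_eq by (subst integral_mult_right_zero[symmetric]) (simp add: mult_ac)

text \<open>The pieces see \<open>f\<close> only through its coefficients, so this makes the
  extension independent of the representative.\<close>

lemma fourier_cong_AE:
  fixes f g :: "real ^ 'n \<Rightarrow> complex"
  assumes "integrable torus f" "integrable torus g" "AE x in torus. f x = g x"
  shows "fourier f = fourier g"
proof
  fix \<xi> :: "int ^ 'n"
  have "(\<lambda>x. cnj (tchar x \<xi>) * h x) \<in> borel_measurable torus" if "integrable torus h" for h :: "real ^ 'n \<Rightarrow> complex"
    by (intro borel_measurable_times borel_measurable_torus_continuous continuous_on_cnj continuous_on_tchar continuous_on_id
          borel_measurable_integrable[OF that])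
  then show "fourier f \<xi> = fourier g \<xi>"
    unfolding fourier_eq using assms by (intro integral_cong_AE) auto
qed

lemma msize_0: "msize 0 = 0"
  by (simp add: msize_def)

lemma multi_op_0:
  fixes D :: "'n::finite \<Rightarrow> 'a \<Rightarrow> 'a"
  shows "multi_op D 0 g = g"
proof -
  have "multi_index_list (0 :: nat ^ 'n) = []"
    using length_multi_index_list[of "0 :: nat ^ 'n"] by (simp add: msize_0)
  then show ?thesis
    by (simp add: multi_op_eq_foldr)
qed

theorem mainTheorem1:
  fixes \<epsilon> \<rho> p C :: real
    and \<omega> :: "real \<Rightarrow> real"
    and \<sigma> :: "real ^ 'n \<Rightarrow> int ^ 'n \<Rightarrow> complex"
  assumes "0 < \<epsilon>" "\<epsilon> \<le> 1"
    and "0 \<le> \<rho>" "\<rho> \<le> 1"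
    and "1 \<le> p"
    and "\<And>t. 0 \<le> t \<Longrightarrow> 0 \<le> \<omega> t"
    and "mono_on {0..} \<omega>"
    and "bounded (\<omega> ` {0..})"
    and "set_integrable lborel {0<..1} (\<lambda>t. \<omega> t / t)"
    and "\<And>\<xi>. periodic (\<lambda>x. \<sigma> x \<xi>)"
    and "\<And>\<xi>. C_k (nat \<lfloor>real CARD('n) / p\<rfloor> + 1) (\<lambda>x. \<sigma> x \<xi>)"
    and "0 < C"
    and "\<And>\<alpha> \<beta> x \<xi>. msize \<alpha> \<le> nat \<lfloor>real CARD('n) / 2\<rfloor> + 1 \<Longrightarrow>
           msize \<beta> \<le> nat \<lfloor>real CARD('n) / p\<rfloor> + 1 \<Longrightarrow>
           norm (multi_op partial \<beta> (\<lambda>y. multi_op diff_op \<alpha> (\<sigma> y) \<xi>) x)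
             \<le> C * \<omega> (japanese \<xi> powr (- \<epsilon>)) *
                 japanese \<xi> powr (- (real CARD('n) / 2) * (1 - \<rho>) - \<rho> * real (msize \<alpha>))"
  shows "extends_to_bounded_op_Lp p (periodic_op \<sigma>)"
proof -
  note \<epsilon> = assms(1,2) and \<rho> = assms(3,4) and p = assms(5) and \<omega>_nonneg = assms(6) and \<omega>_mono = assms(7)
    and \<omega>_int = assms(9) and per = assms(10) and C = assms(12) and symbol = assms(13)
  define k where "k = nat \<lfloor>real CARD('n) / p\<rfloor> + 1"
  define N where "N = nat \<lfloor>real CARD('n) / 2\<rfloor> + 1"
  define h where "h = real CARD('n) / 2 * (1 - \<rho>)"
  define \<Lambda> where "\<Lambda> j = 2 ^ j / (2 * (1 + real N))" for j
  \<comment> \<open>As \<omega> is non-decreasing, its values over the frequencies involved in a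
    piece are at most the one at the smallest bracket \<Lambda> j.\<close>
  define V where "V j = C * \<omega> (\<Lambda> j powr (- \<epsilon>))" for j
  have k: "real k > CARD('n) / p"
    unfolding k_def using p by (simp add: of_nat_nat) linarith
  have N: "2 * N > CARD('n)"
  proof -
    have "real N > CARD('n) / 2"
      unfolding N_def by (simp add: of_nat_nat) linarith
    then show ?thesis by linarith
  qed
  have h: "0 \<le> h" using \<rho> by (simp add: h_def)
  have \<Lambda>: "0 < \<Lambda> j" for j by (simp add: \<Lambda>_def)
  have V: "0 \<le> V j" for j
    unfolding V_def using C by (intro mult_nonneg_nonneg \<omega>_nonneg) auto
  have smooth: "C_k k (\<lambda>x. \<sigma> x \<xi>)" for \<xi>
    unfolding k_def by (rule assms(11))
  have cont: "continuous_on UNIV (\<lambda>x. \<sigma> x \<xi>)" for \<xi>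
    using smooth by (rule C_k_continuous)
  have \<omega>_le: "\<omega> s \<le> \<omega> t" if "0 \<le> s" "s \<le> t" for s t
    using \<omega>_mono that by (auto simp: mono_on_def)
  have bound: "norm (foldr partial js (\<lambda>y. (diff_op i ^^ m) (\<sigma> y) \<xi>) z) \<le> V j * \<Lambda> j powr (- h - \<rho> * m)"
    if js: "length js \<le> k" and m: "m \<le> N" and \<xi>: "\<Lambda> j \<le> japanese \<xi>" for js z \<xi> i m j
  proof -
    define \<alpha> :: "nat ^ 'n" where "\<alpha> = (\<chi> l. if l = i then m else 0)"
    define \<beta> :: "nat ^ 'n" where "\<beta> = (\<chi> l. count (mset js) l)"
    have sizes: "msize \<alpha> = m" "msize \<beta> = length js"
      unfolding \<alpha>_def \<beta>_def by (rule msize_axis msize_count)+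
    have "foldr partial js (\<lambda>y. (diff_op i ^^ m) (\<sigma> y) \<xi>) = multi_op partial \<beta> (\<lambda>y. multi_op diff_op \<alpha> (\<sigma> y) \<xi>)"
      unfolding \<alpha>_def \<beta>_def multi_op_axis
      by (intro foldr_partial_eq_multi_op diff_op_foldr_partial(1) C_k_mono[OF smooth js])
    then have "norm (foldr partial js (\<lambda>y. (diff_op i ^^ m) (\<sigma> y) \<xi>) z) 
        \<le> C * \<omega> (japanese \<xi> powr (- \<epsilon>)) * japanese \<xi> powr (- h - \<rho> * m)"
      using symbol[of \<alpha> \<beta> \<xi> z] js m by (simp add: sizes N_def k_def h_def)
    also have "\<dots> \<le> V j * \<Lambda> j powr (- h - \<rho> * m)"
      unfolding V_def
    proof (intro mult_mono)
      show "\<omega> (japanese \<xi> powr (- \<epsilon>)) \<le> \<omega> (\<Lambda> j powr (- \<epsilon>))"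
        using \<epsilon> \<xi> \<Lambda> by (intro \<omega>_le powr_mono2') auto
      have "0 \<le> \<rho> * m" using \<rho> by simp
      then show "japanese \<xi> powr (- h - \<rho> * m) \<le> \<Lambda> j powr (- h - \<rho> * m)"
        using \<xi> \<Lambda> h by (intro powr_mono2') auto
    qed (use C \<omega>_nonneg in auto)
    finally show ?thesis .
  qed
  define K where "K = \<bar>piece_const TYPE('n) p k N\<bar>"
  \<comment> \<open>The geometric term keeps \<open>a j\<close> positive even where \<omega>
    vanishes, as \<open>Lp_series\<close> requires, and does not affect summability.\<close>
  define a where "a j = K * V j + (1 / 2) ^ j" for j :: nat
  have a_pos: "0 < a j" for j
    unfolding a_def K_def using V by (intro add_nonneg_pos mult_nonneg_nonneg) auto
  have "summable V"
  proof -
    have "\<Lambda> j powr (- \<epsilon>) = (2 * (1 + real N)) powr \<epsilon> * (2 powr (- \<epsilon>)) ^ j" for j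
    proof -
      have "(2 ^ j) powr (- \<epsilon>) = (2 powr (- \<epsilon>)) ^ j"
        by (simp add: powr_realpow[symmetric] powr_powr mult.commute)
      then show ?thesis
        unfolding \<Lambda>_def by (subst powr_minus_divide_eq) auto
    qed
    moreover have "summable (\<lambda>j. \<omega> ((2 * (1 + real N)) powr \<epsilon> * (2 powr (- \<epsilon>)) ^ j))"
    proof (rule dini_summable[OF \<omega>_nonneg \<omega>_mono \<omega>_int])
      show "2 powr (- \<epsilon>) < (1 :: real)"
        using \<epsilon> powr_less_mono[of "- \<epsilon>" 0 2] by simp
    qed auto
    ultimately show ?thesis
      unfolding V_def by (auto intro: summable_mult)
  qed
  then have a_summable: "summable a"
    unfolding a_def by (intro summable_add summable_mult summable_geometric) auto
  have piece_bound: "Lp_norm p (piece_op \<sigma> N j f) \<le> a j * Lp_norm p f" if f: "f \<in> Lp p" for j f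
  proof -
    have "Lp_norm p (piece_op \<sigma> N j f) \<le> piece_const TYPE('n) p k N * V j * Lp_norm p f"
      using bound[where j = j] by (intro piece_op_bound[OF p k N \<rho> V per smooth \<Lambda>_def h_def _ f]) auto
    also have "\<dots> \<le> a j * Lp_norm p f"
      unfolding a_def K_def using V[of j] by (intro mult_right_mono add_increasing2 mult_right_mono) auto
    finally show ?thesis .
  qed
  \<comment> \<open>Defined for every \<open>f\<close> and x; convergence is known almost everywhere
    for \<open>f\<close> in \<open>Lp p\<close>. Periodicity holds regardless, because the value
    depends only on the sequence of pieces at x.\<close>
  define T where "T f x = (\<Sum>j. piece_op \<sigma> N j f x)" for f x
  have piece_cont: "continuous_on UNIV (piece_op \<sigma> N j f)" for j f
    by (rule continuous_on_piece_op[OF cont])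
  have piece_int: "integrable torus (\<lambda>x. norm (piece_op \<sigma> N j f x) powr p)" for j f
    using p by (intro integrable_torus_continuous continuous_on_powr_const continuous_on_norm piece_cont) auto
  note series = Lp_series[of p "\<lambda>j. piece_op \<sigma> N j f" a "Lp_norm p f" for f,
      OF p borel_measurable_torus_continuous[OF piece_cont] piece_int piece_bound a_pos a_summable Lp_norm_nonneg]
  have T_summable: "AE x in torus. summable (\<lambda>j. piece_op \<sigma> N j f x)" if "f \<in> Lp p" for f
    using series(1)[OF that] by eventually_elim (rule summable_norm_cancel)
  have "periodic (T f)" for f
    using periodic_piece_op[OF per] by (simp add: periodic_def T_def)
  then have T_Lp: "T f \<in> Lp p" if "f \<in> Lp p" for f
    using series(2,3)[OF that] by (simp add: Lp_def T_def[abs_def])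
  note integrable = Lp_integrable[OF p]
  have piece_cong: "piece_op \<sigma> N j f = piece_op \<sigma> N j g" if "fourier f = fourier g" for j f g
    by (simp add: piece_op_def[abs_def] that)
  have "bounded_op_Lp p T"
    unfolding bounded_op_Lp_def
  proof (intro conjI ballI allI impI exI[of _ "suminf a"])
    fix f g :: "real ^ 'n \<Rightarrow> complex" assume f: "f \<in> Lp p" and g: "g \<in> Lp p"
    show "AE x in torus. T f x = T g x" if "AE x in torus. f x = g x"
      using piece_cong[OF fourier_cong_AE[OF integrable[OF f] integrable[OF g] that]] by (simp add: T_def)
    show "AE x in torus. T (\<lambda>y. f y + g y) x = T f x + T g x"
      using T_summable[OF f] T_summable[OF g]
    proof eventually_elim
      case (elim x)
      have "piece_op \<sigma> N j (\<lambda>y. f y + g y) x = piece_op \<sigma> N j f x + piece_op \<sigma> N j g x" for j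
        unfolding piece_op_eq_sum fourier_add[OF integrable[OF f] integrable[OF g]]
        by (simp add: algebra_simps sum.distrib)
      then show ?case
        unfolding T_def using suminf_add[OF elim] by simp
    qed
  next
    fix f :: "real ^ 'n \<Rightarrow> complex" and c assume f: "f \<in> Lp p"
    show "AE x in torus. T (\<lambda>y. c * f y) x = c * T f x"
      using T_summable[OF f]
    proof eventually_elim
      case (elim x)
      have "piece_op \<sigma> N j (\<lambda>y. c * f y) x = c * piece_op \<sigma> N j f x" for j
        unfolding piece_op_eq_sum fourier_cmult by (simp add: sum_distrib_left mult_ac)
      then show ?case
        unfolding T_def using suminf_mult[OF elim, of c] by simp
    qed
  next
    fix f :: "real ^ 'n \<Rightarrow> complex" assume f: "f \<in> Lp p"
    show "T f \<in> Lp p" by (rule T_Lp[OF f])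
    show "Lp_norm p (T f) \<le> suminf a * Lp_norm p f"
      using series(4)[OF f] by (simp add: T_def[abs_def])
  qed
  moreover have "T f x = periodic_op \<sigma> f x" if f: "f \<in> smooth_torus" for f x
  proof -
    \<comment> \<open>Brackets are at least 1, so both negative powers are at most 1 and \<omega> is
      bounded by its value at 1.\<close>
    have "norm (\<sigma> x \<xi>) \<le> C * \<omega> 1" for \<xi>
    proof -
      define J where "J = japanese \<xi>"
      have J: "1 \<le> J" unfolding J_def by (rule japanese_ge_1)
      have "norm (\<sigma> x \<xi>) \<le> C * \<omega> (J powr (- \<epsilon>)) * J powr (- h)"
        using symbol[of 0 0 \<xi> x] by (simp add: msize_0 multi_op_0 h_def J_def)
      also have "\<dots> \<le> C * \<omega> 1 * 1"
      proof (intro mult_mono order_refl \<omega>_le)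
        show "J powr (- \<epsilon>) \<le> 1" "J powr (- h) \<le> 1"
          using J \<epsilon> h powr_mono[of "- \<epsilon>" 0 J] powr_mono[of "- h" 0 J] by auto
      qed (use C \<omega>_nonneg in auto)
      finally show ?thesis by simp
    qed
    then show ?thesis
      unfolding T_def by (rule sums_unique[OF piece_op_sums[OF fourier_abs_summable[OF f]], symmetric])
  qed
  ultimately show ?thesis
    unfolding extends_to_bounded_op_Lp_def by (intro exI[of _ T]) auto
qed

end
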